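(* Let $C_H^\epsilon$ be the concentration factor and let $\tilde r,\tilde r_1,\tilde r_2,\mu_1,\mu_2,\mathcal{Q}_k(r_1,r_2)$ be as defined in the context. (a) As $\epsilon\to 0^+$, $$C_H^\epsilon = C_H+O(\epsilon|\ln\epsilon|),$$ where $$C_H=4\pi\mu_1\sum_{m=0}^\infty\left[\frac{\tilde r}{m+1}H\Big(0,0,\frac{\tilde r}{m+1}\Big)-\frac{\tilde r}{m+\tilde r_2}H\Big(0,0,\frac{-\tilde r}{m+\tilde r_2}\Big)\right]+4\pi\mu_2\sum_{m=0}^\infty\left[\frac{\tilde r}{m+\tilde r_1}H\Big(0,0,\frac{\tilde r}{m+\tilde r_1}\Big)-\frac{\tilde r}{m+1}H\Big(0,0,\frac{-\tilde r}{m+1}\Big)\right].$$ (b) The constant $C_H$ can be rewritten as $$C_H=\sum_{k=1}^\infty b_{H,k}\,\mathcal{Q}_k(r_1,r_2),$$ where $b_{H,k}$ are the Taylor coefficients determined by $H(t\mathbf{e}_3)=H(\mathbf 0)+b_{H,1}t+b_{H,2}t^2+\cdots$, $t\in\mathbb{R}$, $\mathbf{e}_3=(0,0,1)$.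
   Context: Fix $r_1,r_2>0$ and a harmonic function $H$ on all of $\mathbb{R}^3$ (an "entire harmonic function"), all independent of $\epsilon$. For $\epsilon>0$ set $c_1=\frac{r_2^2-r_1^2-(r_1+r_2+\epsilon)^2}{2(r_1+r_2+\epsilon)}$, $c_2=c_1+r_1+r_2+\epsilon$, $\mathbf{c}_j=(0,0,c_j)$, and let $B_j=B(\mathbf{c}_j,r_j)$ be the open ball in $\mathbb{R}^3$, $j=1,2$ (the balls are at distance $\epsilon$). Let $\nu$ be the outward unit normal on $\partial B_j$ and $\partial_\nu$ the outward normal derivative. $u$ is the solution of: $\Delta u=0$ in $\mathbb{R}^3\setminus\overline{B_1\cup B_2}$; $u$ is constant on $\partial B_j$ for each $j=1,2$ (the constants are unknown and may differ); $\int_{\partial B_j}\partial_\nu u\,d\sigma=0$, $j=1,2$; $u(\mathbf x)-H(\mathbf x)=O(|\mathbf x|^{-2})$ as $|\mathbf x|\to\infty$. $h$ is the solution of: $\Delta h=0$ in $\mathbb{R}^3\setminus\overline{B_1\cup B_2}$; $h$ is constant on $\partial B_j$ for each $j=1,2$; $\int_{\partial B_j}\partial_\nu h\,d\sigma=(-1)^{j+1}$, $j=1,2$; $h(\mathbf x)=O(|\mathbf x|^{-2})$ as $|\mathbf x|\to\infty$. The concentration factor is $C_H^\epsilon=\dfrac{u|_{\partial B_1}-u|_{\partial B_2}}{h|_{\partial B_1}-h|_{\partial B_2}}$. Notation: $\tilde r=\frac{r_1r_2}{r_1+r_2}$, $\tilde r_j=\frac{r_j}{r_1+r_2}$; $\psi_k(z)=\frac{d^{k+1}}{dz^{k+1}}\ln\Gamma(z)$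 are the polygamma functions ($\psi_0$ the digamma function), $\gamma$ is Euler's constant, $\zeta$ the Riemann zeta function; $$\mu_j=\frac{\psi_0(\tilde r_j)+\gamma}{\psi_0(\tilde r_1)+\psi_0(\tilde r_2)+2\gamma},\quad j=1,2,$$ $$\mathcal{Q}_k(r_1,r_2)=4\pi\tilde r^{k+1}\left[\big(\mu_1+(-1)^{k+1}\mu_2\big)\zeta(k+1)+\frac{\mu_1\psi_k(\tilde r_2)+(-1)^{k+1}\mu_2\psi_k(\tilde r_1)}{k!}\right],\quad k\in\mathbb{N}.$$ *)

theory Defs
  imports "HOL-Analysis.Analysis" "HOL-Library.Landau_Symbols"
begin

definition partial_deriv :: "'n::finite \<Rightarrow> (real ^ 'n \<Rightarrow> real) \<Rightarrow> real ^ 'n \<Rightarrow> real" where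
  "partial_deriv i f x = frechet_derivative f (at x) (axis i 1)"

text \<open>\<open>C1_on\<close>, \<open>C2_on\<close> and \<open>harmonic_on\<close> are meant for open \<open>S\<close> only.\<close>

definition C1_on :: "(real ^ 'n::finite) set \<Rightarrow> (real ^ 'n \<Rightarrow> real) \<Rightarrow> bool" where
  "C1_on S f \<longleftrightarrow>
     (\<forall>x\<in>S. f differentiable (at x)) \<and> (\<forall>i. continuous_on S (partial_deriv i f))"

definition C2_on :: "(real ^ 'n::finite) set \<Rightarrow> (real ^ 'n \<Rightarrow> real) \<Rightarrow> bool" where
  "C2_on S f \<longleftrightarrow> C1_on S f \<and> (\<forall>i. C1_on S (partial_deriv i f))"

definition laplacian :: "(real ^ 'n::finite \<Rightarrow> real) \<Rightarrow> real ^ 'n \<Rightarrow> real" where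
  "laplacian f x = (\<Sum>i\<in>UNIV. partial_deriv i (partial_deriv i f) x)"

definition harmonic_on :: "(real ^ 'n::finite) set \<Rightarrow> (real ^ 'n \<Rightarrow> real) \<Rightarrow> bool" where
  "harmonic_on S f \<longleftrightarrow> C2_on S f \<and> (\<forall>x\<in>S. laplacian f x = 0)"

text \<open>Continuously differentiable up to the boundary: \<open>f\<close> and its gradient extend continuously
  from the open set \<open>S\<close> to its closure.\<close>

definition C1_up_to_boundary :: "(real ^ 'n::finite) set \<Rightarrow> (real ^ 'n \<Rightarrow> real) \<Rightarrow> bool" where
  "C1_up_to_boundary S f \<longleftrightarrow>
     continuous_on (closure S) f \<and>
     (\<exists>G. continuous_on (closure S) G \<and> (\<forall>x\<in>S. GDERIV f x :> G x))"

text \<open>Derivative of \<open>f\<close> at a point \<open>x\<close> of the sphere of centre \<open>c\<close> and radius \<open>r\<close> along the outward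
  unit normal. It is one-sided, because the functions of interest are only relevant outside
  the ball.\<close>

definition normal_deriv :: "real ^ 'n::finite \<Rightarrow> real \<Rightarrow> (real ^ 'n \<Rightarrow> real) \<Rightarrow> real ^ 'n \<Rightarrow> real" where
  "normal_deriv c r f x = Lim (at_right 0) (\<lambda>t. (f (x + t *\<^sub>R ((x - c) /\<^sub>R r)) - f x) / t)"

text \<open>The integral against surface measure, in spherical coordinates with area element
  \<open>r\<^sup>2 sin \<theta> d\<theta> d\<phi>\<close>.\<close>

definition sphere_integral :: "real ^ 3 \<Rightarrow> real \<Rightarrow> (real ^ 3 \<Rightarrow> real) \<Rightarrow> real" where
  "sphere_integral c r f =
     integral (cbox (0, 0) (pi, 2 * pi))
       (\<lambda>(\<theta>, \<phi>). f (c + r *\<^sub>R vector [sin \<theta> * cos \<phi>, sin \<theta> * sin \<phi>, cos \<theta>]) * r\<^sup>2 * sin \<theta>)"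

definition value_on :: "'a set \<Rightarrow> ('a \<Rightarrow> 'b) \<Rightarrow> 'b" where
  "value_on S f = (THE y. \<forall>x\<in>S. f x = y)"

definition center1 :: "real \<Rightarrow> real \<Rightarrow> real \<Rightarrow> real ^ 3" where
  "center1 r1 r2 \<epsilon> =
     vector [0, 0, (r2\<^sup>2 - r1\<^sup>2 - (r1 + r2 + \<epsilon>)\<^sup>2) / (2 * (r1 + r2 + \<epsilon>))]"

definition center2 :: "real \<Rightarrow> real \<Rightarrow> real \<Rightarrow> real ^ 3" where
  "center2 r1 r2 \<epsilon> =
     vector [0, 0, (r2\<^sup>2 - r1\<^sup>2 - (r1 + r2 + \<epsilon>)\<^sup>2) / (2 * (r1 + r2 + \<epsilon>)) + r1 + r2 + \<epsilon>]"

definition exterior_domain :: "real \<Rightarrow> real \<Rightarrow> real \<Rightarrow> (real ^ 3) set" where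
  "exterior_domain r1 r2 \<epsilon> =
     UNIV - closure (ball (center1 r1 r2 \<epsilon>) r1 \<union> ball (center2 r1 r2 \<epsilon>) r2)"

text \<open>Solutions are classical: \<open>C\<^sup>2\<close> in the exterior domain and \<open>C\<^sup>1\<close> up to its boundary, so that the
  boundary values and normal derivatives make sense. Values inside the balls are irrelevant.\<close>

definition is_u :: "real \<Rightarrow> real \<Rightarrow> (real ^ 3 \<Rightarrow> real) \<Rightarrow> real \<Rightarrow> (real ^ 3 \<Rightarrow> real) \<Rightarrow> bool" where
  "is_u r1 r2 H \<epsilon> u \<longleftrightarrow>
     harmonic_on (exterior_domain r1 r2 \<epsilon>) u \<and>
     C1_up_to_boundary (exterior_domain r1 r2 \<epsilon>) u \<and>
     u constant_on sphere (center1 r1 r2 \<epsilon>) r1 \<and>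
     u constant_on sphere (center2 r1 r2 \<epsilon>) r2 \<and>
     sphere_integral (center1 r1 r2 \<epsilon>) r1 (normal_deriv (center1 r1 r2 \<epsilon>) r1 u) = 0 \<and>
     sphere_integral (center2 r1 r2 \<epsilon>) r2 (normal_deriv (center2 r1 r2 \<epsilon>) r2 u) = 0 \<and>
     (\<lambda>x. u x - H x) \<in> O[at_infinity](\<lambda>x. 1 / (norm x)\<^sup>2)"

definition is_h :: "real \<Rightarrow> real \<Rightarrow> real \<Rightarrow> (real ^ 3 \<Rightarrow> real) \<Rightarrow> bool" where
  "is_h r1 r2 \<epsilon> h \<longleftrightarrow>
     harmonic_on (exterior_domain r1 r2 \<epsilon>) h \<and>
     C1_up_to_boundary (exterior_domain r1 r2 \<epsilon>) h \<and>
     h constant_on sphere (center1 r1 r2 \<epsilon>) r1 \<and>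
     h constant_on sphere (center2 r1 r2 \<epsilon>) r2 \<and>
     sphere_integral (center1 r1 r2 \<epsilon>) r1 (normal_deriv (center1 r1 r2 \<epsilon>) r1 h) = 1 \<and>
     sphere_integral (center2 r1 r2 \<epsilon>) r2 (normal_deriv (center2 r1 r2 \<epsilon>) r2 h) = - 1 \<and>
     h \<in> O[at_infinity](\<lambda>x. 1 / (norm x)\<^sup>2)"

definition concentration_factor ::
    "real \<Rightarrow> real \<Rightarrow> real \<Rightarrow> (real ^ 3 \<Rightarrow> real) \<Rightarrow> (real ^ 3 \<Rightarrow> real) \<Rightarrow> real" where
  "concentration_factor r1 r2 \<epsilon> u h =
     (value_on (sphere (center1 r1 r2 \<epsilon>) r1) u - value_on (sphere (center2 r1 r2 \<epsilon>) r2) u) /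
     (value_on (sphere (center1 r1 r2 \<epsilon>) r1) h - value_on (sphere (center2 r1 r2 \<epsilon>) r2) h)"

definition rt :: "real \<Rightarrow> real \<Rightarrow> real" where "rt r1 r2 = r1 * r2 / (r1 + r2)"
definition rt1 :: "real \<Rightarrow> real \<Rightarrow> real" where "rt1 r1 r2 = r1 / (r1 + r2)"
definition rt2 :: "real \<Rightarrow> real \<Rightarrow> real" where "rt2 r1 r2 = r2 / (r1 + r2)"

text \<open>The library's \<open>Polygamma k\<close> is the \<open>(k + 1)\<close>-st derivative of \<open>ln \<Gamma>\<close>, and \<open>Digamma\<close> is
  \<open>Polygamma 0\<close>.\<close>

definition mu1 :: "real \<Rightarrow> real \<Rightarrow> real" where
  "mu1 r1 r2 = (Digamma (rt1 r1 r2) + euler_mascheroni) /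
     (Digamma (rt1 r1 r2) + Digamma (rt2 r1 r2) + 2 * euler_mascheroni)"

definition mu2 :: "real \<Rightarrow> real \<Rightarrow> real" where
  "mu2 r1 r2 = (Digamma (rt2 r1 r2) + euler_mascheroni) /
     (Digamma (rt1 r1 r2) + Digamma (rt2 r1 r2) + 2 * euler_mascheroni)"

text \<open>Riemann's zeta function at the integers \<open>k \<ge> 2\<close>.\<close>

definition zeta_nat :: "nat \<Rightarrow> real" where
  "zeta_nat k = (\<Sum>n. 1 / real (Suc n) ^ k)"

definition Q :: "nat \<Rightarrow> real \<Rightarrow> real \<Rightarrow> real" where
  "Q k r1 r2 = 4 * pi * rt r1 r2 ^ (k + 1) *
     ((mu1 r1 r2 + (- 1) ^ (k + 1) * mu2 r1 r2) * zeta_nat (k + 1) +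
      (mu1 r1 r2 * Polygamma k (rt2 r1 r2) + (- 1) ^ (k + 1) * mu2 r1 r2 * Polygamma k (rt1 r1 r2))
        / fact k)"

definition C_term1 :: "real \<Rightarrow> real \<Rightarrow> (real ^ 3 \<Rightarrow> real) \<Rightarrow> nat \<Rightarrow> real" where
  "C_term1 r1 r2 H m =
     rt r1 r2 / (real m + 1) * H (vector [0, 0, rt r1 r2 / (real m + 1)]) -
     rt r1 r2 / (real m + rt2 r1 r2) * H (vector [0, 0, - rt r1 r2 / (real m + rt2 r1 r2)])"

definition C_term2 :: "real \<Rightarrow> real \<Rightarrow> (real ^ 3 \<Rightarrow> real) \<Rightarrow> nat \<Rightarrow> real" where
  "C_term2 r1 r2 H m =
     rt r1 r2 / (real m + rt1 r1 r2) * H (vector [0, 0, rt r1 r2 / (real m + rt1 r1 r2)]) -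
     rt r1 r2 / (real m + 1) * H (vector [0, 0, - rt r1 r2 / (real m + 1)])"

definition C_lim :: "real \<Rightarrow> real \<Rightarrow> (real ^ 3 \<Rightarrow> real) \<Rightarrow> real" where
  "C_lim r1 r2 H =
     4 * pi * mu1 r1 r2 * (\<Sum>m. C_term1 r1 r2 H m) + 4 * pi * mu2 r1 r2 * (\<Sum>m. C_term2 r1 r2 H m)"

definition taylor_coeff :: "(real ^ 3 \<Rightarrow> real) \<Rightarrow> nat \<Rightarrow> real" where
  "taylor_coeff H k = (deriv ^^ k) (\<lambda>t. H (t *\<^sub>R vector [0, 0, 1])) 0 / fact k"

end

theory Submission
  imports Defs "HOL-Complex_Analysis.Complex_Analysis" "HOL-Real_Asymp.Real_Asymp"
begin

text \<open>Green's identity against the charge \<open>1 / |x - p|\<close> with \<open>p\<close> in a ball \<open>B\<^sub>j\<close> relates the boundary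
  fluxes of \<open>u\<close> to \<open>H p\<close> and the boundary values of \<open>u\<close>. With the two spheres placed at
  \<open>\<mp>\<alpha> coth s\<^sub>j\<close>, where \<open>sinh s\<^sub>j = \<alpha> / r\<^sub>j\<close> and \<open>\<alpha>\<^sup>2 = O(\<epsilon>)\<close>, the charges
  \<open>\<alpha> / sinh a\<close> at \<open>\<alpha> coth a\<close> are reflected by the spheres through shifts of \<open>a\<close>. A sequence of such charges therefore has
  a telescoping potential that is \<open>1\<close> on one sphere and \<open>0\<close> on the other; summing Green's identity
  over it expresses the total fluxes explicitly through the boundary values. Hence the flux
  conditions form a \<open>2 \<times> 2\<close> linear system for \<open>u\<close> and one for \<open>h\<close>, and the concentration factor is a
  quotient of series in \<open>\<alpha> / sinh (\<sigma> + m s)\<close> and the values of \<open>H\<close> at the image points, \<open>s = s\<^sub>1 + s\<^sub>2\<close>.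
  As \<open>\<alpha> \<rightarrow> 0\<close> these charges tend to \<open>1 / (p + m q)\<close>. The errors that are constant or linear in the
  position are Riemann sums of a function with integral \<open>0\<close> and contribute \<open>O(\<alpha>\<^sup>2)\<close>; the
  higher order terms of \<open>H\<close> contribute \<open>O(\<alpha>\<^sup>2 |ln \<alpha>|)\<close>.\<close>

text \<open>The solutions \<open>u\<close> and \<open>h\<close> are given, not constructed; every
  fact about them comes from testing against explicit harmonic functions. The sums of
  \<open>\<alpha> / sinh (\<sigma> + m s)\<close> over \<open>m\<close> have no limit as \<alpha>
  tends to 0, because their terms tend to those of a harmonic series; so the entries of the linear
  system and its determinant diverge. Differences of two such sums do converge. Hence
  \<open>H 0\<close> is subtracted from \<open>H\<close>, and the system is solved only for
  differences of boundary values: the determinant is a factor of both of them and cancels in the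
  quotient. The rate is the second obstacle. As \<alpha> has the order of the square root of
  \<epsilon>, about \<open>1 / \<alpha>\<close> indices have \<open>\<sigma> + m s\<close> at most
  of order one, and there the constant and linear errors are of order
  \<open>\<alpha>\<^sup>2\<close>. Estimating term by term would leave an error of order \<alpha>;
  the vanishing integral supplies the missing factor \<alpha>.\<close>

no_notation fps_nth (infixl "$" 75)

section \<open>Integration in spherical coordinates\<close>

lemma has_derivative_vector_3:
  fixes f1 f2 f3 :: "'a::real_normed_vector \<Rightarrow> real"
  assumes "(f1 has_derivative d1) F" "(f2 has_derivative d2) F" "(f3 has_derivative d3) F"
  shows "((\<lambda>x. vector [f1 x, f2 x, f3 x] :: real ^ 3) has_derivative (\<lambda>h. vector [d1 h, d2 h, d3 h])) F"
proof -
  have "(\<lambda>x. vector [f1 x, f2 x, f3 x] :: real ^ 3) = (\<lambda>x. f1 x *\<^sub>R axis 1 1 + f2 x *\<^sub>R axis 2 1 + f3 x *\<^sub>R axis 3 1)"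
    for f1 f2 f3 :: "'a \<Rightarrow> real"
    by (auto simp: fun_eq_iff vec_eq_iff forall_3 axis_def)
  then show ?thesis
    by (simp only:) (intro derivative_intros assms)
qed

lemma continuous_on_vector_3 [continuous_intros]:
  fixes f1 f2 f3 :: "'a::topological_space \<Rightarrow> real"
  assumes "continuous_on S f1" "continuous_on S f2" "continuous_on S f3"
  shows "continuous_on S (\<lambda>x. vector [f1 x, f2 x, f3 x] :: real ^ 3)"
proof -
  have "(\<lambda>x. vector [f1 x, f2 x, f3 x] :: real ^ 3) = (\<lambda>x. f1 x *\<^sub>R axis 1 1 + f2 x *\<^sub>R axis 2 1 + f3 x *\<^sub>R axis 3 1)"
    by (auto simp: fun_eq_iff vec_eq_iff forall_3 axis_def)
  then show ?thesis
    by (simp only:) (intro continuous_intros assms)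
qed

lemma vector_3_eq_iff: "(x :: real ^ 3) = y \<longleftrightarrow> x $ 1 = y $ 1 \<and> x $ 2 = y $ 2 \<and> x $ 3 = y $ 3"
  by (simp add: vec_eq_iff forall_3)

lemma norm_vector_3_power2: "(norm (x :: real ^ 3))\<^sup>2 = (x $ 1)\<^sup>2 + (x $ 2)\<^sup>2 + (x $ 3)\<^sup>2"
  by (simp add: norm_vec_def L2_set_def sum_3)

definition direction :: "real \<Rightarrow> real \<Rightarrow> real ^ 3" where
  "direction \<theta> \<phi> = vector [sin \<theta> * cos \<phi>, sin \<theta> * sin \<phi>, cos \<theta>]"

lemma direction_nth [simp]:
  "direction \<theta> \<phi> $ 1 = sin \<theta> * cos \<phi>" "direction \<theta> \<phi> $ 2 = sin \<theta> * sin \<phi>" "direction \<theta> \<phi> $ 3 = cos \<theta>"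
  by (simp_all add: direction_def)

lemma norm_direction [simp]: "norm (direction \<theta> \<phi>) = 1"
proof -
  have "(sin \<theta> * cos \<phi>)\<^sup>2 + (sin \<theta> * sin \<phi>)\<^sup>2 + (cos \<theta>)\<^sup>2 = 1"
    using sin_cos_squared_add[of \<theta>] sin_cos_squared_add[of \<phi>] by algebra
  then have "(norm (direction \<theta> \<phi>))\<^sup>2 = 1\<^sup>2" by (simp add: norm_vector_3_power2)
  then show ?thesis by (metis norm_ge_zero power2_eq_iff_nonneg zero_le_one)
qed

lemma continuous_on_direction [continuous_intros]:
  fixes f g :: "'a::t2_space \<Rightarrow> real"
  assumes "continuous_on S f" "continuous_on S g"
  shows "continuous_on S (\<lambda>x. direction (f x) (g x))"
  unfolding direction_def by (intro continuous_intros assms)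

lemma sphere_integral_direction:
  "sphere_integral c r f =
    integral (cbox (0, 0) (pi, 2 * pi)) (\<lambda>z. f (c + r *\<^sub>R direction (fst z) (snd z)) * r\<^sup>2 * sin (fst z))"
  by (simp add: sphere_integral_def direction_def case_prod_unfold)

lemma exists_UNIV_3: "(\<exists>i::3. P i) \<longleftrightarrow> P 1 \<or> P 2 \<or> P 3"
  by (metis exhaust_3)

lemma prod_UNIV_3: "prod f (UNIV :: 3 set) = f 1 * f 2 * f 3"
  unfolding UNIV_3 by (simp add: ac_simps)

text \<open>Fubini in the form \<open>integral_prod_continuous\<close> speaks of product types. The
  reindexing \<open>g\<close> takes boxes to boxes of equal content, which is what
  \<open>has_integral_twiddle\<close> asks for, with content factor 1.\<close>

lemma integral_cbox_3_prod:
  fixes f :: "real ^ 3 \<Rightarrow> real"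
  assumes "f integrable_on cbox (vector [a1, a2, a3]) (vector [b1, b2, b3])"
  shows "integral (cbox (vector [a1, a2, a3]) (vector [b1, b2, b3])) f =
    integral (cbox (a1, a2, a3) (b1, b2, b3)) (\<lambda>z. f (vector [fst z, fst (snd z), snd (snd z)]))"
proof -
  define g :: "real \<times> real \<times> real \<Rightarrow> real ^ 3" where "g z = vector [fst z, fst (snd z), snd (snd z)]" for z
  define h :: "real ^ 3 \<Rightarrow> real \<times> real \<times> real" where "h x = (x $ 1, x $ 2, x $ 3)" for x
  have hg: "h (g x) = x" and gh: "g (h y) = y" for x y
    by (auto simp: h_def g_def vector_3_eq_iff)
  have gim: "g ` cbox u v = cbox (g u) (g v)" for u v
  proof (intro equalityI subsetI)
    fix y assume "y \<in> g ` cbox u v"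
    then show "y \<in> cbox (g u) (g v)"
      by (cases u; cases v) (auto simp: g_def mem_box_cart forall_3 cbox_Pair_eq)
  next
    fix y assume "y \<in> cbox (g u) (g v)"
    then have "h y \<in> cbox u v"
      by (cases u; cases v) (auto simp: g_def h_def mem_box_cart forall_3 cbox_Pair_eq)
    then show "y \<in> g ` cbox u v" by (metis gh image_eqI)
  qed
  have him: "h ` cbox u v = cbox (h u) (h v)" for u v
  proof -
    have "g ` cbox (h u) (h v) = cbox u v" by (simp add: gim gh)
    then have "h ` (g ` cbox (h u) (h v)) = h ` cbox u v" by simp
    moreover have "h ` (g ` cbox (h u) (h v)) = cbox (h u) (h v)" by (simp only: image_image hg image_ident)
    ultimately show ?thesis by simp
  qed
  have r: "measure lborel (g ` cbox u v) = 1 * measure lborel (cbox u v)" for u v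
  proof (cases u; cases v)
    fix u1 u2 u3 v1 v2 v3 :: real
    assume [simp]: "u = (u1, u2, u3)" "v = (v1, v2, v3)"
    show ?thesis
    proof (cases "u1 \<le> v1 \<and> u2 \<le> v2 \<and> u3 \<le> v3")
      case True
      then have "cbox (g u) (g v) \<noteq> {}" by (auto simp: interval_ne_empty_cart g_def forall_3)
      then have "measure lborel (cbox (g u) (g v)) = (v1 - u1) * ((v2 - u2) * (v3 - u3))"
        by (simp add: content_cbox_cart prod_UNIV_3 g_def)
      then show ?thesis using True by (simp add: gim content_Pair)
    next
      case False
      then have "cbox (g u) (g v) = {}"
        unfolding interval_eq_empty_cart exists_UNIV_3 by (simp add: g_def not_le)
      moreover have "cbox u v = {}" using False by (auto simp: cbox_Pair_eq)
      ultimately show ?thesis using gim[of u v] by simp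
    qed
  qed
  have contg: "continuous (at x) g" for x
    unfolding g_def continuous_on_eq_continuous_within[symmetric]
    by (rule continuous_on_interior[where S = UNIV]) (auto intro!: continuous_intros)
  have "((\<lambda>x. f (g x)) has_integral (1 / 1) *\<^sub>R integral (cbox (vector [a1, a2, a3]) (vector [b1, b2, b3])) f)
      (h ` cbox (vector [a1, a2, a3]) (vector [b1, b2, b3]))"
  proof (rule has_integral_twiddle[OF _ hg gh contg _ _ r])
    show "\<exists>w z. g ` cbox u v = cbox w z" for u v using gim by blast
    show "\<exists>w z. h ` cbox u v = cbox w z" for u v using him by blast
  qed (use assms in \<open>simp_all add: integrable_integral\<close>)
  then show ?thesis
    unfolding him by (simp add: h_def g_def integral_unique)
qed

lemma cos_sin_inj_2pi:
  assumes "cos x = cos y" "sin x = sin y" "0 < x" "x < 2 * pi" "0 < y" "y < 2 * pi"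
  shows "x = y"
proof -
  obtain n :: int where n: "x = y + 2 * pi * n" using assms(1,2) sin_cos_eq_iff[of x y] by auto
  have "\<bar>2 * pi * n\<bar> < 2 * pi * 1" using assms n unfolding abs_less_iff by linarith
  then have "\<bar>real_of_int n\<bar> < 1" unfolding abs_mult by simp
  then have "n = 0" by linarith
  then show ?thesis using n by simp
qed

text \<open>Change of variables by spherical coordinates, whose Jacobian
  \<open>\<rho>\<^sup>2 sin \<theta>\<close> is the area element in \<open>sphere_integral\<close>.
  On the open coordinate box the map is injective and misses only a null set of the shell.\<close>

lemma integral_shell:
  fixes f :: "real ^ 3 \<Rightarrow> real"
  assumes ab: "0 < a" "a < b" and cont: "continuous_on (cball c b - ball c a) f"
  shows "integral (cball c b - ball c a) f = integral {a..b} (\<lambda>\<rho>. sphere_integral c \<rho> f)"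
proof -
  define sh where "sh = cball c b - ball c a"
  have csh: "compact sh" unfolding sh_def by (intro compact_diff compact_cball open_ball)
  define T :: "real ^ 3 \<Rightarrow> real ^ 3" where "T y = c + y $ 1 *\<^sub>R direction (y $ 2) (y $ 3)" for y
  define T' :: "real ^ 3 \<Rightarrow> real ^ 3 \<Rightarrow> real ^ 3" where
    "T' y h = vector [sin (y$2) * cos (y$3) * h$1 + y$1 * (cos (y$2) * h$2 * cos (y$3) - sin (y$2) * (sin (y$3) * h$3)),
       sin (y$2) * sin (y$3) * h$1 + y$1 * (cos (y$2) * h$2 * sin (y$3) + sin (y$2) * (cos (y$3) * h$3)),
       cos (y$2) * h$1 - y$1 * (sin (y$2) * h$2)]" for y h
  define lo hi :: "real ^ 3" where "lo = vector [a, 0, 0]" and "hi = vector [b, pi, 2 * pi]"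
  define S where "S = box lo hi"
  have S_iff: "y \<in> S \<longleftrightarrow> a < y$1 \<and> y$1 < b \<and> 0 < y$2 \<and> y$2 < pi \<and> 0 < y$3 \<and> y$3 < 2 * pi" for y
    by (auto simp: S_def lo_def hi_def mem_box_cart forall_3)
  have T_alt: "T y = c + vector [y$1 * (sin (y$2) * cos (y$3)), y$1 * (sin (y$2) * sin (y$3)), y$1 * cos (y$2)]" for y
    by (auto simp: T_def vector_3_eq_iff)
  have der: "(T has_derivative T' y) (at y within S)" for y
    unfolding T_alt[abs_def] T'_def[abs_def]
    by (rule has_derivative_eq_rhs, rule has_derivative_add, rule has_derivative_const, rule has_derivative_vector_3)
      (auto intro!: derivative_eq_intros bounded_linear_imp_has_derivative[OF bounded_linear_vec_nth] simp: fun_eq_iff vector_3_eq_iff algebra_simps)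
  have det: "det (matrix (T' y)) = (y$1)\<^sup>2 * sin (y$2)" for y
  proof -
    have "det (matrix (T' y)) = (y$1)\<^sup>2 * sin (y$2) * (((sin (y$2))\<^sup>2 + (cos (y$2))\<^sup>2) * ((sin (y$3))\<^sup>2 + (cos (y$3))\<^sup>2))"
      unfolding det_3 matrix_def T'_def
      by (simp add: axis_def power2_eq_square ring_distribs mult.assoc mult.commute mult.left_commute)
    then show ?thesis by (simp only: sin_cos_squared_add mult_1_right)
  qed
  have inj: "inj_on T S"
  proof (rule inj_onI)
    fix x y assume x: "x \<in> S" and y: "y \<in> S" and e: "T x = T y"
    have e1: "x$1 *\<^sub>R direction (x$2) (x$3) = y$1 *\<^sub>R direction (y$2) (y$3)" using e by (simp add: T_def)
    have "norm (x$1 *\<^sub>R direction (x$2) (x$3)) = x$1" "norm (y$1 *\<^sub>R direction (y$2) (y$3)) = y$1"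
      using x y ab by (auto simp: S_iff)
    then have 1: "x$1 = y$1" using e1 by simp
    then have d: "direction (x$2) (x$3) = direction (y$2) (y$3)" using e1 x ab by (auto simp: S_iff)
    have "cos (x$2) = cos (y$2)" using d by (metis direction_nth(3))
    then have 2: "x$2 = y$2" using x y by (auto simp: S_iff intro!: cos_inj_pi)
    have "sin (x$2) > 0" using x by (auto simp: S_iff intro!: sin_gt_zero)
    moreover have "sin (x$2) * cos (x$3) = sin (x$2) * cos (y$3)" "sin (x$2) * sin (x$3) = sin (x$2) * sin (y$3)"
      using d 2 by (metis direction_nth(1), metis direction_nth(2))
    ultimately have "cos (x$3) = cos (y$3)" "sin (x$3) = sin (y$3)" by auto
    then have 3: "x$3 = y$3" using x y by (auto simp: S_iff intro!: cos_sin_inj_2pi)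
    show "x = y" using 1 2 3 by (simp add: vector_3_eq_iff)
  qed
  have T_in: "T y \<in> sh" if "y \<in> cbox lo hi" for y
    using that ab by (auto simp: T_def sh_def lo_def hi_def mem_box_cart forall_3 dist_norm)
  have Tsub: "T ` S \<subseteq> sh"
    using T_in box_subset_cbox[of lo hi] unfolding S_def by blast
  \<comment> \<open>The missed points lie on the two bounding spheres or on the half-plane
    \<open>\<phi> = 0\<close>, which is part of the plane \<open>x $ 2 = c $ 2\<close>.\<close>
  have surj: "sh - T ` S \<subseteq> sphere c a \<union> sphere c b \<union> {x. x$2 = c$2}"
  proof
    fix x assume x: "x \<in> sh - T ` S"
    show "x \<in> sphere c a \<union> sphere c b \<union> {x. x$2 = c$2}"
    proof (rule ccontr)
      assume n: "\<not> ?thesis"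
      define d where "d = x - c"
      define \<rho> where "\<rho> = norm d"
      have \<rho>: "a < \<rho>" "\<rho> < b" and d2: "d$2 \<noteq> 0"
        using x n by (auto simp: sh_def \<rho>_def d_def dist_norm norm_minus_commute)
      have sq: "\<rho>\<^sup>2 = (d$1)\<^sup>2 + (d$2)\<^sup>2 + (d$3)\<^sup>2" by (simp add: \<rho>_def norm_vector_3_power2)
      define s where "s = sqrt ((d$1)\<^sup>2 + (d$2)\<^sup>2)"
      have s0: "s > 0" using d2 by (auto simp: s_def add_nonneg_pos)
      have ss: "s\<^sup>2 = (d$1)\<^sup>2 + (d$2)\<^sup>2" by (simp add: s_def)
      have r0: "\<rho> > 0" using \<rho> ab by simp
      have "(d$3)\<^sup>2 + s\<^sup>2 = \<rho>\<^sup>2" using sq ss by simp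
      moreover have "(d$3 / \<rho>)\<^sup>2 + (s / \<rho>)\<^sup>2 = ((d$3)\<^sup>2 + s\<^sup>2) / \<rho>\<^sup>2"
        by (simp add: power_divide add_divide_distrib)
      ultimately have "(d$3 / \<rho>)\<^sup>2 + (s / \<rho>)\<^sup>2 = 1" using r0 by simp
      moreover have "0 \<le> s / \<rho>" using s0 r0 by simp
      ultimately obtain t where t: "0 \<le> t" "t \<le> pi" "d$3 / \<rho> = cos t" "s / \<rho> = sin t"
        using sincos_total_pi by metis
      have t': "0 < t" "t < pi" using t s0 r0 by (metis divide_pos_pos less_eq_real_def order_less_irrefl sin_pi sin_zero)+
      have "(d$1 / s)\<^sup>2 + (d$2 / s)\<^sup>2 = ((d$1)\<^sup>2 + (d$2)\<^sup>2) / s\<^sup>2"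
        by (simp add: power_divide add_divide_distrib)
      then have "(d$1 / s)\<^sup>2 + (d$2 / s)\<^sup>2 = 1" using s0 unfolding ss[symmetric] by simp
      then obtain p where p: "0 \<le> p" "p < 2 * pi" "d$1 / s = cos p" "d$2 / s = sin p"
        using sincos_total_2pi by metis
      have "p \<noteq> 0" using p d2 s0 by auto
      then have "(vector [\<rho>, t, p] :: real ^ 3) \<in> S" using p t' \<rho> by (auto simp: S_iff)
      moreover have "T (vector [\<rho>, t, p]) = x"
      proof -
        have "\<rho> * cos t = d$3" "\<rho> * sin t = s" using t(3,4)[symmetric] r0 by simp_all
        moreover have "s * cos p = d$1" "s * sin p = d$2" using p(3,4)[symmetric] s0 by simp_all
        ultimately have "\<rho> * cos t = d$3" "\<rho> * (sin t * cos p) = d$1" "\<rho> * (sin t * sin p) = d$2"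
          by (simp_all add: mult.assoc[symmetric])
        then show ?thesis unfolding T_alt by (simp add: vector_3_eq_iff d_def)
      qed
      ultimately show False using x by blast
    qed
  qed
  have neg: "negligible (sh - T ` S)"
    by (rule negligible_subset[OF _ surj])
      (use negligible_standard_hyperplane[of "axis 2 1 :: real ^ 3" "c $ 2"] in
        \<open>auto intro!: negligible_Un negligible_sphere simp: inner_axis\<close>)
  \<comment> \<open>\<open>integral_change_of_variables\<close> is about vector-valued functions, so
    the integrand is packed into \<open>real ^ 1\<close>.\<close>
  define F :: "real ^ 3 \<Rightarrow> real ^ 1" where "F x = vec (f x)" for x
  have "continuous_on sh F"
    unfolding F_def vec_def by (intro continuous_on_vec_lambda) (use cont in \<open>auto simp: sh_def\<close>)
  then have "integrable lborel (\<lambda>x. indicator sh x *\<^sub>R F x)"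
    by (intro borel_integrable_compact csh)
  then have aF: "F absolutely_integrable_on sh"
    by (simp add: set_integrable_def integrable_completion)
  have aF': "F absolutely_integrable_on T ` S"
  proof -
    have "(\<lambda>x. F x) absolutely_integrable_on T ` S \<longleftrightarrow> F absolutely_integrable_on sh"
      by (rule absolutely_integrable_spike_set_eq) (use Tsub neg in \<open>auto simp: Diff_eq_empty_iff[THEN iffD2] intro: negligible_subset\<close>)
    then show ?thesis using aF by simp
  qed
  have "integral sh f = integral (T ` S) f"
    by (rule integral_spike_set) (use Tsub neg in \<open>auto intro: negligible_subset\<close>)
  also have "\<dots> = integral S (\<lambda>y. \<bar>det (matrix (T' y))\<bar> * f (T y))"
  proof -
    have "integral (T ` S) F = integral S (\<lambda>y. \<bar>det (matrix (T' y))\<bar> *\<^sub>R F (T y))"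
      by (rule integral_change_of_variables[OF _ der inj]) (use aF' in \<open>auto simp: S_def\<close>)
    then show ?thesis
      by (simp add: integral_on_1_eq F_def)
  qed
  also have "\<dots> = integral S (\<lambda>y. f (T y) * (y$1)\<^sup>2 * sin (y$2))"
  proof (rule integral_cong)
    fix y assume "y \<in> S"
    then have "sin (y$2) \<ge> 0" by (auto simp: S_iff intro!: sin_ge_zero)
    then show "\<bar>det (matrix (T' y))\<bar> * f (T y) = f (T y) * (y$1)\<^sup>2 * sin (y$2)"
      by (simp add: det abs_mult)
  qed
  also have "\<dots> = integral (cbox lo hi) (\<lambda>y. f (T y) * (y$1)\<^sup>2 * sin (y$2))"
    unfolding S_def by (rule integral_open_interval)
  also have "\<dots> = integral (cbox (a, 0, 0) (b, pi, 2 * pi))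
      (\<lambda>z. f (c + fst z *\<^sub>R direction (fst (snd z)) (snd (snd z))) * (fst z)\<^sup>2 * sin (fst (snd z)))"
  proof -
    have "continuous_on (cbox lo hi) T"
      unfolding T_def by (intro continuous_intros)
    then have "continuous_on (cbox lo hi) (\<lambda>y. f (T y) * (y$1)\<^sup>2 * sin (y$2))"
      by (intro continuous_intros continuous_on_compose2[OF cont]) (use T_in in \<open>auto simp: sh_def\<close>)
    from integral_cbox_3_prod[OF integrable_continuous[OF this[unfolded lo_def hi_def]]]
    show ?thesis by (simp add: lo_def hi_def T_def)
  qed
  also have "\<dots> = integral (cbox a b) (\<lambda>\<rho>. integral (cbox (0, 0) (pi, 2 * pi))
      (\<lambda>z. f (c + \<rho> *\<^sub>R direction (fst z) (snd z)) * \<rho>\<^sup>2 * sin (fst z)))"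
  proof (rule trans[OF integral_prod_continuous])
    show "continuous_on (cbox (a, 0, 0) (b, pi, 2 * pi))
      (\<lambda>z. f (c + fst z *\<^sub>R direction (fst (snd z)) (snd (snd z))) * (fst z)\<^sup>2 * sin (fst (snd z)))"
      by (intro continuous_intros continuous_on_compose2[OF cont])
        (use ab in \<open>auto simp: cbox_Pair_eq dist_norm\<close>)
  qed simp
  finally show ?thesis
    by (simp add: sphere_integral_direction sh_def)
qed

section \<open>The divergence theorem outside spheres\<close>

text \<open>The integral of \<open>f\<close> is invariant under translation, so every difference
  quotient of \<open>f\<close> along \<open>e\<close> has integral 0. By the mean value theorem and
  uniform continuity the quotients approach \<open>D\<close> uniformly, and all functions involved
  live on one box.\<close>

lemma integral_directional_derivative_eq_0:
  fixes f D :: "'a::euclidean_space \<Rightarrow> real"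
  assumes der: "\<And>x. ((\<lambda>t. f (x + t *\<^sub>R e)) has_real_derivative D x) (at 0)"
    and contf: "continuous_on UNIV f" and contD: "continuous_on UNIV D"
    and supf: "\<And>x. norm x > R \<Longrightarrow> f x = 0" and supD: "\<And>x. norm x > R \<Longrightarrow> D x = 0"
  shows "integral UNIV D = 0" "D integrable_on UNIV"
proof -
  obtain a where a: "cball 0 (\<bar>R\<bar> + 2 * norm e + 1) \<subseteq> cbox (-a) (a::'a)"
    using bounded_subset_cbox_symmetric[OF bounded_cball] by metis
  have out: "norm x > \<bar>R\<bar> + 2 * norm e" if "x \<notin> cbox (-a) a" for x
    using a that by (force simp: not_le)
  have whole: "(g has_integral integral (cbox (-a) a) g) UNIV"
    if "continuous_on UNIV g" "\<And>x. norm x > R + 2 * norm e \<Longrightarrow> g x = 0" for g :: "'a \<Rightarrow> real"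
  proof (rule has_integral_on_superset)
    show "(g has_integral integral (cbox (-a) a) g) (cbox (-a) a)"
      by (intro integrable_integral integrable_continuous continuous_on_subset[OF that(1)]) simp
    show "g x = 0" if "x \<notin> cbox (-a) a" for x
      using out[OF that] \<open>\<And>x. norm x > R + 2 * norm e \<Longrightarrow> g x = 0\<close>[of x] by linarith
  qed simp
  have hD: "(D has_integral integral (cbox (-a) a) D) UNIV"
    using supD by (intro whole contD) (smt (verit) norm_ge_zero)
  then show intD: "D integrable_on UNIV" by blast
  have hf: "(f has_integral integral (cbox (-a) a) f) UNIV"
    using supf by (intro whole contf) (smt (verit) norm_ge_zero)
  have shift: "((\<lambda>x. f (x + c)) has_integral integral (cbox (-a) a) f) UNIV" for c
  proof (rule has_integral_on_superset)
    have "(f has_integral integral (cbox (-a) a) f) (cbox (-a) a)"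
      by (intro integrable_integral integrable_continuous continuous_on_subset[OF contf]) simp
    then show "((\<lambda>x. f (x + c)) has_integral integral (cbox (-a) a) f) (cbox (-a - c) (a - c))"
      by (rule has_integral_shift_cbox)
    show "f (x + c) = 0" if "x \<notin> cbox (-a - c) (a - c)" for x
    proof -
      have "x + c \<notin> cbox (-a) a" using that by (auto simp: mem_box algebra_simps)
      then show ?thesis using out[of "x + c"] supf[of "x + c"] norm_ge_zero[of e] by linarith
    qed
  qed simp
  have bound: "\<bar>integral UNIV D\<bar> \<le> d * measure lborel (cbox (-a) a)" if d: "d > 0" for d
  proof -
    \<comment> \<open>Arguments of norm up to \<open>\<bar>R\<bar> + 2 * norm e + 1\<close> will be
      moved by at most \<open>norm e\<close>, as \<open>t \<le> 1\<close>.\<close>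
    have "uniformly_continuous_on (cball 0 (\<bar>R\<bar> + 3 * norm e + 1)) D"
      by (intro compact_uniformly_continuous continuous_on_subset[OF contD]) auto
    then obtain d' where d': "d' > 0" "\<And>x y. norm x \<le> \<bar>R\<bar> + 3 * norm e + 1 \<Longrightarrow>
        norm y \<le> \<bar>R\<bar> + 3 * norm e + 1 \<Longrightarrow> dist y x < d' \<Longrightarrow> dist (D y) (D x) < d"
      using d unfolding uniformly_continuous_on_def by (metis mem_cball_0)
    define t where "t = min 1 (d' / (2 * (norm e + 1)))"
    have t: "t > 0" "t \<le> 1" "t * norm e < d'"
    proof -
      show "t > 0" "t \<le> 1" using d'(1) by (auto simp: t_def add_nonneg_pos)
      have "t * norm e \<le> d' / (2 * (norm e + 1)) * (norm e + 1)"
        using d'(1) by (intro mult_mono) (auto simp: t_def)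
      also have "\<dots> = d' / 2"
        by (metis add_nonneg_pos divide_divide_eq_left less_numeral_extra(1) nonzero_eq_divide_eq norm_ge_zero order_less_irrefl times_divide_eq_left mult.commute)
      finally show "t * norm e < d'" using d'(1) by linarith
    qed
    have close: "\<bar>D x - (f (x + t *\<^sub>R e) - f x) / t\<bar> \<le> d" for x
    proof (cases "norm x \<le> \<bar>R\<bar> + 2 * norm e + 1")
      case True
      have ders: "((\<lambda>s. f (x + s *\<^sub>R e)) has_real_derivative D (x + s *\<^sub>R e)) (at s)" for s
        using der[of "x + s *\<^sub>R e"] DERIV_shift[of "\<lambda>s. f (x + s *\<^sub>R e)" "D (x + s *\<^sub>R e)" 0 s]
        by (simp add: algebra_simps)
      have "\<exists>s. 0 < s \<and> s < t \<and> f (x + t *\<^sub>R e) - f (x + 0 *\<^sub>R e) = (t - 0) * D (x + s *\<^sub>R e)"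
        by (rule MVT2[OF t(1)]) (rule ders)
      then obtain s where s: "0 < s" "s < t" "f (x + t *\<^sub>R e) - f x = t * D (x + s *\<^sub>R e)" by auto
      have se: "norm (s *\<^sub>R e) \<le> t * norm e" using s by (auto intro!: mult_right_mono)
      have "t * norm e \<le> 1 * norm e" using t by (intro mult_right_mono) auto
      then have "norm (x + s *\<^sub>R e) \<le> \<bar>R\<bar> + 3 * norm e + 1"
        using norm_triangle_ineq[of x "s *\<^sub>R e"] se True by linarith
      then have "dist (D (x + s *\<^sub>R e)) (D x) < d"
        using d'(2)[of x "x + s *\<^sub>R e"] True se t(3) norm_ge_zero[of e] by (force simp: dist_norm)
      then show ?thesis using s t by (simp add: dist_real_def abs_minus_commute)
    next
      case False
      have "norm (t *\<^sub>R e) \<le> 1 * norm e" using t by (simp add: mult_left_le_one_le)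
      then have "norm (x + t *\<^sub>R e) > R"
        using norm_diff_ineq[of x "t *\<^sub>R e"] False norm_ge_zero[of e] by linarith
      moreover have "norm x > R" using False norm_ge_zero[of e] by linarith
      ultimately show ?thesis using supf supD d by auto
    qed
    define g where "g x = D x - (f (x + t *\<^sub>R e) - f x) / t" for x
    have "(g has_integral integral (cbox (-a) a) D -
        (integral (cbox (-a) a) f - integral (cbox (-a) a) f) / t) UNIV"
      unfolding g_def by (intro has_integral_diff hD has_integral_divide shift hf)
    then have "integral UNIV g = integral UNIV D" using hD by (simp add: integral_unique)
    moreover have "(g has_integral integral (cbox (-a) a) g) UNIV"
    proof (rule whole)
      show "continuous_on UNIV g" unfolding g_def
        by (intro continuous_intros contD contf continuous_on_compose2[OF contf]) (use t in auto)
      show "g x = 0" if "norm x > R + 2 * norm e" for x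
      proof -
        have "norm (t *\<^sub>R e) \<le> 1 * norm e" using t by (simp add: mult_left_le_one_le)
        then have "norm (x + t *\<^sub>R e) > R"
          using norm_diff_ineq[of x "t *\<^sub>R e"] that norm_ge_zero[of e] by linarith
        moreover have "norm x > R" using that norm_ge_zero[of e] by linarith
        ultimately show ?thesis using supf supD by (auto simp: g_def)
      qed
    qed
    moreover have "norm (integral (cbox (-a) a) g) \<le> d * measure lborel (cbox (-a) a)"
    proof (rule integrable_bound)
      show "g integrable_on cbox (-a) a" unfolding g_def
        by (intro integrable_continuous continuous_intros continuous_on_subset[OF contD] continuous_on_subset[OF contf]
            continuous_on_compose2[OF contf]) (use t in auto)
    qed (use close d in \<open>auto simp: g_def\<close>)
    ultimately show ?thesis by (simp add: integral_unique)
  qed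
  have "\<bar>integral UNIV D\<bar> \<le> 0 + e'" if "e' > 0" for e'
  proof -
    define m where "m = measure lborel (cbox (-a) a) + 1"
    have m: "m > 0" "measure lborel (cbox (-a) a) \<le> m" by (auto simp: m_def add_nonneg_pos)
    have "e' / m * measure lborel (cbox (-a) a) \<le> e' / m * m"
      using m that by (intro mult_left_mono) auto
    then show ?thesis using bound[of "e' / m"] m that by simp
  qed
  then show "integral UNIV D = 0" using field_le_epsilon[of "\<bar>integral UNIV D\<bar>" 0] by auto
qed

section \<open>A continuously differentiable cutoff\<close>

definition smooth_step :: "real \<Rightarrow> real" where
  "smooth_step t = 2 * ((max 0 t)\<^sup>2 - 2 * (max 0 (t - 1/2))\<^sup>2 + (max 0 (t - 1))\<^sup>2)"

text \<open>The tent function on [0, 1] with peak 2 and area 1; \<open>smooth_step\<close> is its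
  antiderivative. One continuous derivative suffices, since the divergence of a cut-off field
  differentiates the cutoff once.\<close>

definition smooth_step' :: "real \<Rightarrow> real" where
  "smooth_step' t = 4 * (max 0 t - 2 * max 0 (t - 1/2) + max 0 (t - 1))"

lemma has_real_derivative_max_0_power2: "((\<lambda>t::real. (max 0 t)\<^sup>2) has_real_derivative 2 * max 0 t) (at t)"
proof -
  consider "t > 0" | "t < 0" | "t = 0" by linarith
  then show ?thesis
  proof cases
    case 1
    show ?thesis
      by (rule has_field_derivative_transform_within_open[of "\<lambda>t. t\<^sup>2" _ _ "{0<..}"])
        (use 1 in \<open>auto intro!: derivative_eq_intros\<close>)
  next
    case 2
    show ?thesis
      by (rule has_field_derivative_transform_within_open[of "\<lambda>t. 0" _ _ "{..<0}"]) (use 2 in auto)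
  next
    case 3
    have "((\<lambda>h::real. (max 0 h)\<^sup>2 / h) \<longlongrightarrow> 0) (at 0)"
    proof (rule Lim_null_comparison)
      show "\<forall>\<^sub>F h in at 0. norm ((max 0 h)\<^sup>2 / h) \<le> \<bar>h::real\<bar>"
        by (intro always_eventually allI) (auto simp: max_def power2_eq_square)
      show "((\<lambda>h::real. \<bar>h\<bar>) \<longlongrightarrow> 0) (at 0)" by (auto intro!: tendsto_eq_intros)
    qed
    then show ?thesis using 3 by (simp add: DERIV_def)
  qed
qed

lemma smooth_step_derivative [derivative_intros]:
  assumes "(f has_real_derivative f') (at x within S)"
  shows "((\<lambda>x. smooth_step (f x)) has_real_derivative smooth_step' (f x) * f') (at x within S)"
proof -
  have "(smooth_step has_real_derivative smooth_step' t) (at t)" for t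
    unfolding smooth_step_def[abs_def] smooth_step'_def
    by (rule derivative_eq_intros DERIV_chain2[OF has_real_derivative_max_0_power2] refl | simp)+
  from DERIV_chain2[OF this assms] show ?thesis .
qed

lemma continuous_on_smooth_step' [continuous_intros]:
  "continuous_on S f \<Longrightarrow> continuous_on S (\<lambda>x. smooth_step' (f x))"
  unfolding smooth_step'_def by (intro continuous_intros)

lemma continuous_on_smooth_step [continuous_intros]:
  "continuous_on S f \<Longrightarrow> continuous_on S (\<lambda>x. smooth_step (f x))"
  unfolding smooth_step_def by (intro continuous_intros)

lemma smooth_step_eq_0: "t \<le> 0 \<Longrightarrow> smooth_step t = 0"
  by (simp add: smooth_step_def)

lemma smooth_step_eq_1: "t \<ge> 1 \<Longrightarrow> smooth_step t = 1"
  by (simp add: smooth_step_def max_def power2_eq_square algebra_simps)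

lemma smooth_step'_eq_0: "t \<le> 0 \<or> t \<ge> 1 \<Longrightarrow> smooth_step' t = 0"
  by (auto simp: smooth_step'_def max_def)

lemma smooth_step'_nonneg: "smooth_step' t \<ge> 0"
  by (auto simp: smooth_step'_def max_def)

section \<open>Integrals and fluxes over spheres\<close>

lemma continuous_on_sphere_integral:
  assumes "0 \<le> a" "continuous_on (cball c b - ball c a) f"
  shows "continuous_on {a..b} (\<lambda>r. sphere_integral c r f)"
  unfolding sphere_integral_direction
proof (rule integral_continuous_on_param)
  show "continuous_on ({a..b} \<times> cbox (0, 0) (pi, 2 * pi))
     (\<lambda>(r, z). f (c + r *\<^sub>R direction (fst z) (snd z)) * r\<^sup>2 * sin (fst z))"
    unfolding case_prod_unfold
    by (intro continuous_intros continuous_on_compose2[OF assms(2)]) (use assms(1) in \<open>auto simp: dist_norm\<close>)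
qed

lemma sphere_integral_cong:
  assumes "r \<ge> 0" "\<And>x. dist c x = r \<Longrightarrow> f x = g x"
  shows "sphere_integral c r f = sphere_integral c r g"
  unfolding sphere_integral_direction
  by (rule integral_cong) (use assms in \<open>auto simp: dist_norm\<close>)

lemma continuous_on_sphere_param:
  assumes "r \<ge> 0" "continuous_on (sphere c r) f"
  shows "continuous_on S (\<lambda>z. f (c + r *\<^sub>R direction (fst z) (snd z)))"
  by (intro continuous_on_compose2[OF assms(2)] continuous_intros) (use assms in \<open>auto simp: dist_norm\<close>)

lemma integrable_sphere_param:
  assumes "r \<ge> 0" "continuous_on (sphere c r) f"
  shows "(\<lambda>z. f (c + r *\<^sub>R direction (fst z) (snd z)) * r\<^sup>2 * sin (fst z)) integrable_on cbox (0, 0) (pi, 2 * pi)"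
  by (intro integrable_continuous continuous_intros continuous_on_sphere_param assms)

lemma sphere_integral_cmult: "sphere_integral c r (\<lambda>x. k * f x) = k * sphere_integral c r f"
  unfolding sphere_integral_direction integral_mult_right[symmetric] by (simp add: mult.assoc)

lemma sphere_integral_diff:
  assumes "r \<ge> 0" "continuous_on (sphere c r) f" "continuous_on (sphere c r) g"
  shows "sphere_integral c r (\<lambda>x. f x - g x) = sphere_integral c r f - sphere_integral c r g"
  unfolding sphere_integral_direction
  using integral_diff[OF integrable_sphere_param[OF assms(1,2)] integrable_sphere_param[OF assms(1,3)]]
  by (simp add: algebra_simps)

lemma sphere_integral_const: "sphere_integral c r (\<lambda>x. k) = 4 * pi * r\<^sup>2 * k"
proof -
  have "(sin has_integral (- cos pi) - (- cos 0)) {0..pi}"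
    by (rule fundamental_theorem_of_calculus)
      (auto intro!: derivative_eq_intros simp: has_real_derivative_iff_has_vector_derivative[symmetric])
  then have s: "integral {0..pi} sin = (2::real)" by (simp add: integral_unique)
  have "sphere_integral c r (\<lambda>x. k) = integral (cbox (0, 0) (pi, 2 * pi)) (\<lambda>z. k * r\<^sup>2 * sin (fst z))"
    by (simp add: sphere_integral_direction)
  also have "\<dots> = integral (cbox 0 pi) (\<lambda>x. integral (cbox 0 (2 * pi)) (\<lambda>y. k * r\<^sup>2 * sin (fst (x, y))))"
    by (rule integral_prod_continuous) (intro continuous_intros)
  also have "\<dots> = integral {0..pi} (\<lambda>x. (2 * pi * k * r\<^sup>2) * sin x)"
    by (simp add: mult_ac)
  also have "\<dots> = 2 * pi * k * r\<^sup>2 * 2"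
    unfolding integral_mult_right using s by simp
  finally show ?thesis by simp
qed

lemma sphere_integral_abs_le:
  assumes "r \<ge> 0" "continuous_on (sphere c r) f" "\<And>x. dist c x = r \<Longrightarrow> \<bar>f x\<bar> \<le> B"
  shows "\<bar>sphere_integral c r f\<bar> \<le> 4 * pi * r\<^sup>2 * B"
proof -
  have "norm (sphere_integral c r f) \<le> integral (cbox (0, 0) (pi, 2 * pi)) (\<lambda>z. B * r\<^sup>2 * sin (fst z))"
    unfolding sphere_integral_direction
  proof (rule integral_norm_bound_integral)
    show "(\<lambda>z. f (c + r *\<^sub>R direction (fst z) (snd z)) * r\<^sup>2 * sin (fst z)) integrable_on cbox (0, 0) (pi, 2 * pi)"
      by (rule integrable_sphere_param[OF assms(1,2)])
    show "(\<lambda>z::real\<times>real. B * r\<^sup>2 * sin (fst z)) integrable_on cbox (0, 0) (pi, 2 * pi)"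
      by (intro integrable_continuous continuous_intros)
    fix z :: "real \<times> real" assume z: "z \<in> cbox (0, 0) (pi, 2 * pi)"
    then have s: "sin (fst z) \<ge> 0" by (cases z) (auto intro!: sin_ge_zero simp: cbox_Pair_eq)
    have "\<bar>f (c + r *\<^sub>R direction (fst z) (snd z))\<bar> \<le> B" using assms(1) by (intro assms(3)) (simp add: dist_norm)
    then have "\<bar>f (c + r *\<^sub>R direction (fst z) (snd z))\<bar> * r\<^sup>2 * sin (fst z) \<le> B * r\<^sup>2 * sin (fst z)"
      by (intro mult_right_mono s) auto
    then show "norm (f (c + r *\<^sub>R direction (fst z) (snd z)) * r\<^sup>2 * sin (fst z)) \<le> B * r\<^sup>2 * sin (fst z)"
      using s by (simp add: abs_mult)
  qed
  also have "\<dots> = sphere_integral c r (\<lambda>x. B)" by (simp add: sphere_integral_direction)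
  finally show ?thesis by (simp add: sphere_integral_const)
qed

definition sphere_flux :: "(real ^ 3 \<Rightarrow> real ^ 3) \<Rightarrow> real ^ 3 \<Rightarrow> real \<Rightarrow> real" where
  "sphere_flux F c r = sphere_integral c r (\<lambda>x. F x \<bullet> (x - c) / r)"

text \<open>With \<open>norm (x - c)\<close> in place of \<open>r\<close> the integrand is one
  function of \<open>x\<close> for all radii, so \<open>continuous_on_sphere_integral\<close> gives
  continuity in the radius.\<close>

lemma sphere_flux_alt:
  "r \<ge> 0 \<Longrightarrow> sphere_flux F c r = sphere_integral c r (\<lambda>x. F x \<bullet> (x - c) / norm (x - c))"
  unfolding sphere_flux_def by (rule sphere_integral_cong) (auto simp: dist_norm norm_minus_commute)

lemma continuous_on_sphere_flux:
  assumes "0 < a" "continuous_on (cball c b - ball c a) F"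
  shows "continuous_on {a..b} (sphere_flux F c)"
proof -
  have "continuous_on {a..b} (\<lambda>r. sphere_integral c r (\<lambda>x. F x \<bullet> (x - c) / norm (x - c)))"
    using assms(1)
    by (intro continuous_on_sphere_integral continuous_intros assms(2)) auto
  then show ?thesis
    by (rule continuous_on_cong[THEN iffD1, rotated 2]) (use assms in \<open>auto simp: sphere_flux_alt\<close>)
qed

text \<open>The weight is the derivative in \<open>r\<close> of
  \<open>smooth_step ((r\<^sup>2 - \<rho>\<^sup>2) / \<delta>)\<close>, which rises from 0 to 1 over
  the shell: a probability density in the radius.\<close>

lemma smooth_step_weight:
  assumes "\<rho> > 0" "\<delta> > 0"
  shows "((\<lambda>r. smooth_step' ((r\<^sup>2 - \<rho>\<^sup>2) / \<delta>) * (2 * r / \<delta>)) has_integral 1) {\<rho>..sqrt (\<rho>\<^sup>2 + \<delta>)}"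
proof -
  have le: "\<rho> \<le> sqrt (\<rho>\<^sup>2 + \<delta>)" using assms by (simp add: real_le_rsqrt)
  have "((\<lambda>r. smooth_step' ((r\<^sup>2 - \<rho>\<^sup>2) / \<delta>) * (2 * r / \<delta>)) has_integral
     smooth_step (((sqrt (\<rho>\<^sup>2 + \<delta>))\<^sup>2 - \<rho>\<^sup>2) / \<delta>) - smooth_step ((\<rho>\<^sup>2 - \<rho>\<^sup>2) / \<delta>)) {\<rho>..sqrt (\<rho>\<^sup>2 + \<delta>)}"
    by (rule fundamental_theorem_of_calculus[OF le])
      (use assms in \<open>auto intro!: derivative_eq_intros simp: has_real_derivative_iff_has_vector_derivative[symmetric]\<close>)
  then show ?thesis using assms by (simp add: smooth_step_eq_0 smooth_step_eq_1)
qed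

text \<open>The densities concentrate at \<rho> from outside, so averages against them converge to
  the value of a continuous function there.\<close>

lemma smooth_step_average_tendsto:
  assumes "\<rho> > 0" "\<delta>0 > 0" and cont: "continuous_on {\<rho>..sqrt (\<rho>\<^sup>2 + \<delta>0)} g"
  shows "((\<lambda>\<delta>. integral {\<rho>..sqrt (\<rho>\<^sup>2 + \<delta>)} (\<lambda>r. smooth_step' ((r\<^sup>2 - \<rho>\<^sup>2) / \<delta>) * (2 * r / \<delta>) * g r))
    \<longlongrightarrow> g \<rho>) (at_right 0)"
proof (rule tendstoI)
  fix e :: real assume e: "e > 0"
  have "\<rho> \<in> {\<rho>..sqrt (\<rho>\<^sup>2 + \<delta>0)}" using assms by (simp add: real_le_rsqrt)
  then obtain d where d: "d > 0" "\<And>r. r \<in> {\<rho>..sqrt (\<rho>\<^sup>2 + \<delta>0)} \<Longrightarrow> dist r \<rho> < d \<Longrightarrow> dist (g r) (g \<rho>) < e / 2"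
    using cont e unfolding continuous_on_iff by (metis half_gt_zero)
  have "((\<lambda>\<delta>. sqrt (\<rho>\<^sup>2 + \<delta>)) \<longlongrightarrow> sqrt (\<rho>\<^sup>2 + 0)) (at_right 0)"
    by (intro tendsto_intros)
  then have "\<forall>\<^sub>F \<delta> in at_right 0. sqrt (\<rho>\<^sup>2 + \<delta>) < \<rho> + d"
    by (rule order_tendstoD) (use assms d in simp)
  moreover have "\<forall>\<^sub>F \<delta> in at_right 0. \<delta> < \<delta>0" using eventually_at_right[OF assms(2)] assms(2) by auto
  moreover have "\<forall>\<^sub>F \<delta> in at_right (0::real). \<delta> > 0" by (simp add: eventually_at_right_less)
  ultimately show "\<forall>\<^sub>F \<delta> in at_right 0. dist (integral {\<rho>..sqrt (\<rho>\<^sup>2 + \<delta>)}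
      (\<lambda>r. smooth_step' ((r\<^sup>2 - \<rho>\<^sup>2) / \<delta>) * (2 * r / \<delta>) * g r)) (g \<rho>) < e"
  proof eventually_elim
    case (elim \<delta>)
    define w where "w r = smooth_step' ((r\<^sup>2 - \<rho>\<^sup>2) / \<delta>) * (2 * r / \<delta>)" for r
    let ?I = "{\<rho>..sqrt (\<rho>\<^sup>2 + \<delta>)}"
    have w: "(w has_integral 1) ?I" unfolding w_def by (rule smooth_step_weight) (use assms elim in auto)
    have sub: "?I \<subseteq> {\<rho>..sqrt (\<rho>\<^sup>2 + \<delta>0)}" using elim by (auto intro: order_trans)
    have contw: "continuous_on ?I w" unfolding w_def by (intro continuous_intros) (use elim in auto)
    have w0: "w r \<ge> 0" if "r \<in> ?I" for r
      unfolding w_def by (intro mult_nonneg_nonneg divide_nonneg_nonneg smooth_step'_nonneg) (use that assms elim in auto)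
    have i1: "(\<lambda>r. w r * g r) integrable_on ?I"
      by (intro integrable_continuous_real continuous_intros contw continuous_on_subset[OF cont sub])
    have "((\<lambda>r. w r * g \<rho>) has_integral 1 * g \<rho>) ?I" by (intro has_integral_mult_left w)
    then have "((\<lambda>r. w r * g r - w r * g \<rho>) has_integral integral ?I (\<lambda>r. w r * g r) - g \<rho>) ?I"
      using has_integral_diff[OF integrable_integral[OF i1]] by simp
    then have i2: "(\<lambda>r. w r * g r - w r * g \<rho>) integrable_on ?I"
      and i3: "integral ?I (\<lambda>r. w r * g r) - g \<rho> = integral ?I (\<lambda>r. w r * g r - w r * g \<rho>)"
      by (auto simp: integral_unique)
    note i3
    also have "norm \<dots> \<le> integral ?I (\<lambda>r. w r * (e / 2))"
    proof (rule integral_norm_bound_integral[OF i2])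
      show "(\<lambda>r. w r * (e / 2)) integrable_on ?I" using has_integral_mult_left[OF w] by blast
      fix r assume r: "r \<in> ?I"
      then have "r \<in> {\<rho>..sqrt (\<rho>\<^sup>2 + \<delta>0)}" using sub by blast
      then have "dist (g r) (g \<rho>) < e / 2" using d(2)[of r] r elim by (auto simp: dist_real_def)
      then have "w r * \<bar>g r - g \<rho>\<bar> \<le> w r * (e / 2)" using w0[OF r] by (intro mult_left_mono) (auto simp: dist_real_def)
      then show "norm (w r * g r - w r * g \<rho>) \<le> w r * (e / 2)"
        using w0[OF r] by (simp add: abs_mult right_diff_distrib[symmetric])
    qed
    also have "\<dots> = 1 * (e / 2)" by (rule integral_unique[OF has_integral_mult_left[OF w]])
    finally show ?case using e by (simp add: dist_real_def w_def)
  qed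
qed

text \<open>Only the divergence theorem for compactly supported fields is needed: cut the field off with
  a combination of radial steps and let the width of the steps tend to \<open>0\<close>.\<close>

lemma sum_sphere_flux_eq_0:
  fixes F :: "real ^ 3 \<Rightarrow> real ^ 3" and dF :: "3 \<Rightarrow> real ^ 3 \<Rightarrow> real" and c :: "'i \<Rightarrow> real ^ 3"
  assumes \<Omega>: "open \<Omega>" and K: "compact K" "K \<subseteq> \<Omega>"
    and F: "continuous_on \<Omega> F" "\<And>i. continuous_on \<Omega> (dF i)"
    and dF: "\<And>i x. x \<in> \<Omega> \<Longrightarrow> ((\<lambda>t. F (x + t *\<^sub>R axis i 1) $ i) has_real_derivative dF i x) (at 0)"
    and div: "\<And>x. x \<in> \<Omega> \<Longrightarrow> (\<Sum>i\<in>UNIV. dF i x) = 0"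
    and J: "finite J" "\<And>j. j \<in> J \<Longrightarrow> \<rho> j > 0"
    and d0: "\<eta> > 0"
    and shell: "\<And>j. j \<in> J \<Longrightarrow> cball (c j) (sqrt ((\<rho> j)\<^sup>2 + \<eta>)) - ball (c j) (\<rho> j) \<subseteq> \<Omega>"
    and cut: "\<And>\<delta> x. 0 < \<delta> \<Longrightarrow> \<delta> < \<eta> \<Longrightarrow> x \<notin> K \<Longrightarrow>
      k + (\<Sum>j\<in>J. \<sigma> j * smooth_step (((norm (x - c j))\<^sup>2 - (\<rho> j)\<^sup>2) / \<delta>)) = 0"
  shows "(\<Sum>j\<in>J. \<sigma> j * sphere_flux F (c j) (\<rho> j)) = 0"
proof -
  \<comment> \<open>For a fixed width the cut-off field has compact support, so its divergence
    integrates to 0. As \<open>F\<close> is divergence free, only the gradient of the cutoff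
    contributes. It lives on the shells, where it produces weighted averages of the fluxes.\<close>
  have fixed: "(\<Sum>j\<in>J. \<sigma> j * integral {\<rho> j..sqrt ((\<rho> j)\<^sup>2 + \<delta>)}
      (\<lambda>r. smooth_step' ((r\<^sup>2 - (\<rho> j)\<^sup>2) / \<delta>) * (2 * r / \<delta>) * sphere_flux F (c j) r)) = 0"
    if \<delta>: "0 < \<delta>" "\<delta> < \<eta>" for \<delta>
  proof -
    \<comment> \<open>The step is applied to the squared distance, which is differentiable at the
      centre as well.\<close>
    define cf where "cf x = k + (\<Sum>j\<in>J. \<sigma> j * smooth_step (((norm (x - c j))\<^sup>2 - (\<rho> j)\<^sup>2) / \<delta>))" for x
    define s' where "s' j x = smooth_step' (((norm (x - c j))\<^sup>2 - (\<rho> j)\<^sup>2) / \<delta>)" for j x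
    define dcf where "dcf i x = (\<Sum>j\<in>J. \<sigma> j * (s' j x * (2 * (x - c j) $ i / \<delta>)))" for i :: 3 and x
    have dcf: "((\<lambda>t. cf (x + t *\<^sub>R axis i 1)) has_real_derivative dcf i x) (at 0)" for i x
    proof -
      have nd: "((\<lambda>t. (norm (x + t *\<^sub>R axis i 1 - c j))\<^sup>2) has_real_derivative 2 * (x - c j) $ i) (at 0)" for j
      proof -
        have "(norm (x + t *\<^sub>R axis i 1 - c j))\<^sup>2 = (norm (x - c j))\<^sup>2 + 2 * t * (x - c j) $ i + t\<^sup>2" for t
          unfolding power2_norm_eq_inner
          by (simp add: algebra_simps inner_axis inner_axis' inner_axis_axis inner_commute power2_eq_square)
        then show ?thesis by (auto intro!: derivative_eq_intros)
      qed
      have "((\<lambda>t. \<sigma> j * smooth_step (((norm (x + t *\<^sub>R axis i 1 - c j))\<^sup>2 - (\<rho> j)\<^sup>2) / \<delta>)) has_real_derivative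
          \<sigma> j * (s' j x * (2 * (x - c j) $ i / \<delta>))) (at 0)" for j
        using DERIV_cmult[OF smooth_step_derivative[OF DERIV_cdivide[OF DERIV_diff[OF nd[of j]
            DERIV_const[of "(\<rho> j)\<^sup>2"]], of \<delta>]], of "\<sigma> j"] by (simp add: s'_def)
      from DERIV_add[OF DERIV_const[of k] DERIV_sum[of J, OF this]]
      show ?thesis unfolding cf_def dcf_def by simp
    qed
    have cf0: "cf x = 0" if "x \<notin> K" for x using cut[OF \<delta> that] by (simp add: cf_def)
    have oK: "open (- K)" using compact_imp_closed[OF K(1)] by auto
    have line: "\<forall>\<^sub>F t in nhds 0. x + t *\<^sub>R e \<in> U" if "open U" "x \<in> U" for x e :: "real ^ 3" and U
    proof -
      have "((\<lambda>t. x + t *\<^sub>R e) \<longlongrightarrow> x + 0 *\<^sub>R e) (nhds 0)" by (intro tendsto_intros filterlim_ident)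
      then show ?thesis using topological_tendstoD[of "\<lambda>t. x + t *\<^sub>R e"] that by simp
    qed
    have dcf0: "dcf i x = 0" if "x \<notin> K" for i x
    proof -
      have "((\<lambda>t. 0) has_real_derivative dcf i x) (at 0)"
        by (rule DERIV_cong_ev[THEN iffD1, OF refl _ refl dcf[of x i]])
          (use line[OF oK, of x "axis i 1"] that in \<open>auto elim!: eventually_mono simp: cf0\<close>)
      then show ?thesis using DERIV_unique[OF _ DERIV_const[of 0]] by blast
    qed
    have contcf: "continuous_on S cf" "continuous_on S (dcf i)" "continuous_on S (s' j)" for S i j
      unfolding cf_def[abs_def] dcf_def[abs_def] s'_def[abs_def] using \<delta> by (auto intro!: continuous_intros)
    \<comment> \<open>Extension by 0 keeps continuity: \<open>\<Omega>\<close> and the complement of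
      \<open>K\<close> are open and cover the space, and the cutoff vanishes off
      \<open>K\<close>.\<close>
    define V where "V i x = (if x \<in> \<Omega> then cf x * F x $ i else 0)" for i :: 3 and x
    define D where "D i x = (if x \<in> \<Omega> then dcf i x * F x $ i + cf x * dF i x else 0)" for i :: 3 and x
    have V0: "V i x = 0" and D0: "D i x = 0" if "x \<notin> K" for i x
      using cf0[OF that] dcf0[OF that] by (auto simp: V_def D_def)
    have cU: "continuous_on UNIV g" if "continuous_on \<Omega> g" "\<And>x. x \<notin> K \<Longrightarrow> g x = 0" for g :: "real ^ 3 \<Rightarrow> real"
    proof -
      have "continuous_on (- K) g" by (rule continuous_on_cong[THEN iffD1, OF refl _ continuous_on_const[of _ 0]]) (use that in auto)
      then have "continuous_on (\<Omega> \<union> - K) g" using that \<Omega> oK by (intro continuous_on_open_Un) auto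
      moreover have "\<Omega> \<union> - K = UNIV" using K by auto
      ultimately show ?thesis by simp
    qed
    have cV: "continuous_on UNIV (V i)" for i
    proof (rule cU)
      have "continuous_on \<Omega> (\<lambda>x. cf x * F x $ i)" by (intro continuous_intros contcf F)
      then show "continuous_on \<Omega> (V i)" by (rule continuous_on_cong[THEN iffD1, rotated 2]) (auto simp: V_def)
    qed (rule V0)
    have cD: "continuous_on UNIV (D i)" for i
    proof (rule cU)
      have "continuous_on \<Omega> (\<lambda>x. dcf i x * F x $ i + cf x * dF i x)" by (intro continuous_intros contcf F)
      then show "continuous_on \<Omega> (D i)" by (rule continuous_on_cong[THEN iffD1, rotated 2]) (auto simp: D_def)
    qed (rule D0)
    have der: "((\<lambda>t. V i (x + t *\<^sub>R axis i 1)) has_real_derivative D i x) (at 0)" for i x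
    proof (cases "x \<in> \<Omega>")
      case True
      have "((\<lambda>t. cf (x + t *\<^sub>R axis i 1) * F (x + t *\<^sub>R axis i 1) $ i) has_real_derivative D i x) (at 0)"
        using DERIV_mult[OF dcf[of x i] dF[OF True, of i]] True by (simp add: D_def mult.commute add.commute)
      then show ?thesis
        by (rule DERIV_cong_ev[THEN iffD1, OF refl _ refl, rotated])
          (use line[OF \<Omega> True, of "axis i 1"] in \<open>auto elim!: eventually_mono simp: V_def\<close>)
    next
      case False
      then have xK: "x \<in> - K" using K by auto
      have "((\<lambda>t. 0) has_real_derivative D i x) (at 0)" using D0[of x i] xK by simp
      then show ?thesis
        by (rule DERIV_cong_ev[THEN iffD1, OF refl _ refl, rotated])
          (use line[OF oK xK, of "axis i 1"] in \<open>auto elim!: eventually_mono simp: V0\<close>)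
    qed
    obtain R where R: "\<And>x. x \<in> K \<Longrightarrow> norm x \<le> R" using compact_imp_bounded[OF K(1)] unfolding bounded_iff by blast
    have zero: "integral UNIV (D i) = 0" "D i integrable_on UNIV" for i
      using integral_directional_derivative_eq_0[OF der cV cD, where R = R] R V0 D0 by (meson not_le)+
    define G where "G j x = s' j x * (2 / \<delta>) * (F x \<bullet> (x - c j))" for j x
    define sh where "sh j = cball (c j) (sqrt ((\<rho> j)\<^sup>2 + \<delta>)) - ball (c j) (\<rho> j)" for j
    have shsub: "sh j \<subseteq> \<Omega>" if "j \<in> J" for j
    proof -
      have "sqrt ((\<rho> j)\<^sup>2 + \<delta>) \<le> sqrt ((\<rho> j)\<^sup>2 + \<eta>)" using \<delta> by simp
      then show ?thesis using shell[OF that] unfolding sh_def by (meson Diff_mono order_refl order_trans subset_cball)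
    qed
    have s'0: "s' j x = 0" if "x \<notin> sh j" "j \<in> J" for j x
    proof -
      have "norm (x - c j) > sqrt ((\<rho> j)\<^sup>2 + \<delta>) \<or> norm (x - c j) < \<rho> j"
        using that(1) by (auto simp: sh_def dist_norm norm_minus_commute)
      then have "(norm (x - c j))\<^sup>2 \<ge> (\<rho> j)\<^sup>2 + \<delta> \<or> (norm (x - c j))\<^sup>2 \<le> (\<rho> j)\<^sup>2"
      proof (elim disjE)
        assume "norm (x - c j) > sqrt ((\<rho> j)\<^sup>2 + \<delta>)"
        then show ?thesis using sqrt_le_D[of "(\<rho> j)\<^sup>2 + \<delta>" "norm (x - c j)"] by simp
      next
        assume "norm (x - c j) < \<rho> j"
        then have "(norm (x - c j))\<^sup>2 \<le> (\<rho> j)\<^sup>2" by (intro power_mono) auto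
        then show ?thesis by simp
      qed
      then show ?thesis unfolding s'_def using \<delta> by (intro smooth_step'_eq_0) (auto simp: divide_simps)
    qed
    have contG: "continuous_on (sh j) (G j)" if "j \<in> J" for j
      unfolding G_def by (intro continuous_intros contcf continuous_on_subset[OF F(1) shsub[OF that]])
    have csh: "compact (sh j)" for j unfolding sh_def by (intro compact_diff compact_cball open_ball)
    have iG: "(G j) integrable_on (sh j)" if "j \<in> J" for j
    proof -
      have "set_integrable lborel (sh j) (G j)"
        using borel_integrable_compact[OF csh contG[OF that]] by (simp add: set_integrable_def)
      then show ?thesis by (rule set_borel_integral_eq_integral)
    qed
    have sumD: "(\<Sum>i\<in>UNIV. D i x) = (\<Sum>j\<in>J. \<sigma> j * (if x \<in> sh j then G j x else 0))" for x
    proof (cases "x \<in> \<Omega>")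
      case True
      have "(\<Sum>i\<in>UNIV. D i x) = (\<Sum>i\<in>UNIV. dcf i x * F x $ i) + cf x * (\<Sum>i\<in>UNIV. dF i x)"
        using True by (simp add: D_def sum.distrib sum_distrib_left)
      also have "\<dots> = (\<Sum>i\<in>UNIV. dcf i x * F x $ i)" using div[OF True] by simp
      also have "\<dots> = (\<Sum>j\<in>J. \<sigma> j * G j x)"
        unfolding dcf_def sum_distrib_right
        by (subst sum.swap) (auto simp: G_def inner_vec_def sum_distrib_left intro!: sum.cong)
      also have "\<dots> = (\<Sum>j\<in>J. \<sigma> j * (if x \<in> sh j then G j x else 0))"
        by (rule sum.cong) (auto simp: G_def s'0)
      finally show ?thesis .
    next
      case False
      then have "x \<notin> sh j" if "j \<in> J" for j using shsub[OF that] by auto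
      then show ?thesis using False by (simp add: D_def)
    qed
    have "0 = integral UNIV (\<lambda>x. \<Sum>i\<in>UNIV. D i x)"
      using zero by (subst integral_sum) auto
    also have "\<dots> = integral UNIV (\<lambda>x. \<Sum>j\<in>J. \<sigma> j * (if x \<in> sh j then G j x else 0))" by (simp add: sumD)
    also have "\<dots> = (\<Sum>j\<in>J. \<sigma> j * integral (sh j) (G j))"
      using iG J(1) by (subst integral_sum) (auto simp: integrable_restrict_UNIV integral_restrict_UNIV intro!: integrable_on_mult_right)
    also have "\<dots> = (\<Sum>j\<in>J. \<sigma> j * integral {\<rho> j..sqrt ((\<rho> j)\<^sup>2 + \<delta>)}
      (\<lambda>r. smooth_step' ((r\<^sup>2 - (\<rho> j)\<^sup>2) / \<delta>) * (2 * r / \<delta>) * sphere_flux F (c j) r))"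
    proof (rule sum.cong[OF refl])
      fix j assume j: "j \<in> J"
      have "\<rho> j = sqrt ((\<rho> j)\<^sup>2)" using J(2)[OF j] by simp
      also have "\<dots> < sqrt ((\<rho> j)\<^sup>2 + \<delta>)" using \<delta> by (intro real_sqrt_less_mono) simp
      finally have lt: "\<rho> j < sqrt ((\<rho> j)\<^sup>2 + \<delta>)" .
      have "integral (sh j) (G j) = integral {\<rho> j..sqrt ((\<rho> j)\<^sup>2 + \<delta>)} (\<lambda>r. sphere_integral (c j) r (G j))"
        unfolding sh_def by (rule integral_shell[OF J(2)[OF j] lt contG[OF j, unfolded sh_def]])
      also have "\<dots> = integral {\<rho> j..sqrt ((\<rho> j)\<^sup>2 + \<delta>)}
          (\<lambda>r. smooth_step' ((r\<^sup>2 - (\<rho> j)\<^sup>2) / \<delta>) * (2 * r / \<delta>) * sphere_flux F (c j) r)"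
      proof (rule integral_cong)
        fix r assume "r \<in> {\<rho> j..sqrt ((\<rho> j)\<^sup>2 + \<delta>)}"
        then have r: "r > 0" using J(2)[OF j] by auto
        have "sphere_integral (c j) r (G j) = sphere_integral (c j) r
            (\<lambda>x. (smooth_step' ((r\<^sup>2 - (\<rho> j)\<^sup>2) / \<delta>) * (2 * r / \<delta>)) * (F x \<bullet> (x - c j) / r))"
          by (rule sphere_integral_cong) (use r in \<open>auto simp: G_def s'_def dist_norm norm_minus_commute\<close>)
        then show "sphere_integral (c j) r (G j) = smooth_step' ((r\<^sup>2 - (\<rho> j)\<^sup>2) / \<delta>) * (2 * r / \<delta>) * sphere_flux F (c j) r"
          unfolding sphere_integral_cmult sphere_flux_def .
      qed
      finally show "\<sigma> j * integral (sh j) (G j) = \<sigma> j * integral {\<rho> j..sqrt ((\<rho> j)\<^sup>2 + \<delta>)}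
          (\<lambda>r. smooth_step' ((r\<^sup>2 - (\<rho> j)\<^sup>2) / \<delta>) * (2 * r / \<delta>) * sphere_flux F (c j) r)" by simp
    qed
    finally show ?thesis by simp
  qed
  \<comment> \<open>Each weighted average tends to the flux through the inner sphere of its
    shell.\<close>
  have "((\<lambda>\<delta>. \<Sum>j\<in>J. \<sigma> j * integral {\<rho> j..sqrt ((\<rho> j)\<^sup>2 + \<delta>)}
      (\<lambda>r. smooth_step' ((r\<^sup>2 - (\<rho> j)\<^sup>2) / \<delta>) * (2 * r / \<delta>) * sphere_flux F (c j) r))
      \<longlongrightarrow> (\<Sum>j\<in>J. \<sigma> j * sphere_flux F (c j) (\<rho> j))) (at_right 0)"
    by (intro tendsto_sum tendsto_mult tendsto_const smooth_step_average_tendsto[OF _ d0]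
        continuous_on_sphere_flux continuous_on_subset[OF F(1)] shell J(2))
  moreover have "\<forall>\<^sub>F \<delta> in at_right 0. (\<Sum>j\<in>J. \<sigma> j * integral {\<rho> j..sqrt ((\<rho> j)\<^sup>2 + \<delta>)}
      (\<lambda>r. smooth_step' ((r\<^sup>2 - (\<rho> j)\<^sup>2) / \<delta>) * (2 * r / \<delta>) * sphere_flux F (c j) r)) = 0"
    using eventually_at_right[OF d0] fixed d0 by auto
  then have "((\<lambda>\<delta>. \<Sum>j\<in>J. \<sigma> j * integral {\<rho> j..sqrt ((\<rho> j)\<^sup>2 + \<delta>)}
      (\<lambda>r. smooth_step' ((r\<^sup>2 - (\<rho> j)\<^sup>2) / \<delta>) * (2 * r / \<delta>) * sphere_flux F (c j) r)) \<longlongrightarrow> 0) (at_right 0)"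
    by (rule tendsto_eventually)
  ultimately show ?thesis by (intro tendsto_unique[OF trivial_limit_at_right_real])
qed

section \<open>Green's identity against a point charge\<close>

text \<open>\<open>W\<close> is the gradient of \<open>w\<close> and \<open>dW i\<close> its \<open>i\<close>-th pure second partial derivative; the mixed ones are
  not needed for the divergence.\<close>

definition harmonic_field ::
  "(real ^ 3) set \<Rightarrow> (real ^ 3 \<Rightarrow> real) \<Rightarrow> (real ^ 3 \<Rightarrow> real ^ 3) \<Rightarrow> (3 \<Rightarrow> real ^ 3 \<Rightarrow> real) \<Rightarrow> bool" where
  "harmonic_field S w W dW \<longleftrightarrow>
     (\<forall>x\<in>S. GDERIV w x :> W x) \<and> continuous_on S W \<and> (\<forall>i. continuous_on S (dW i)) \<and>
     (\<forall>x\<in>S. \<forall>i. ((\<lambda>t. W (x + t *\<^sub>R axis i 1) $ i) has_real_derivative dW i x) (at 0)) \<and>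
     (\<forall>x\<in>S. (\<Sum>i\<in>UNIV. dW i x) = 0)"

lemma harmonic_fieldD:
  assumes "harmonic_field S w W dW"
  shows "\<And>x. x \<in> S \<Longrightarrow> GDERIV w x :> W x" "continuous_on S W" "\<And>i. continuous_on S (dW i)"
    "\<And>x i. x \<in> S \<Longrightarrow> ((\<lambda>t. W (x + t *\<^sub>R axis i 1) $ i) has_real_derivative dW i x) (at 0)"
    "\<And>x. x \<in> S \<Longrightarrow> (\<Sum>i\<in>UNIV. dW i x) = 0" "continuous_on S w"
proof -
  show "continuous_on S w"
    using assms unfolding harmonic_field_def gderiv_def
    by (meson continuous_at_imp_continuous_on has_derivative_continuous)
qed (use assms in \<open>auto simp: harmonic_field_def\<close>)

lemma GDERIV_line:
  assumes "GDERIV w (x + t *\<^sub>R v) :> D"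
  shows "((\<lambda>s. w (x + s *\<^sub>R v)) has_real_derivative D \<bullet> v) (at t within S)"
proof -
  have "((\<lambda>s. x + s *\<^sub>R v) has_derivative (\<lambda>h. h *\<^sub>R v)) (at t within S)"
    by (auto intro!: derivative_eq_intros)
  from has_derivative_compose[OF this, of w "\<lambda>h. h \<bullet> D"] assms
  have "((\<lambda>s. w (x + s *\<^sub>R v)) has_derivative (\<lambda>h. h *\<^sub>R v \<bullet> D)) (at t within S)"
    by (simp add: gderiv_def)
  then show ?thesis
    unfolding has_field_derivative_def
    by (rule has_derivative_eq_rhs) (auto simp: fun_eq_iff inner_commute mult.commute)
qed

lemma harmonic_on_imp_field:
  assumes "harmonic_on S w"
  obtains W dW where "harmonic_field S w W dW"
proof
  define W :: "real ^ 3 \<Rightarrow> real ^ 3" where "W x = (\<chi> i. partial_deriv i w x)" for x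
  define dW where "dW i = partial_deriv i (partial_deriv i w)" for i :: 3
  have C1: "C1_on S w" and C1': "\<And>i. C1_on S (partial_deriv i w)"
    and lap: "\<And>x. x \<in> S \<Longrightarrow> laplacian w x = 0"
    using assms by (auto simp: harmonic_on_def C2_on_def)
  have grad: "GDERIV v x :> (\<chi> i. partial_deriv i v x)" if "v differentiable (at x)" for v :: "real ^ 3 \<Rightarrow> real" and x
  proof -
    have d: "(v has_derivative frechet_derivative v (at x)) (at x)" using that frechet_derivative_works by blast
    then have lin: "linear (frechet_derivative v (at x))" using has_derivative_linear by blast
    have "frechet_derivative v (at x) h = h \<bullet> (\<chi> i. partial_deriv i v x)" for h
    proof -
      have "h = (\<Sum>i\<in>UNIV. h $ i *\<^sub>R axis i 1)" using basis_expansion[of h] by (simp add: scalar_mult_eq_scaleR)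
      then have "frechet_derivative v (at x) h = frechet_derivative v (at x) (\<Sum>i\<in>UNIV. h $ i *\<^sub>R axis i 1)" by simp
      also have "\<dots> = (\<Sum>i\<in>UNIV. h $ i * partial_deriv i v x)"
        by (simp add: linear_sum[OF lin] linear_scale[OF lin] partial_deriv_def)
      finally show ?thesis by (simp add: inner_vec_def)
    qed
    then show ?thesis unfolding gderiv_def by (intro has_derivative_eq_rhs[OF d]) auto
  qed
  show "harmonic_field S w W dW"
    unfolding harmonic_field_def
  proof (intro conjI ballI allI)
    show "GDERIV w x :> W x" if "x \<in> S" for x
      using C1 that grad[of w x] by (auto simp: C1_on_def W_def)
    show "continuous_on S W" unfolding W_def[abs_def]
      using C1 by (intro continuous_on_vec_lambda) (auto simp: C1_on_def)
    show "continuous_on S (dW i)" for i using C1'[of i] by (auto simp: C1_on_def dW_def)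
    show "(\<Sum>i\<in>UNIV. dW i x) = 0" if "x \<in> S" for x using lap[OF that] by (simp add: laplacian_def dW_def)
    show "((\<lambda>t. W (x + t *\<^sub>R axis i 1) $ i) has_real_derivative dW i x) (at 0)" if "x \<in> S" for x i
    proof -
      have "GDERIV (partial_deriv i w) (x + 0 *\<^sub>R axis i 1) :> (\<chi> j. partial_deriv j (partial_deriv i w) x)"
        using C1'[of i] that by (auto simp: C1_on_def intro!: grad)
      from GDERIV_line[OF this] show ?thesis by (simp add: W_def dW_def inner_axis)
    qed
  qed
qed

lemma harmonic_field_subset: "harmonic_field T w W dW \<Longrightarrow> S \<subseteq> T \<Longrightarrow> harmonic_field S w W dW"
  unfolding harmonic_field_def by (meson continuous_on_subset subset_iff)

lemma harmonic_field_diff: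
  assumes "harmonic_field S w W dW" "harmonic_field S v V dV"
  shows "harmonic_field S (\<lambda>x. w x - v x) (\<lambda>x. W x - V x) (\<lambda>i x. dW i x - dV i x)"
  using harmonic_fieldD[OF assms(1)] harmonic_fieldD[OF assms(2)]
  by (auto simp: harmonic_field_def sum_subtractf intro!: continuous_intros GDERIV_diff derivative_intros)

lemma harmonic_field_const: "harmonic_field S (\<lambda>x. k) (\<lambda>x. 0) (\<lambda>i x. 0)"
  by (auto simp: harmonic_field_def intro: GDERIV_const)

section \<open>The Newton kernel and Green's second identity\<close>

definition newton :: "real ^ 3 \<Rightarrow> real ^ 3 \<Rightarrow> real" where
  "newton p x = 1 / norm (x - p)"

definition newton_grad :: "real ^ 3 \<Rightarrow> real ^ 3 \<Rightarrow> real ^ 3" where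
  "newton_grad p x = (- 1 / norm (x - p) ^ 3) *\<^sub>R (x - p)"

lemma harmonic_field_newton:
  "harmonic_field (- {p}) (newton p) (newton_grad p)
     (\<lambda>i x. 3 * ((x - p) $ i)\<^sup>2 / norm (x - p) ^ 5 - 1 / norm (x - p) ^ 3)"
  unfolding harmonic_field_def
proof (intro conjI ballI allI)
  fix x :: "real ^ 3" assume "x \<in> - {p}"
  then have n0: "norm (x - p) > 0" by simp
  show "GDERIV (newton p) x :> newton_grad p x"
  proof -
    have "((\<lambda>x. x - p) has_derivative (\<lambda>h. h)) (at x)" by (auto intro!: derivative_eq_intros)
    from has_derivative_compose[OF this, of norm "\<lambda>h. h \<bullet> sgn (x - p)"] GDERIV_norm[of "x - p"] n0
    have n: "((\<lambda>x. norm (x - p)) has_derivative (\<lambda>h. h \<bullet> sgn (x - p))) (at x)"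
      by (simp add: gderiv_def)
    have "((\<lambda>x. 1 / norm (x - p)) has_derivative (\<lambda>h. - (h \<bullet> sgn (x - p)) / (norm (x - p))\<^sup>2)) (at x)"
      using n0 by (auto intro!: derivative_eq_intros n simp: power2_eq_square divide_inverse)
    moreover have "- (h \<bullet> sgn d) / (norm d)\<^sup>2 = h \<bullet> ((- 1 / norm d ^ 3) *\<^sub>R d)" for h d :: "real ^ 3"
      by (simp add: sgn_div_norm divide_inverse power2_eq_square power3_eq_cube)
    ultimately show ?thesis
      unfolding gderiv_def newton_def[abs_def] newton_grad_def by simp
  qed
  show "(\<Sum>i\<in>UNIV. 3 * ((x - p) $ i)\<^sup>2 / norm (x - p) ^ 5 - 1 / norm (x - p) ^ 3) = 0"
  proof -
    have "(\<Sum>i\<in>UNIV. 3 * ((x - p) $ i)\<^sup>2 / norm (x - p) ^ 5 - 1 / norm (x - p) ^ 3)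
        = 3 * (norm (x - p))\<^sup>2 / norm (x - p) ^ 5 - 3 / norm (x - p) ^ 3"
      unfolding norm_vector_3_power2 sum_3 by (simp add: add_divide_distrib distrib_left)
    also have "\<dots> = 0" using n0 by (simp add: field_simps power_numeral_reduce)
    finally show ?thesis .
  qed
  fix i :: 3
  show "((\<lambda>t. newton_grad p (x + t *\<^sub>R axis i 1) $ i) has_real_derivative
      3 * ((x - p) $ i)\<^sup>2 / norm (x - p) ^ 5 - 1 / norm (x - p) ^ 3) (at 0)"
  proof -
    have n: "((\<lambda>t. norm (x + t *\<^sub>R axis i 1 - p)) has_real_derivative (x - p) $ i / norm (x - p)) (at 0)"
    proof -
      have "GDERIV norm (x - p + 0 *\<^sub>R axis i 1) :> sgn (x - p)" using n0 GDERIV_norm[of "x - p"] by simp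
      from GDERIV_line[OF this] show ?thesis
        by (simp add: algebra_simps inner_axis sgn_div_norm divide_inverse)
    qed
    have "((\<lambda>t. - (1 / norm (x + t *\<^sub>R axis i 1 - p) ^ 3) * ((x - p) $ i + t)) has_real_derivative
      3 * ((x - p) $ i)\<^sup>2 / norm (x - p) ^ 5 - 1 / norm (x - p) ^ 3) (at 0)"
      using n0 by (auto intro!: derivative_eq_intros n simp: field_simps power_numeral_reduce)
    moreover have "newton_grad p (x + t *\<^sub>R axis i 1) $ i = - (1 / norm (x + t *\<^sub>R axis i 1 - p) ^ 3) * ((x - p) $ i + t)" for t
      by (simp add: newton_grad_def divide_inverse algebra_simps)
    ultimately show ?thesis by simp
  qed
next
  show "continuous_on (- {p}) (newton_grad p)"
    unfolding newton_grad_def[abs_def] by (intro continuous_intros) auto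
  show "continuous_on (- {p}) (\<lambda>x. 3 * ((x - p) $ i)\<^sup>2 / norm (x - p) ^ 5 - 1 / norm (x - p) ^ 3)" for i :: 3
    by (intro continuous_intros) auto
qed

text \<open>The field of Green's second identity: its divergence is
  \<open>w \<Delta>g - g \<Delta>w\<close>, because the products of the two gradients
  cancel.\<close>

definition green_field where
  "green_field w W g A x = w x *\<^sub>R A x - g x *\<^sub>R (W x :: real ^ 3)"

lemma green_sum_sphere_flux_eq_0:
  fixes c :: "'i \<Rightarrow> real ^ 3"
  assumes "open \<Omega>" and w: "harmonic_field \<Omega> w W dW" and g: "harmonic_field \<Omega> g A dA"
    and "compact K" "K \<subseteq> \<Omega>" "finite J" "\<And>j. j \<in> J \<Longrightarrow> \<rho> j > 0" "\<eta> > 0"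
    "\<And>j. j \<in> J \<Longrightarrow> cball (c j) (sqrt ((\<rho> j)\<^sup>2 + \<eta>)) - ball (c j) (\<rho> j) \<subseteq> \<Omega>"
    "\<And>\<delta> x. 0 < \<delta> \<Longrightarrow> \<delta> < \<eta> \<Longrightarrow> x \<notin> K \<Longrightarrow>
      k + (\<Sum>j\<in>J. \<sigma> j * smooth_step (((norm (x - c j))\<^sup>2 - (\<rho> j)\<^sup>2) / \<delta>)) = 0"
  shows "(\<Sum>j\<in>J. \<sigma> j * sphere_flux (green_field w W g A) (c j) (\<rho> j)) = 0"
proof (rule sum_sphere_flux_eq_0[where \<Omega> = \<Omega> and K = K and \<eta> = \<eta> and k = k])
  note w' = harmonic_fieldD[OF w] and g' = harmonic_fieldD[OF g]
  show "continuous_on \<Omega> (green_field w W g A)"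
    unfolding green_field_def[abs_def] by (intro continuous_intros w' g')
  show "continuous_on \<Omega> (\<lambda>x. w x * dA i x - g x * dW i x)" for i
    by (intro continuous_intros w' g')
  show "((\<lambda>t. green_field w W g A (x + t *\<^sub>R axis i 1) $ i) has_real_derivative w x * dA i x - g x * dW i x) (at 0)"
    if x: "x \<in> \<Omega>" for i x
  proof -
    have "((\<lambda>t. w (x + t *\<^sub>R axis i 1)) has_real_derivative W x $ i) (at 0)"
      "((\<lambda>t. g (x + t *\<^sub>R axis i 1)) has_real_derivative A x $ i) (at 0)"
      using GDERIV_line[of w x 0 "axis i 1" "W x"] GDERIV_line[of g x 0 "axis i 1" "A x"] w'(1)[OF x] g'(1)[OF x]
      by (simp_all add: inner_axis)
    from DERIV_diff[OF DERIV_mult[OF this(1) g'(4)[OF x, of i]] DERIV_mult[OF this(2) w'(4)[OF x, of i]]]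
    show ?thesis by (simp add: green_field_def algebra_simps)
  qed
  show "(\<Sum>i\<in>UNIV. w x * dA i x - g x * dW i x) = 0" if x: "x \<in> \<Omega>" for x
    using w'(5)[OF x] g'(5)[OF x] by (simp add: sum_subtractf sum_distrib_left[symmetric])
qed (use assms in auto)

lemma smooth_step_outside:
  assumes "0 < \<delta>" "\<delta> \<le> r'\<^sup>2 - r\<^sup>2" "0 \<le> r'" "r' \<le> norm y"
  shows "smooth_step (((norm y)\<^sup>2 - r\<^sup>2) / \<delta>) = 1"
proof -
  have "r'\<^sup>2 \<le> (norm y)\<^sup>2" using assms by (intro power_mono) auto
  then have "\<delta> \<le> (norm y)\<^sup>2 - r\<^sup>2" using assms by linarith
  then show ?thesis using assms by (intro smooth_step_eq_1) simp
qed

lemma smooth_step_inside: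
  assumes "0 < \<delta>" "norm y \<le> r"
  shows "smooth_step (((norm y)\<^sup>2 - r\<^sup>2) / \<delta>) = 0"
proof -
  have "(norm y)\<^sup>2 \<le> r\<^sup>2" using assms by (intro power_mono) auto
  then show ?thesis using assms by (intro smooth_step_eq_0) (simp add: divide_nonpos_pos)
qed

lemma sqrt_shell_le: "0 \<le> r' \<Longrightarrow> \<delta> \<le> r'\<^sup>2 - r\<^sup>2 \<Longrightarrow> sqrt (r\<^sup>2 + \<delta>) \<le> r'"
  by (rule real_le_lsqrt) auto

text \<open>With the charge outside the ball, one minus a single step serves as cutoff; it is
  supported in a slightly larger ball that still avoids \<open>p\<close>.\<close>

lemma green_ball_eq_0:
  assumes w: "harmonic_field UNIV w W dW" and r: "0 < r" "r < dist c p"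
  shows "sphere_flux (green_field w W (newton p) (newton_grad p)) c r = 0"
proof -
  define R where "R = (r + dist c p) / 2"
  have R: "r < R" "R < dist c p" using r by (auto simp: R_def)
  have d: "R\<^sup>2 - r\<^sup>2 > 0" using R r by (simp add: power_strict_mono)
  have "(\<Sum>j\<in>{0::nat}. (-1) * sphere_flux (green_field w W (newton p) (newton_grad p)) c r) = 0"
  proof (rule green_sum_sphere_flux_eq_0[where \<Omega> = "- {p}" and K = "cball c R" and \<eta> = "R\<^sup>2 - r\<^sup>2" and k = 1])
    show "harmonic_field (- {p}) w W dW" by (rule harmonic_field_subset[OF w]) auto
    show "cball c (sqrt (r\<^sup>2 + (R\<^sup>2 - r\<^sup>2))) - ball c r \<subseteq> - {p}" using R r by auto
    show "1 + (\<Sum>j\<in>{0::nat}. - 1 * smooth_step (((norm (x - c))\<^sup>2 - r\<^sup>2) / \<delta>)) = 0"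
      if "0 < \<delta>" "\<delta> < R\<^sup>2 - r\<^sup>2" "x \<notin> cball c R" for \<delta> x
      using smooth_step_outside[of \<delta> R r "x - c"] that R r by (auto simp: dist_norm norm_minus_commute)
  qed (use R r d in \<open>auto intro: harmonic_field_newton\<close>)
  then show ?thesis by simp
qed

text \<open>The field is divergence free between the two spheres. The cutoff is the difference of
  the steps at \<open>p\<close> and at \<open>c\<close>: both are 0 inside the small ball and both
  are 1 far out.\<close>

lemma green_ball_shrink:
  assumes w: "harmonic_field UNIV w W dW" and p: "dist c p < r" and s: "0 < s" "s < r - dist c p"
  shows "sphere_flux (green_field w W (newton p) (newton_grad p)) c r =
    sphere_flux (green_field w W (newton p) (newton_grad p)) p s"
proof -
  define s' where "s' = r - dist c p"
  have r: "r > 0" using p zero_le_dist[of c p] by linarith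
  \<comment> \<open>This width lets the step about \<open>p\<close> reach 1 by radius
    \<open>s'\<close> and the step about \<open>c\<close> reach 1 by radius
    \<open>r + 1\<close>.\<close>
  define \<eta> where "\<eta> = min (s'\<^sup>2 - s\<^sup>2) ((r + 1)\<^sup>2 - r\<^sup>2)"
  have d: "\<eta> > 0" "\<eta> \<le> s'\<^sup>2 - s\<^sup>2" "\<eta> \<le> (r + 1)\<^sup>2 - r\<^sup>2"
    using s r by (auto simp: \<eta>_def s'_def power_strict_mono)
  have "(\<Sum>j\<in>{True, False}. (if j then 1 else - 1) *
      sphere_flux (green_field w W (newton p) (newton_grad p)) (if j then p else c) (if j then s else r)) = 0"
  proof (rule green_sum_sphere_flux_eq_0[where \<Omega> = "- {p}" and K = "cball c (r + 1) - ball p s" and \<eta> = \<eta> and k = 0])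
    show "harmonic_field (- {p}) w W dW" by (rule harmonic_field_subset[OF w]) auto
    show "compact (cball c (r + 1) - ball p s)" by (intro compact_diff compact_cball open_ball)
    show "cball (if j then p else c) (sqrt ((if j then s else r)\<^sup>2 + \<eta>)) -
        ball (if j then p else c) (if j then s else r) \<subseteq> - {p}" for j
      using p s by auto
    fix \<delta> x assume \<delta>: "0 < \<delta>" "\<delta> < \<eta>" and x: "x \<notin> cball c (r + 1) - ball p s"
    have "smooth_step (((norm (x - p))\<^sup>2 - s\<^sup>2) / \<delta>) = smooth_step (((norm (x - c))\<^sup>2 - r\<^sup>2) / \<delta>)"
    proof (cases "x \<in> ball p s")
      case True
      then have "dist c x \<le> r" using dist_triangle[of c x p] s by simp
      then show ?thesis using True \<delta> by (simp add: smooth_step_inside dist_norm norm_minus_commute)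
    next
      case False
      then have 1: "dist c x \<ge> r + 1" using x by auto
      then have "dist p x \<ge> s'" using dist_triangle[of c x p] by (simp add: s'_def)
      then show ?thesis using 1 \<delta> d s r smooth_step_outside[of \<delta> s' s "x - p"] smooth_step_outside[of \<delta> "r + 1" r "x - c"]
        by (simp add: dist_norm norm_minus_commute s'_def)
    qed
    then show "0 + (\<Sum>j\<in>{True, False}. (if j then 1 else - 1) *
        smooth_step (((norm (x - (if j then p else c)))\<^sup>2 - (if j then s else r)\<^sup>2) / \<delta>)) = 0"
      by simp
  qed (use d r s in \<open>auto intro: harmonic_field_newton\<close>)
  then show ?thesis by simp
qed

text \<open>The cutoff is the sum of the steps at \<open>c1\<close> and \<open>c2\<close>, minus the
  step at \<open>p\<close>, minus 1. Up to thin layers it is 1 between the small spheres and the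
  large one; it is 0 inside the small spheres and far out.\<close>

lemma green_exterior_sum:
  fixes c1 c2 p :: "real ^ 3"
  assumes w: "harmonic_field (- (cball c1 r1 \<union> cball c2 r2)) w W dW"
    and r: "0 < r1" "r1 < \<rho>1" "0 < r2" "r2 < \<rho>2" "\<rho>1 + \<rho>2 < dist c1 c2"
    and p: "p \<in> ball c1 r1 \<union> ball c2 r2"
    and R: "dist p c1 + \<rho>1 < R" "dist p c2 + \<rho>2 < R"
  defines "F \<equiv> green_field w W (newton p) (newton_grad p)"
  shows "sphere_flux F c1 \<rho>1 + sphere_flux F c2 \<rho>2 = sphere_flux F p R"
proof -
  \<comment> \<open>Half of the smallest slack: the balls enlarged by \<open>e\<close> still do not
    overlap and stay inside the sphere of radius \<open>R\<close> about \<open>p\<close>.\<close>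
  define e where "e = min (dist c1 c2 - \<rho>1 - \<rho>2) (min (R - dist p c1 - \<rho>1) (R - dist p c2 - \<rho>2)) / 2"
  define t1 t2 where "t1 = \<rho>1 + e" and "t2 = \<rho>2 + e"
  have e: "e > 0" using r R by (auto simp: e_def)
  have e1: "2 * e \<le> dist c1 c2 - \<rho>1 - \<rho>2" "2 * e \<le> R - dist p c1 - \<rho>1" "2 * e \<le> R - dist p c2 - \<rho>2"
    by (auto simp: e_def)
  have t: "\<rho>1 < t1" "\<rho>2 < t2" "t1 + t2 \<le> dist c1 c2" "dist p c1 + t1 < R" "dist p c2 + t2 < R"
    using e e1 by (auto simp: t1_def t2_def)
  have Rp: "R > 0" using R r zero_le_dist[of p c1] by linarith
  define \<eta> where "\<eta> = min (t1\<^sup>2 - \<rho>1\<^sup>2) (min (t2\<^sup>2 - \<rho>2\<^sup>2) ((R + 1)\<^sup>2 - R\<^sup>2))"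
  have d: "\<eta> > 0" "\<eta> \<le> t1\<^sup>2 - \<rho>1\<^sup>2" "\<eta> \<le> t2\<^sup>2 - \<rho>2\<^sup>2" "\<eta> \<le> (R + 1)\<^sup>2 - R\<^sup>2"
    using r t Rp by (auto simp: \<eta>_def power_strict_mono)
  define cc \<rho>\<rho> \<sigma>\<sigma> where "cc j = (if j = 0 then c1 else if j = 1 then c2 else p)"
    and "\<rho>\<rho> j = (if j = 0 then \<rho>1 else if j = 1 then \<rho>2 else R)" and "\<sigma>\<sigma> j = (if j < 2 then 1 else - 1 :: real)" for j :: nat
  have tri: "dist c1 c2 \<le> dist c1 x + dist c2 x" "dist p x \<le> dist p c1 + dist c1 x"
    "dist p x \<le> dist p c2 + dist c2 x" "dist c1 x \<le> dist p c1 + dist p x" "dist c2 x \<le> dist p c2 + dist p x" for x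
    using dist_triangle[of c1 c2 x] dist_triangle[of p x c1] dist_triangle[of p x c2]
      dist_triangle[of c1 x p] dist_triangle[of c2 x p] by (auto simp: dist_commute)
  have "(\<Sum>j\<in>{0, 1, 2}. \<sigma>\<sigma> j * sphere_flux (green_field w W (newton p) (newton_grad p)) (cc j) (\<rho>\<rho> j)) = 0"
  proof (rule green_sum_sphere_flux_eq_0[where \<Omega> = "- (cball c1 r1 \<union> cball c2 r2)"
        and K = "cball p (R + 1) - (ball c1 \<rho>1 \<union> ball c2 \<rho>2)" and \<eta> = \<eta> and k = "-1", OF _ w])
    show "harmonic_field (- (cball c1 r1 \<union> cball c2 r2)) (newton p) (newton_grad p)
     (\<lambda>i x. 3 * ((x - p) $ i)\<^sup>2 / norm (x - p) ^ 5 - 1 / norm (x - p) ^ 3)"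
      by (rule harmonic_field_subset[OF harmonic_field_newton]) (use p in auto)
    show "compact (cball p (R + 1) - (ball c1 \<rho>1 \<union> ball c2 \<rho>2))" by (intro compact_diff compact_cball open_Un open_ball)
    show "open (- (cball c1 r1 \<union> cball c2 r2))" by (intro open_Compl closed_Un closed_cball)
    show "cball p (R + 1) - (ball c1 \<rho>1 \<union> ball c2 \<rho>2) \<subseteq> - (cball c1 r1 \<union> cball c2 r2)" using r by auto
    show "cball (cc j) (sqrt ((\<rho>\<rho> j)\<^sup>2 + \<eta>)) - ball (cc j) (\<rho>\<rho> j) \<subseteq> - (cball c1 r1 \<union> cball c2 r2)"
      if j: "j \<in> {0, 1, 2}" for j
    proof
      fix x assume x: "x \<in> cball (cc j) (sqrt ((\<rho>\<rho> j)\<^sup>2 + \<eta>)) - ball (cc j) (\<rho>\<rho> j)"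
      have "sqrt (\<rho>1\<^sup>2 + \<eta>) \<le> t1" "sqrt (\<rho>2\<^sup>2 + \<eta>) \<le> t2"
        using d t r by (auto intro!: sqrt_shell_le)
      then show "x \<in> - (cball c1 r1 \<union> cball c2 r2)"
        using j x r t tri[of x] R by (auto simp: cc_def \<rho>\<rho>_def not_le)
    qed
    fix \<delta> x assume \<delta>: "0 < \<delta>" "\<delta> < \<eta>" and x: "x \<notin> cball p (R + 1) - (ball c1 \<rho>1 \<union> ball c2 \<rho>2)"
    have n: "norm (x - y) = dist y x" for y by (simp add: dist_norm norm_minus_commute)
    have ins: "smooth_step (((norm (x - y))\<^sup>2 - r\<^sup>2) / \<delta>) = 0" if "dist y x \<le> r" for y r
      using smooth_step_inside[OF \<delta>(1), of "x - y" r] that by (simp add: n)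
    have out: "smooth_step (((norm (x - y))\<^sup>2 - r\<^sup>2) / \<delta>) = 1" if "\<eta> \<le> r'\<^sup>2 - r\<^sup>2" "0 \<le> r'" "r' \<le> dist y x" for y r r'
      using smooth_step_outside[OF \<delta>(1), of r' r "x - y"] that \<delta> by (simp add: n)
    consider "x \<in> ball c1 \<rho>1" | "x \<in> ball c2 \<rho>2" | "dist p x > R + 1" using x by force
    then have "smooth_step (((norm (x - c1))\<^sup>2 - \<rho>1\<^sup>2) / \<delta>) + smooth_step (((norm (x - c2))\<^sup>2 - \<rho>2\<^sup>2) / \<delta>)
        = 1 + smooth_step (((norm (x - p))\<^sup>2 - R\<^sup>2) / \<delta>)"
    proof cases
      case 1
      then show ?thesis using ins[of c1 \<rho>1] out[OF d(3), of c2] ins[of p R] tri[of x] t r by simp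
    next
      case 2
      then show ?thesis using ins[of c2 \<rho>2] out[OF d(2), of c1] ins[of p R] tri[of x] t r by simp
    next
      case 3
      then show ?thesis using out[OF d(2), of c1] out[OF d(3), of c2] out[OF d(4), of p] tri[of x] t r Rp by simp
    qed
    then show "- 1 + (\<Sum>j\<in>{0, 1, 2}. \<sigma>\<sigma> j * smooth_step (((norm (x - cc j))\<^sup>2 - (\<rho>\<rho> j)\<^sup>2) / \<delta>)) = 0"
      by (simp add: cc_def \<rho>\<rho>_def \<sigma>\<sigma>_def)
  qed (use d r Rp in \<open>auto simp: \<rho>\<rho>_def\<close>)
  then show ?thesis by (simp add: F_def cc_def \<rho>\<rho>_def \<sigma>\<sigma>_def)
qed

section \<open>Spherical means about the charge\<close>

definition sphere_mean :: "(real ^ 3 \<Rightarrow> real) \<Rightarrow> real ^ 3 \<Rightarrow> real \<Rightarrow> real" where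
  "sphere_mean w p r = integral (cbox (0, 0) (pi, 2 * pi)) (\<lambda>z. w (p + r *\<^sub>R direction (fst z) (snd z)) * sin (fst z))"

text \<open>Taking out \<open>r\<^sup>2\<close> keeps the mean meaningful at radius 0. It is not
  normalised: it is \<open>4 * pi\<close> times the average over the sphere.\<close>

lemma sphere_integral_eq_mean: "sphere_integral p r w = r\<^sup>2 * sphere_mean w p r"
  unfolding sphere_integral_direction sphere_mean_def integral_mult_right[symmetric] by (simp add: mult_ac)

lemma sphere_mean_0: "sphere_mean w p 0 = 4 * pi * w p"
  using sphere_integral_const[of p 1 "w p"] by (simp add: sphere_integral_eq_mean sphere_mean_def)

lemma continuous_on_sphere_mean:
  assumes "continuous_on S w" "\<And>r. r \<in> U \<Longrightarrow> r \<ge> 0 \<and> sphere p r \<subseteq> S"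
  shows "continuous_on U (sphere_mean w p)"
  unfolding sphere_mean_def[abs_def]
proof (rule integral_continuous_on_param)
  show "continuous_on (U \<times> cbox (0, 0) (pi, 2 * pi)) (\<lambda>(r, z). w (p + r *\<^sub>R direction (fst z) (snd z)) * sin (fst z))"
    unfolding case_prod_unfold
    by (intro continuous_intros continuous_on_compose2[OF assms(1)])
      (use assms(2) in \<open>fastforce simp: dist_norm subset_iff\<close>)
qed

text \<open>On a sphere about the charge the kernel is \<open>1 / r\<close> and its normal
  derivative \<open>- 1 / r\<^sup>2\<close>. With the area factor \<open>r\<^sup>2\<close> the flux
  becomes \<open>- (M + r M')\<close>, where \<open>M\<close> is the spherical mean: a total
  derivative. Constancy of the flux thus turns into a first order equation for
  \<open>M\<close>.\<close>

lemma green_flux_centred: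
  assumes w: "harmonic_field S w W dW" and U: "open U" "convex U"
    and sub: "\<And>r. r \<in> U \<Longrightarrow> r > 0 \<and> sphere p r \<subseteq> S" and r: "r \<in> U"
  shows "((\<lambda>r. r * sphere_mean w p r) has_real_derivative
    - sphere_flux (green_field w W (newton p) (newton_grad p)) p r) (at r)"
proof -
  define m' where "m' r = integral (cbox (0, 0) (pi, 2 * pi))
    (\<lambda>z. W (p + r *\<^sub>R direction (fst z) (snd z)) \<bullet> direction (fst z) (snd z) * sin (fst z))" for r
  note w' = harmonic_fieldD[OF w]
  have inS: "p + r *\<^sub>R direction a b \<in> S" if "r \<in> U" for r a b
  proof -
    have "dist p (p + r *\<^sub>R direction a b) = r" using sub[OF that] by (simp add: dist_norm)
    then show ?thesis using sub[OF that] by auto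
  qed
  have cont: "continuous_on T (\<lambda>z. w (p + r *\<^sub>R direction (fst z) (snd z)))"
    "continuous_on T (\<lambda>z. W (p + r *\<^sub>R direction (fst z) (snd z)))" if "r \<in> U" for r and T :: "(real \<times> real) set"
    by (intro continuous_on_compose2[OF w'(6)] continuous_on_compose2[OF w'(2)] continuous_intros; use inS[OF that] in auto)+
  have "(sphere_mean w p has_real_derivative m' r) (at r within U)"
    unfolding sphere_mean_def[abs_def] m'_def
  proof (rule leibniz_rule_field_derivative[OF _ _ _ r U(2)])
    show "((\<lambda>r. w (p + r *\<^sub>R direction (fst z) (snd z)) * sin (fst z)) has_real_derivative
        W (p + r *\<^sub>R direction (fst z) (snd z)) \<bullet> direction (fst z) (snd z) * sin (fst z)) (at r within U)"
      if "r \<in> U" for r z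
      by (intro DERIV_cmult_right GDERIV_line w'(1) inS that)
    show "(\<lambda>z. w (p + r *\<^sub>R direction (fst z) (snd z)) * sin (fst z)) integrable_on cbox (0, 0) (pi, 2 * pi)"
      if "r \<in> U" for r
      by (intro integrable_continuous continuous_intros cont that)
    show "continuous_on (U \<times> cbox (0, 0) (pi, 2 * pi)) (\<lambda>(r, z).
        W (p + r *\<^sub>R direction (fst z) (snd z)) \<bullet> direction (fst z) (snd z) * sin (fst z))"
      unfolding case_prod_unfold
      by (intro continuous_intros continuous_on_compose2[OF w'(2)]) (use inS in auto)
  qed
  then have d: "(sphere_mean w p has_real_derivative m' r) (at r)" using at_within_open[OF r U(1)] by simp
  have r0: "r > 0" using sub[OF r] by simp
  have "sphere_flux (green_field w W (newton p) (newton_grad p)) p r = - (sphere_mean w p r + r * m' r)"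
  proof -
    have "sphere_flux (green_field w W (newton p) (newton_grad p)) p r = integral (cbox (0, 0) (pi, 2 * pi))
      (\<lambda>z. - (w (p + r *\<^sub>R direction (fst z) (snd z)) * sin (fst z)
        + r * (W (p + r *\<^sub>R direction (fst z) (snd z)) \<bullet> direction (fst z) (snd z) * sin (fst z))))"
      unfolding sphere_flux_def sphere_integral_direction
    proof (rule integral_cong)
      fix z :: "real \<times> real"
      have "direction a b \<bullet> direction a b = 1" for a b
        by (simp add: dot_square_norm)
      then show "green_field w W (newton p) (newton_grad p) (p + r *\<^sub>R direction (fst z) (snd z)) \<bullet>
          (p + r *\<^sub>R direction (fst z) (snd z) - p) / r * r\<^sup>2 * sin (fst z) =
        - (w (p + r *\<^sub>R direction (fst z) (snd z)) * sin (fst z)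
        + r * (W (p + r *\<^sub>R direction (fst z) (snd z)) \<bullet> direction (fst z) (snd z) * sin (fst z)))"
        using r0 by (simp add: green_field_def newton_def newton_grad_def inner_diff_left field_simps
            power2_eq_square power3_eq_cube)
    qed
    also have "\<dots> = - (sphere_mean w p r + r * m' r)"
      unfolding sphere_mean_def m'_def integral_mult_right[symmetric]
      by (subst integral_add[symmetric])
        (auto intro!: integrable_continuous continuous_intros cont r simp: integral_neg[symmetric])
    finally show ?thesis .
  qed
  then show ?thesis
    by (auto intro!: derivative_eq_intros d)
qed

text \<open>All spheres about \<open>p\<close> carry the same flux \<kappa>, so
  \<open>r * sphere_mean w p r + \<kappa> * r\<close> is constant in \<open>r\<close>, and it is 0
  at 0. Hence the mean is \<open>- \<kappa>\<close> for every positive radius, and by continuity at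
  0 it is \<open>4 * pi * w p\<close>.\<close>

lemma green_flux_point:
  assumes w: "harmonic_field UNIV w W dW" and p: "dist c p < r"
  shows "sphere_flux (green_field w W (newton p) (newton_grad p)) c r = - (4 * pi * w p)"
proof -
  let ?F = "green_field w W (newton p) (newton_grad p)"
  define \<kappa> where "\<kappa> = sphere_flux ?F p 1"
  \<comment> \<open>\<open>green_ball_shrink\<close> compares strictly nested spheres, and radius
    \<open>1 + s\<close> exceeds both \<open>s\<close> and 1.\<close>
  have const: "sphere_flux ?F p s = \<kappa>" if s: "s > 0" for s
  proof -
    have "sphere_flux ?F p (1 + s) = sphere_flux ?F p s" "sphere_flux ?F p (1 + s) = sphere_flux ?F p 1"
      using s by (auto intro!: green_ball_shrink[OF w])
    then show ?thesis by (simp add: \<kappa>_def)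
  qed
  have cont: "continuous_on {0..} (sphere_mean w p)"
    by (rule continuous_on_sphere_mean[OF harmonic_fieldD(6)[OF w]]) auto
  have m: "sphere_mean w p b = - \<kappa>" if b: "b > 0" for b
  proof -
    have "b * sphere_mean w p b + \<kappa> * b = 0 * sphere_mean w p 0 + \<kappa> * 0"
    proof (rule DERIV_isconst_end[OF b])
      show "continuous_on {0..b} (\<lambda>r. r * sphere_mean w p r + \<kappa> * r)"
        by (intro continuous_intros continuous_on_subset[OF cont]) auto
      fix x :: real assume x: "0 < x" "x < b"
      have "((\<lambda>r. r * sphere_mean w p r) has_real_derivative - sphere_flux ?F p x) (at x)"
        by (rule green_flux_centred[OF w, of "{0<..}"]) (use x in auto)
      from DERIV_add[OF this DERIV_cmult_Id[of \<kappa>]]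
      show "((\<lambda>r. r * sphere_mean w p r + \<kappa> * r) has_real_derivative 0) (at x)"
        using const[OF x(1)] by simp
    qed
    then have "b * (sphere_mean w p b + \<kappa>) = 0" by (simp add: algebra_simps)
    then show ?thesis using b by simp
  qed
  have "((sphere_mean w p) \<longlongrightarrow> sphere_mean w p 0) (at_right 0)"
    using cont unfolding continuous_on_def by (auto intro: tendsto_within_subset)
  moreover have "((sphere_mean w p) \<longlongrightarrow> - \<kappa>) (at_right 0)"
    by (rule tendsto_eventually) (auto simp: eventually_at_filter m)
  ultimately have "sphere_mean w p 0 = - \<kappa>" by (rule tendsto_unique[OF trivial_limit_at_right_real])
  then have k: "\<kappa> = - (4 * pi * w p)" by (simp add: sphere_mean_0)
  have "sphere_flux ?F c r = sphere_flux ?F p ((r - dist c p) / 2)"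
    by (rule green_ball_shrink[OF w p]) (use p in auto)
  then show ?thesis using const[of "(r - dist c p) / 2"] p k by simp
qed

lemma sphere_mean_tendsto_0:
  assumes "(w \<longlongrightarrow> 0) at_infinity" "continuous_on S w" "\<And>r. r > R0 \<Longrightarrow> sphere p r \<subseteq> S"
  shows "((sphere_mean w p) \<longlongrightarrow> 0) at_top"
proof (rule tendstoI)
  fix e :: real assume e: "e > 0"
  define d where "d = e / (8 * pi)"
  have d: "d > 0" using e by (simp add: d_def)
  obtain B where B: "\<And>x. norm x \<ge> B \<Longrightarrow> dist (w x) 0 < d"
    using tendstoD[OF assms(1) d] unfolding eventually_at_infinity by blast
  have "\<bar>sphere_mean w p r\<bar> < e" if r: "r > max (max R0 1) (B + norm p)" for r
  proof -
    have "\<bar>sphere_integral p r w\<bar> \<le> 4 * pi * r\<^sup>2 * d"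
    proof (rule sphere_integral_abs_le)
      show "continuous_on (sphere p r) w" using assms(2,3) r by (auto intro: continuous_on_subset)
      show "\<bar>w x\<bar> \<le> d" if "dist p x = r" for x
      proof -
        have "norm x \<ge> B" using that r norm_triangle_ineq4[of p x] by (simp add: dist_norm)
        then show ?thesis using B[of x] by (simp add: dist_real_def)
      qed
    qed (use r in auto)
    then have "r\<^sup>2 * \<bar>sphere_mean w p r\<bar> \<le> r\<^sup>2 * (4 * pi * d)"
      by (simp add: sphere_integral_eq_mean abs_mult mult_ac)
    then have "\<bar>sphere_mean w p r\<bar> \<le> 4 * pi * d" using r by simp
    also have "\<dots> < e" using e by (simp add: d_def)
    finally show ?thesis .
  qed
  then show "\<forall>\<^sub>F r in at_top. dist (sphere_mean w p r) 0 < e"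
    unfolding eventually_at_top_dense
    by (intro exI[of _ "max (max R0 1) (B + norm p)"]) (auto simp: dist_real_def)
qed

text \<open>The same first order equation makes \<open>M + \<kappa>\<close> a constant divided by
  \<open>r\<close>, which tends to 0, and \<open>M\<close> tends to 0 with \<open>w\<close>.
  Integration in the radius takes the place of a decay estimate for the gradient.\<close>

lemma green_flux_infinity:
  assumes w: "harmonic_field S w W dW" and S: "\<And>r. r > R0 \<Longrightarrow> sphere p r \<subseteq> S" and R0: "R0 \<ge> 0"
    and lim: "(w \<longlongrightarrow> 0) at_infinity"
    and const: "\<And>r. r > R0 \<Longrightarrow> sphere_flux (green_field w W (newton p) (newton_grad p)) p r = \<kappa>"
  shows "\<kappa> = 0"
proof -
  define f where "f r = r * sphere_mean w p r + \<kappa> * r" for r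
  have der: "(f has_real_derivative 0) (at r)" if r: "r > R0" for r
  proof -
    have "((\<lambda>r. r * sphere_mean w p r) has_real_derivative
        - sphere_flux (green_field w W (newton p) (newton_grad p)) p r) (at r)"
      by (rule green_flux_centred[OF w, of "{R0<..}"]) (use r R0 S in auto)
    from DERIV_add[OF this DERIV_cmult_Id[of \<kappa>]] show ?thesis unfolding f_def using const[OF r] by simp
  qed
  have fc: "f r = f (R0 + 1)" if "r > R0 + 1" for r
    by (rule DERIV_isconst_end[OF that])
      (auto intro!: der DERIV_continuous_on[of _ f "\<lambda>_. 0"] intro: has_field_derivative_at_within)
  have "((\<lambda>r. f (R0 + 1) / r) \<longlongrightarrow> 0) at_top"
    by (intro tendsto_divide_0[OF tendsto_const] filterlim_at_top_imp_at_infinity filterlim_ident)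
  moreover have "\<forall>\<^sub>F r in at_top. f (R0 + 1) / r = sphere_mean w p r + \<kappa>"
    using eventually_gt_at_top[of "R0 + 1"]
  proof eventually_elim
    case (elim r)
    then have "f (R0 + 1) = r * (sphere_mean w p r + \<kappa>)" using fc[of r] by (simp add: f_def algebra_simps)
    then show ?case using elim R0 by simp
  qed
  ultimately have "((\<lambda>r. sphere_mean w p r + \<kappa>) \<longlongrightarrow> 0) at_top"
    by (rule Lim_transform_eventually)
  moreover have "((\<lambda>r. sphere_mean w p r + \<kappa>) \<longlongrightarrow> 0 + \<kappa>) at_top"
    by (intro tendsto_intros sphere_mean_tendsto_0[OF lim harmonic_fieldD(6)[OF w] S])
  ultimately show ?thesis using tendsto_unique[OF trivial_limit_at_top_linorder] by fastforce
qed

lemma sphere_flux_cong: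
  "r \<ge> 0 \<Longrightarrow> (\<And>x. dist c x = r \<Longrightarrow> F x = F' x) \<Longrightarrow> sphere_flux F c r = sphere_flux F' c r"
  unfolding sphere_flux_def by (rule sphere_integral_cong) auto

text \<open>For spheres of radii \<open>r1 + t\<close> and \<open>r2 + t\<close> the sum of the
  fluxes equals the flux through every large sphere, which is 0. The boundary spheres are reached by
  letting \<open>t\<close> tend to 0, as \<open>w\<close> and its gradient extend
  continuously.\<close>

lemma green_exterior_eq_0:
  fixes c1 c2 p :: "real ^ 3" and r1 r2 :: real
  defines "\<Omega> \<equiv> - (cball c1 r1 \<union> cball c2 r2)" and "\<Omega>' \<equiv> - (ball c1 r1 \<union> ball c2 r2)"
  assumes r: "0 < r1" "0 < r2" "r1 + r2 < dist c1 c2" and p: "p \<in> ball c1 r1 \<union> ball c2 r2"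
    and w: "harmonic_field \<Omega> w W dW" and lim: "(w \<longlongrightarrow> 0) at_infinity"
    and cont: "continuous_on \<Omega>' w" "continuous_on \<Omega>' G" and G: "\<And>x. x \<in> \<Omega> \<Longrightarrow> G x = W x"
  shows "sphere_flux (green_field w G (newton p) (newton_grad p)) c1 r1 +
    sphere_flux (green_field w G (newton p) (newton_grad p)) c2 r2 = 0"
proof -
  let ?F = "green_field w W (newton p) (newton_grad p)" and ?F' = "green_field w G (newton p) (newton_grad p)"
  \<comment> \<open>A quarter of the gap, so that spheres enlarged by at most \<open>e\<close> stay
    apart.\<close>
  define e where "e = (dist c1 c2 - r1 - r2) / 4"
  have "4 * e = dist c1 c2 - r1 - r2" by (simp add: e_def)
  then have e: "e > 0" "r1 + r2 + 4 * e = dist c1 c2" using r by linarith+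
  have tri: "dist c1 c2 \<le> dist c1 x + dist c2 x" for x using dist_triangle[of c1 c2 x] by (simp add: dist_commute)
  have inner: "sphere_flux ?F' c1 (r1 + t) + sphere_flux ?F' c2 (r2 + t) = 0" if t: "0 < t" "t \<le> e" for t
  proof -
    define R0 where "R0 = max (dist p c1 + (r1 + t)) (dist p c2 + (r2 + t))"
    define \<kappa> where "\<kappa> = sphere_flux ?F c1 (r1 + t) + sphere_flux ?F c2 (r2 + t)"
    have "\<kappa> = 0"
    proof (rule green_flux_infinity[OF w _ _ lim])
      show "sphere p r \<subseteq> \<Omega>" if "r > R0" for r
      proof
        fix x assume "x \<in> sphere p r"
        then show "x \<in> \<Omega>" using that t dist_triangle[of p x c1] dist_triangle[of p x c2] by (auto simp: \<Omega>_def R0_def)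
      qed
      show "R0 \<ge> 0" using r t by (auto simp: R0_def intro!: max.coboundedI1 add_nonneg_nonneg)
      show "sphere_flux ?F p R = \<kappa>" if "R > R0" for R
        unfolding \<kappa>_def
        by (rule green_exterior_sum[OF w[unfolded \<Omega>_def], symmetric]) (use r t e p that in \<open>auto simp: R0_def\<close>)
    qed
    moreover have "sphere_flux ?F c1 (r1 + t) = sphere_flux ?F' c1 (r1 + t)"
      "sphere_flux ?F c2 (r2 + t) = sphere_flux ?F' c2 (r2 + t)"
    proof -
      have "x \<in> \<Omega>" if "dist c1 x = r1 + t \<or> dist c2 x = r2 + t" for x
        using that tri[of x] t e unfolding \<Omega>_def by auto
      then show "sphere_flux ?F c1 (r1 + t) = sphere_flux ?F' c1 (r1 + t)"
        "sphere_flux ?F c2 (r2 + t) = sphere_flux ?F' c2 (r2 + t)"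
        using r t by (auto intro!: sphere_flux_cong simp: green_field_def G)
    qed
    ultimately show ?thesis by (simp add: \<kappa>_def)
  qed
  have pn: "\<Omega>' \<subseteq> - {p}" using p by (auto simp: \<Omega>'_def)
  have contF: "continuous_on \<Omega>' ?F'"
    unfolding green_field_def[abs_def]
    by (intro continuous_intros cont continuous_on_subset[OF harmonic_fieldD(2)[OF harmonic_field_newton] pn]
        continuous_on_subset[OF harmonic_fieldD(6)[OF harmonic_field_newton] pn])
  have "continuous_on {r1..r1 + e} (sphere_flux ?F' c1)"
  proof (rule continuous_on_sphere_flux[OF r(1) continuous_on_subset[OF contF]], rule subsetI)
    fix x assume "x \<in> cball c1 (r1 + e) - ball c1 r1"
    then show "x \<in> \<Omega>'" using tri[of x] e r by (auto simp: \<Omega>'_def)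
  qed
  then have 1: "continuous_on {0..e} (\<lambda>t. sphere_flux ?F' c1 (r1 + t))"
    by (rule continuous_on_compose2) (auto intro!: continuous_intros)
  have "continuous_on {r2..r2 + e} (sphere_flux ?F' c2)"
  proof (rule continuous_on_sphere_flux[OF r(2) continuous_on_subset[OF contF]], rule subsetI)
    fix x assume "x \<in> cball c2 (r2 + e) - ball c2 r2"
    then show "x \<in> \<Omega>'" using tri[of x] e r by (auto simp: \<Omega>'_def)
  qed
  then have 2: "continuous_on {0..e} (\<lambda>t. sphere_flux ?F' c2 (r2 + t))"
    by (rule continuous_on_compose2) (auto intro!: continuous_intros)
  have c12: "continuous_on {0..e} (\<lambda>t. sphere_flux ?F' c1 (r1 + t) + sphere_flux ?F' c2 (r2 + t))"
    by (intro continuous_intros 1 2)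
  have "0 \<in> {0..e}" using e by simp
  from bspec[OF c12[unfolded continuous_on_def] this] have "((\<lambda>t. sphere_flux ?F' c1 (r1 + t) + sphere_flux ?F' c2 (r2 + t)) \<longlongrightarrow>
      sphere_flux ?F' c1 (r1 + 0) + sphere_flux ?F' c2 (r2 + 0)) (at 0 within {0..e})"
    .
  then have "((\<lambda>t. sphere_flux ?F' c1 (r1 + t) + sphere_flux ?F' c2 (r2 + t)) \<longlongrightarrow>
      sphere_flux ?F' c1 (r1 + 0) + sphere_flux ?F' c2 (r2 + 0)) (at_right 0)"
    by (simp add: at_within_Icc_at_right e)
  moreover have "((\<lambda>t. sphere_flux ?F' c1 (r1 + t) + sphere_flux ?F' c2 (r2 + t)) \<longlongrightarrow> 0) (at_right 0)"
    by (rule tendsto_eventually) (use inner e in \<open>auto simp: eventually_at_right_field intro!: exI[of _ e]\<close>)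
  ultimately show ?thesis using tendsto_unique[OF trivial_limit_at_right_real] by fastforce
qed

text \<open>Green's identity for \<open>u - H\<close>, which decays at infinity. On each sphere
  \<open>u\<close> is a constant, and constants as well as \<open>H\<close> are harmonic inside the
  ball, so their contributions are known. What survives are the single-layer integrals of the normal
  derivative of \<open>u\<close>.\<close>

lemma green_charge_identity:
  fixes c1 c2 p :: "real ^ 3" and r1 r2 :: real
  defines "\<Omega> \<equiv> - (cball c1 r1 \<union> cball c2 r2)" and "\<Omega>' \<equiv> - (ball c1 r1 \<union> ball c2 r2)"
  assumes r: "0 < r1" "0 < r2" "r1 + r2 < dist c1 c2" and p: "p \<in> ball c1 r1 \<union> ball c2 r2"
    and u: "harmonic_on \<Omega> u" and cont: "continuous_on \<Omega>' u" "continuous_on \<Omega>' G"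
    and G: "\<And>x. x \<in> \<Omega> \<Longrightarrow> GDERIV u x :> G x"
    and V: "harmonic_field UNIV H V dV" and lim: "((\<lambda>x. u x - H x) \<longlongrightarrow> 0) at_infinity"
    and U: "\<And>x. x \<in> sphere c1 r1 \<Longrightarrow> u x = U1" "\<And>x. x \<in> sphere c2 r2 \<Longrightarrow> u x = U2"
  shows "sphere_integral c1 r1 (\<lambda>x. newton p x * (G x \<bullet> (x - c1) / r1)) +
    sphere_integral c2 r2 (\<lambda>x. newton p x * (G x \<bullet> (x - c2) / r2)) =
    4 * pi * (H p - (if p \<in> ball c1 r1 then U1 else U2))"
proof -
  obtain W dW where W: "harmonic_field \<Omega> u W dW" by (rule harmonic_on_imp_field[OF u])
  note V' = harmonic_fieldD[OF V]
  have GW: "G x = W x" if "x \<in> \<Omega>" for x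
  proof -
    have "(\<lambda>h. h \<bullet> G x) = (\<lambda>h. h \<bullet> W x)"
      using has_derivative_unique G[OF that] harmonic_fieldD(1)[OF W that] unfolding gderiv_def by blast
    then have "(G x - W x) \<bullet> G x = (G x - W x) \<bullet> W x" by (rule fun_cong)
    then have "(G x - W x) \<bullet> (G x - W x) = 0" by (simp add: inner_diff_right)
    then show ?thesis by simp
  qed
  let ?g = "newton p" and ?A = "newton_grad p"
  have 0: "sphere_flux (green_field (\<lambda>x. u x - H x) (\<lambda>x. G x - V x) ?g ?A) c1 r1 +
      sphere_flux (green_field (\<lambda>x. u x - H x) (\<lambda>x. G x - V x) ?g ?A) c2 r2 = 0"
  proof (rule green_exterior_eq_0[OF r p _ lim])
    show "harmonic_field (- (cball c1 r1 \<union> cball c2 r2)) (\<lambda>x. u x - H x) (\<lambda>x. W x - V x) (\<lambda>i x. dW i x - dV i x)"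
      using harmonic_field_diff[OF W harmonic_field_subset[OF V]] by (simp add: \<Omega>_def)
    show "continuous_on (- (ball c1 r1 \<union> ball c2 r2)) (\<lambda>x. u x - H x)"
      "continuous_on (- (ball c1 r1 \<union> ball c2 r2)) (\<lambda>x. G x - V x)"
      using cont unfolding \<Omega>'_def by (auto intro!: continuous_intros continuous_on_subset[OF V'(6)] continuous_on_subset[OF V'(2)])
  qed (use GW in \<open>auto simp: \<Omega>_def\<close>)
  have sp: "sphere_flux (green_field (\<lambda>x. u x - H x) (\<lambda>x. G x - V x) ?g ?A) c r =
      (if p \<in> ball c r then 4 * pi * (H p - k) else 0) - sphere_integral c r (\<lambda>x. ?g x * (G x \<bullet> (x - c) / r))"
    if rp: "0 < r" and sub: "sphere c r \<subseteq> \<Omega>'" and k: "\<And>x. x \<in> sphere c r \<Longrightarrow> u x = k" for c r k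
  proof -
    have pn: "sphere c r \<subseteq> - {p}" using p sub by (auto simp: \<Omega>'_def)
    then have pc: "dist c p \<noteq> r" by auto
    have cA: "continuous_on (sphere c r) ?A" and cg: "continuous_on (sphere c r) ?g"
      using continuous_on_subset[OF harmonic_fieldD(2)[OF harmonic_field_newton] pn]
        continuous_on_subset[OF harmonic_fieldD(6)[OF harmonic_field_newton] pn] by auto
    have cG: "continuous_on (sphere c r) G" by (rule continuous_on_subset[OF cont(2) sub])
    have cH: "continuous_on (sphere c r) H" "continuous_on (sphere c r) V"
      using continuous_on_subset[OF V'(6)] continuous_on_subset[OF V'(2)] by auto
    have one: "sphere_flux (green_field (\<lambda>x. 1) (\<lambda>x. 0) ?g ?A) c r = (if p \<in> ball c r then - (4 * pi) else 0)"
      using green_flux_point[OF harmonic_field_const[of UNIV 1], of c p r] 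
        green_ball_eq_0[OF harmonic_field_const[of UNIV 1] rp, of c p] pc by auto
    have Hf: "sphere_flux (green_field H V ?g ?A) c r = (if p \<in> ball c r then - (4 * pi * H p) else 0)"
      using green_flux_point[OF V, of c p r] green_ball_eq_0[OF V rp, of c p] pc by auto
    \<comment> \<open>Splits the field into a multiple of the one for the constant 1, the one for
      \<open>H\<close>, and the unknown normal derivative of \<open>u\<close>.\<close>
    have "sphere_flux (green_field (\<lambda>x. u x - H x) (\<lambda>x. G x - V x) ?g ?A) c r =
      sphere_integral c r (\<lambda>x. (k * (green_field (\<lambda>x. 1) (\<lambda>x. 0) ?g ?A x \<bullet> (x - c) / r)
        - green_field H V ?g ?A x \<bullet> (x - c) / r) - ?g x * (G x \<bullet> (x - c) / r))"
      unfolding sphere_flux_def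
    proof (rule sphere_integral_cong)
      fix x assume "dist c x = r"
      then have "u x = k" using k by simp
      then show "green_field (\<lambda>x. u x - H x) (\<lambda>x. G x - V x) ?g ?A x \<bullet> (x - c) / r =
        (k * (green_field (\<lambda>x. 1) (\<lambda>x. 0) ?g ?A x \<bullet> (x - c) / r)
        - green_field H V ?g ?A x \<bullet> (x - c) / r) - ?g x * (G x \<bullet> (x - c) / r)"
        by (simp add: green_field_def inner_diff_left add_divide_distrib diff_divide_distrib algebra_simps)
    qed (use rp in simp)
    also have "\<dots> = (k * sphere_flux (green_field (\<lambda>x. 1) (\<lambda>x. 0) ?g ?A) c r - sphere_flux (green_field H V ?g ?A) c r)
        - sphere_integral c r (\<lambda>x. ?g x * (G x \<bullet> (x - c) / r))"
      unfolding sphere_flux_def sphere_integral_cmult[symmetric]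
      by (subst sphere_integral_diff sphere_integral_diff;
          use rp in \<open>auto intro!: continuous_intros cA cg cG cH simp: green_field_def\<close>)+
    finally have f: "sphere_flux (green_field (\<lambda>x. u x - H x) (\<lambda>x. G x - V x) ?g ?A) c r =
        (k * (if p \<in> ball c r then - (4 * pi) else 0) - (if p \<in> ball c r then - (4 * pi * H p) else 0))
        - sphere_integral c r (\<lambda>x. ?g x * (G x \<bullet> (x - c) / r))" unfolding one Hf .
    have "k * (if b then - (4 * pi) else 0) - (if b then - (4 * pi * H p) else 0) =
        (if b then 4 * pi * (H p - k) else 0)" for b
      by (simp add: algebra_simps)
    then show ?thesis unfolding f by simp
  qed
  have tri: "dist c1 c2 \<le> dist c1 x + dist c2 x" for x using dist_triangle[of c1 c2 x] by (simp add: dist_commute)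
  have "x \<in> \<Omega>'" if "x \<in> sphere c1 r1 \<union> sphere c2 r2" for x
    using tri[of x] r that by (auto simp: \<Omega>'_def)
  then have "sphere c1 r1 \<subseteq> \<Omega>'" "sphere c2 r2 \<subseteq> \<Omega>'" by auto
  then have "(if p \<in> ball c1 r1 then 4 * pi * (H p - U1) else 0) - sphere_integral c1 r1 (\<lambda>x. ?g x * (G x \<bullet> (x - c1) / r1))
     + ((if p \<in> ball c2 r2 then 4 * pi * (H p - U2) else 0) - sphere_integral c2 r2 (\<lambda>x. ?g x * (G x \<bullet> (x - c2) / r2))) = 0"
    using 0 sp[OF r(1), of c1 U1] sp[OF r(2), of c2 U2] U by simp
  moreover have "\<not> (p \<in> ball c1 r1 \<and> p \<in> ball c2 r2)" using tri[of p] r by auto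
  ultimately show ?thesis using p by (auto split: if_splits)
qed

text \<open>Along the outward ray the difference quotient is \<open>G \<bullet> \<nu>\<close> at an
  intermediate point, by the mean value theorem, and \<open>G\<close> is continuous up to
  \<open>x\<close>.\<close>

lemma normal_deriv_eq:
  assumes r: "0 < r" and x: "dist c x = r"
    and G: "\<And>y. y \<in> S \<Longrightarrow> GDERIV u y :> G y" and cont: "continuous_on T u" "continuous_on T G"
    and sub: "S \<subseteq> T" "x \<in> T" and e: "e > 0" "\<And>t. 0 < t \<Longrightarrow> t < e \<Longrightarrow> x + t *\<^sub>R ((x - c) /\<^sub>R r) \<in> S"
  shows "normal_deriv c r u x = G x \<bullet> (x - c) / r"
proof -
  define \<nu> where "\<nu> = (x - c) /\<^sub>R r"
  define \<gamma> where "\<gamma> t = x + t *\<^sub>R \<nu>" for t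
  have \<gamma>: "\<gamma> t \<in> S" if "0 < t" "t < e" for t using e(2)[OF that] by (simp add: \<gamma>_def \<nu>_def)
  have g0: "\<gamma> 0 = x" by (simp add: \<gamma>_def)
  have gT: "\<gamma> t \<in> T" if "0 \<le> t" "t < e" for t
    using \<gamma>[of t] that sub g0 by (cases "t = 0") auto
  have "((\<lambda>t. G (\<gamma> t) \<bullet> \<nu>) \<longlongrightarrow> G (\<gamma> 0) \<bullet> \<nu>) (at 0 within {0..e/2})"
  proof -
    have "continuous_on {0..e/2} (\<lambda>t. G (\<gamma> t) \<bullet> \<nu>)"
      by (intro continuous_intros continuous_on_compose2[OF cont(2)]) (use gT e(1) in \<open>auto simp: \<gamma>_def[abs_def] intro!: continuous_intros\<close>)
    then show ?thesis using e(1) by (auto simp: continuous_on_def)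
  qed
  then have limG: "((\<lambda>t. G (\<gamma> t) \<bullet> \<nu>) \<longlongrightarrow> G x \<bullet> \<nu>) (at_right 0)"
    using e(1) g0 by (simp add: at_within_Icc_at_right)
  have "((\<lambda>t. (u (\<gamma> t) - u x) / t) \<longlongrightarrow> G x \<bullet> \<nu>) (at_right 0)"
  proof (rule tendstoI)
    fix d :: real assume d: "d > 0"
    have "\<forall>\<^sub>F t in at_right 0. dist (G (\<gamma> t) \<bullet> \<nu>) (G x \<bullet> \<nu>) < d" by (rule tendstoD[OF limG d])
    then obtain b where b: "b > 0" "\<And>t. 0 < t \<Longrightarrow> t < b \<Longrightarrow> dist (G (\<gamma> t) \<bullet> \<nu>) (G x \<bullet> \<nu>) < d"
      unfolding eventually_at_right_field by auto
    have "dist ((u (\<gamma> t) - u x) / t) (G x \<bullet> \<nu>) < d" if t: "0 < t" "t < min b e" for t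
    proof -
      have "\<exists>s. 0 < s \<and> s < t \<and> (((\<lambda>t. u (\<gamma> t)) has_real_derivative (u (\<gamma> t) - u (\<gamma> 0)) / (t - 0)) (at s))"
      proof -
        have der: "((\<lambda>t. u (\<gamma> t)) has_real_derivative G (\<gamma> s) \<bullet> \<nu>) (at s)" if "0 < s" "s < t" for s
          unfolding \<gamma>_def by (rule GDERIV_line) (use G \<gamma>[of s] that t in \<open>auto simp: \<gamma>_def\<close>)
        have "continuous_on {0..t} (\<lambda>t. u (\<gamma> t))"
          by (rule continuous_on_compose2[OF cont(1)]) (use gT t in \<open>auto simp: \<gamma>_def[abs_def] intro!: continuous_intros\<close>)
        then obtain l z where "0 < z" "z < t" "((\<lambda>t. u (\<gamma> t)) has_real_derivative l) (at z)"
            "u (\<gamma> t) - u (\<gamma> 0) = (t - 0) * l"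
          using MVT[OF t(1), of "\<lambda>t. u (\<gamma> t)"] der real_differentiable_def by metis
        then show ?thesis using t by (intro exI[of _ z]) auto
      qed
      moreover have "((\<lambda>t. u (\<gamma> t)) has_real_derivative G (\<gamma> s) \<bullet> \<nu>) (at s)" if "0 < s" "s < t" for s
        unfolding \<gamma>_def by (rule GDERIV_line) (use G \<gamma>[of s] that t in \<open>auto simp: \<gamma>_def\<close>)
      ultimately have "\<exists>s. 0 < s \<and> s < t \<and> u (\<gamma> t) - u (\<gamma> 0) = t * (G (\<gamma> s) \<bullet> \<nu>)"
        using t by (metis DERIV_unique diff_zero nonzero_mult_div_cancel_left times_divide_eq_right order_less_irrefl)
      then obtain s where s: "0 < s" "s < t" "u (\<gamma> t) - u x = t * (G (\<gamma> s) \<bullet> \<nu>)" by (auto simp: g0)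
      then show ?thesis using b(2)[of s] t by simp
    qed
    then show "\<forall>\<^sub>F t in at_right 0. dist ((u (\<gamma> t) - u x) / t) (G x \<bullet> \<nu>) < d"
      unfolding eventually_at_right_field using b(1) e(1) by (intro exI[of _ "min b e"]) auto
  qed
  then have "normal_deriv c r u x = G x \<bullet> \<nu>"
    unfolding normal_deriv_def \<gamma>_def \<nu>_def by (intro tendsto_Lim trivial_limit_at_right_real)
  then show ?thesis by (simp add: \<nu>_def divide_inverse mult.commute)
qed

section \<open>Image charges of two spheres\<close>

text \<open>In this parameter, inversion in the sphere with centre
  \<open>coth_point \<alpha> s\<close> and radius \<open>\<alpha> / \<bar>sinh s\<bar>\<close> is
  the map from \<open>a\<close> to \<open>s - a\<close>. The centre has parameter \<open>s\<close>,
  and infinity corresponds to 0. Two inversions compose to a shift.\<close>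

definition coth_point :: "real \<Rightarrow> real \<Rightarrow> real ^ 3" where
  "coth_point \<alpha> a = vector [0, 0, \<alpha> * cosh a / sinh a]"

text \<open>The distance to \<open>coth_point \<alpha> a\<close> times \<open>|sinh a|\<close>. It is invariant under reflections of \<open>a\<close> when
  \<open>x\<close> is on a sphere, and makes sense for \<open>a = 0\<close> as well.\<close>

definition image_dist :: "real \<Rightarrow> real \<Rightarrow> real ^ 3 \<Rightarrow> real" where
  "image_dist \<alpha> a x = norm (sinh a *\<^sub>R x - vector [0, 0, \<alpha> * cosh a])"

lemma image_dist_eq:
  assumes "a \<noteq> 0"
  shows "image_dist \<alpha> a x = \<bar>sinh a\<bar> * norm (x - coth_point \<alpha> a)"
proof -
  have "sinh a *\<^sub>R x - vector [0, 0, \<alpha> * cosh a] = sinh a *\<^sub>R (x - coth_point \<alpha> a)"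
    using assms by (simp add: vector_3_eq_iff coth_point_def right_diff_distrib)
  then show ?thesis by (simp add: image_dist_def)
qed

lemma image_dist_0: "\<alpha> \<ge> 0 \<Longrightarrow> image_dist \<alpha> 0 x = \<alpha>"
proof -
  assume "\<alpha> \<ge> 0"
  have "(norm (- vector [0, 0, \<alpha>] :: real ^ 3))\<^sup>2 = \<alpha>\<^sup>2" by (simp only: norm_vector_3_power2) simp
  then have "norm (- vector [0, 0, \<alpha>] :: real ^ 3) = \<alpha>" using \<open>\<alpha> \<ge> 0\<close> by (simp add: power2_eq_iff_nonneg)
  then show ?thesis by (simp add: image_dist_def)
qed

lemma image_dist_power2:
  "(image_dist \<alpha> a x)\<^sup>2 = (sinh a)\<^sup>2 * (norm x)\<^sup>2 - 2 * x $ 3 * \<alpha> * sinh a * cosh a + \<alpha>\<^sup>2 * (cosh a)\<^sup>2"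
  unfolding image_dist_def norm_vector_3_power2 by (simp add: power2_eq_square algebra_simps)

text \<open>The equation of the sphere eliminates \<open>norm x\<close>. The remaining product
  \<open>sinh a * sinh (a - s)\<close> is unchanged when \<open>a\<close> is replaced by
  \<open>s - a\<close>.\<close>

lemma image_dist_sphere_power2:
  assumes s: "s \<noteq> 0" and x: "dist (coth_point \<alpha> s) x = \<bar>\<alpha> / sinh s\<bar>"
  shows "(image_dist \<alpha> a x)\<^sup>2 = \<alpha>\<^sup>2 + 2 * x $ 3 * \<alpha> * sinh a * sinh (a - s) / sinh s"
proof -
  define S C z where "S = sinh s" and "C = cosh s" and "z = x $ 3"
  have S: "S \<noteq> 0" using s by (simp add: S_def)
  have CS: "C\<^sup>2 = S\<^sup>2 + 1" unfolding C_def S_def by (rule cosh_square_eq)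
  have "(norm (x - coth_point \<alpha> s))\<^sup>2 = (\<alpha> / S)\<^sup>2"
    using x by (simp add: dist_norm norm_minus_commute S_def power_divide)
  then have "(norm x)\<^sup>2 - 2 * z * (\<alpha> * C / S) + (\<alpha> * C / S)\<^sup>2 = (\<alpha> / S)\<^sup>2"
    unfolding norm_vector_3_power2 by (simp add: coth_point_def S_def C_def z_def power2_eq_square algebra_simps)
  moreover have "(\<alpha> * C / S)\<^sup>2 = \<alpha>\<^sup>2 + (\<alpha> / S)\<^sup>2"
    using S by (simp add: power_divide power_mult_distrib CS field_simps)
  ultimately have n: "(norm x)\<^sup>2 = 2 * z * (\<alpha> * C / S) - \<alpha>\<^sup>2" by linarith
  have "(image_dist \<alpha> a x)\<^sup>2 = \<alpha>\<^sup>2 * ((cosh a)\<^sup>2 - (sinh a)\<^sup>2) + 2 * z * \<alpha> * sinh a * ((sinh a * C - cosh a * S) / S)"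
    unfolding image_dist_power2 n z_def[symmetric] using S
    by (simp add: field_simps power2_eq_square)
  also have "sinh a * C - cosh a * S = sinh (a - s)" by (simp add: sinh_diff C_def S_def)
  also have "(cosh a)\<^sup>2 - (sinh a)\<^sup>2 = 1" by (simp add: cosh_square_eq)
  finally show ?thesis by (simp add: S_def z_def)
qed

lemma image_dist_reflect:
  assumes "s \<noteq> 0" "dist (coth_point \<alpha> s) x = \<bar>\<alpha> / sinh s\<bar>"
  shows "image_dist \<alpha> a x = image_dist \<alpha> (s - a) x"
proof -
  have "sinh a * sinh (a - s) = sinh (s - a) * sinh (s - a - s)"
    using sinh_minus[of "s - a"] by simp
  then have "(image_dist \<alpha> a x)\<^sup>2 = (image_dist \<alpha> (s - a) x)\<^sup>2"
    unfolding image_dist_sphere_power2[OF assms] by (simp add: mult.assoc)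
  then show ?thesis by (simp add: image_dist_def)
qed

lemma dist_axis: "dist (vector [0, 0, a] :: real ^ 3) (vector [0, 0, b]) = \<bar>a - b\<bar>"
proof -
  have "(dist (vector [0, 0, a] :: real ^ 3) (vector [0, 0, b]))\<^sup>2 = (a - b)\<^sup>2"
    unfolding dist_norm norm_vector_3_power2 by simp
  then show ?thesis by (metis abs_of_nonneg real_sqrt_abs zero_le_dist)
qed

text \<open>The difference \<open>coth s - coth b\<close> equals
  \<open>sinh (b - s) / (sinh s * sinh b)\<close>, and \<open>sinh (b - s) < sinh b\<close>. The
  case \<open>b = s\<close> is the centre of the ball.\<close>

lemma coth_point_in_ball:
  assumes "\<alpha> > 0" "0 < s" "s \<le> b"
  shows "coth_point \<alpha> b \<in> ball (coth_point \<alpha> s) (\<alpha> / sinh s)"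
    "coth_point \<alpha> (- b) \<in> ball (coth_point \<alpha> (- s)) (\<alpha> / sinh s)"
proof -
  have S: "sinh s > 0" "sinh b > 0" using assms by auto
  have "cosh s / sinh s - cosh b / sinh b = sinh (b - s) / (sinh s * sinh b)"
    using S by (simp add: field_simps sinh_diff)
  moreover have "sinh (b - s) \<ge> 0" using assms by simp
  moreover have "sinh (b - s) < sinh b" using assms by simp
  ultimately have "\<bar>cosh s / sinh s - cosh b / sinh b\<bar> < 1 / sinh s"
    using S by (simp add: divide_simps)
  from mult_strict_left_mono[OF this assms(1)]
  have "\<alpha> * \<bar>cosh s / sinh s - cosh b / sinh b\<bar> < \<alpha> * (1 / sinh s)" .
  moreover have "\<alpha> * \<bar>cosh s / sinh s - cosh b / sinh b\<bar> = \<bar>\<alpha> * cosh s / sinh s - \<alpha> * cosh b / sinh b\<bar>"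
    using assms by (simp add: abs_mult_pos' right_diff_distrib)
  ultimately have "\<bar>\<alpha> * cosh s / sinh s - \<alpha> * cosh b / sinh b\<bar> < \<alpha> / sinh s" by simp
  then show "coth_point \<alpha> b \<in> ball (coth_point \<alpha> s) (\<alpha> / sinh s)"
    "coth_point \<alpha> (- b) \<in> ball (coth_point \<alpha> (- s)) (\<alpha> / sinh s)"
    by (auto simp: coth_point_def dist_axis)
qed

text \<open>\<open>a m\<close> and \<open>b m\<close> locate the image charges in the balls \<open>A\<close> and \<open>B\<close>. On the sphere \<open>B\<close> the potential
  of each pair vanishes, on the sphere \<open>A\<close> the potentials of the pairs telescope to \<open>1\<close>.\<close>

lemma image_charges_sums:
  fixes a b :: "nat \<Rightarrow> real"
  assumes \<alpha>: "\<alpha> > 0" and r: "0 < rA" "0 < rB" "rA + rB < dist cA cB"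
    and ab: "\<And>m. a m \<noteq> 0" "\<And>m. b m \<noteq> 0"
    and A: "\<And>m. coth_point \<alpha> (a m) \<in> ball cA rA" and B: "\<And>m. coth_point \<alpha> (b m) \<in> ball cB rB"
    and A0: "\<And>x. x \<in> sphere cA rA \<Longrightarrow> image_dist \<alpha> (a 0) x = \<alpha>"
    and AS: "\<And>m x. x \<in> sphere cA rA \<Longrightarrow> image_dist \<alpha> (a (Suc m)) x = image_dist \<alpha> (b m) x"
    and BB: "\<And>m x. x \<in> sphere cB rB \<Longrightarrow> image_dist \<alpha> (a m) x = image_dist \<alpha> (b m) x"
    and lim: "filterlim (\<lambda>m. \<bar>sinh (b m)\<bar>) at_top sequentially"
    and q: "continuous_on (sphere cA rA) qA" "continuous_on (sphere cB rB) qB"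
    and idA: "\<And>p. p \<in> ball cA rA \<Longrightarrow> sphere_integral cA rA (\<lambda>x. newton p x * qA x) +
      sphere_integral cB rB (\<lambda>x. newton p x * qB x) = 4 * pi * (H p - UA)"
    and idB: "\<And>p. p \<in> ball cB rB \<Longrightarrow> sphere_integral cA rA (\<lambda>x. newton p x * qA x) +
      sphere_integral cB rB (\<lambda>x. newton p x * qB x) = 4 * pi * (H p - UB)"
  shows "(\<lambda>m. 4 * pi * (\<alpha> / \<bar>sinh (a m)\<bar> * (H (coth_point \<alpha> (a m)) - UA) -
      \<alpha> / \<bar>sinh (b m)\<bar> * (H (coth_point \<alpha> (b m)) - UB))) sums sphere_integral cA rA qA"
proof -
  define T where "T m = 4 * pi * (\<alpha> / \<bar>sinh (a m)\<bar> * (H (coth_point \<alpha> (a m)) - UA) -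
      \<alpha> / \<bar>sinh (b m)\<bar> * (H (coth_point \<alpha> (b m)) - UB))" for m
  \<comment> \<open>The potential of a pair of charges of strengths
    \<open>\<alpha> / \<bar>sinh (a m)\<bar>\<close> and
    \<open>- \<alpha> / \<bar>sinh (b m)\<bar>\<close>.\<close>
  define P where "P m x = \<alpha> / image_dist \<alpha> (a m) x - \<alpha> / image_dist \<alpha> (b m) x" for m x
  \<comment> \<open>What telescoping leaves over: the potential of the last charge in
    \<open>B\<close>, tested on the sphere \<open>A\<close>.\<close>
  define E where "E m = sphere_integral cA rA (\<lambda>x. \<alpha> / image_dist \<alpha> (b m) x * qA x)" for m
  have tri: "dist cA cB \<le> dist cA x + dist cB x" for x using dist_triangle[of cA cB x] by (simp add: dist_commute)
  have id_newton: "\<alpha> / image_dist \<alpha> t x = \<alpha> / \<bar>sinh t\<bar> * newton (coth_point \<alpha> t) x" if "t \<noteq> 0" for t x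
    by (simp add: image_dist_eq[OF that] newton_def)
  have notin: "x \<noteq> coth_point \<alpha> t" if "x \<in> sphere cA rA \<union> sphere cB rB"
      "coth_point \<alpha> t \<in> ball cA rA \<or> coth_point \<alpha> t \<in> ball cB rB" for x t
    using that tri[of x] r by auto
  have cont: "continuous_on (sphere cA rA) (newton (coth_point \<alpha> t))" "continuous_on (sphere cB rB) (newton (coth_point \<alpha> t))"
    if "coth_point \<alpha> t \<in> ball cA rA \<or> coth_point \<alpha> t \<in> ball cB rB" for t
    using notin[OF _ that] unfolding newton_def[abs_def]
    by (auto intro!: continuous_intros)
  have contb: "continuous_on (sphere cA rA) (\<lambda>x. \<alpha> / image_dist \<alpha> (b m) x)" for m
    unfolding id_newton[OF ab(2)] by (intro continuous_intros cont disjI2 B)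
  have T_eq: "T m = sphere_integral cA rA (\<lambda>x. P m x * qA x)" for m
  proof -
    let ?ka = "\<alpha> / \<bar>sinh (a m)\<bar>" and ?kb = "\<alpha> / \<bar>sinh (b m)\<bar>"
    let ?na = "newton (coth_point \<alpha> (a m))" and ?nb = "newton (coth_point \<alpha> (b m))"
    have PA: "P m x = ?ka * ?na x - ?kb * ?nb x" for x
      unfolding P_def id_newton[OF ab(1)] id_newton[OF ab(2)] ..
    have lin: "sphere_integral c r (\<lambda>x. P m x * q x) =
        ?ka * sphere_integral c r (\<lambda>x. ?na x * q x) - ?kb * sphere_integral c r (\<lambda>x. ?nb x * q x)"
      if "r > 0" "continuous_on (sphere c r) q" "continuous_on (sphere c r) ?na" "continuous_on (sphere c r) ?nb" for c r q
    proof -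
      have "sphere_integral c r (\<lambda>x. P m x * q x) =
          sphere_integral c r (\<lambda>x. ?ka * (?na x * q x) - ?kb * (?nb x * q x))"
        unfolding PA by (simp add: algebra_simps)
      also have "\<dots> = ?ka * sphere_integral c r (\<lambda>x. ?na x * q x) - ?kb * sphere_integral c r (\<lambda>x. ?nb x * q x)"
        unfolding sphere_integral_cmult[symmetric] using that
        by (intro sphere_integral_diff continuous_on_mult continuous_on_const) auto
      finally show ?thesis .
    qed
    have "sphere_integral cB rB (\<lambda>x. P m x * qB x) = sphere_integral cB rB (\<lambda>x. 0)"
      by (rule sphere_integral_cong) (use r BB in \<open>auto simp: P_def\<close>)
    then have "sphere_integral cB rB (\<lambda>x. P m x * qB x) = 0" by (simp add: sphere_integral_const)
    moreover have "T m = sphere_integral cA rA (\<lambda>x. P m x * qA x) + sphere_integral cB rB (\<lambda>x. P m x * qB x)"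
    proof -
      have "4 * pi * (ka * x - kb * y) = ka * (4 * pi * x) - kb * (4 * pi * y)" for ka kb x y :: real
        by (simp add: algebra_simps)
      then have "T m = ?ka * (4 * pi * (H (coth_point \<alpha> (a m)) - UA)) - ?kb * (4 * pi * (H (coth_point \<alpha> (b m)) - UB))"
        unfolding T_def by blast
      then show ?thesis
        unfolding lin[OF r(1) q(1) cont(1)[OF disjI1[OF A]] cont(1)[OF disjI2[OF B]]]
          lin[OF r(2) q(2) cont(2)[OF disjI1[OF A]] cont(2)[OF disjI2[OF B]]]
          idA[OF A, symmetric] idB[OF B, symmetric]
        by (simp add: algebra_simps)
    qed
    ultimately show ?thesis by simp
  qed
  have partial: "(\<Sum>m\<le>n. T m) = sphere_integral cA rA qA - E n" for n
  proof (induction n)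
    case 0
    have "T 0 = sphere_integral cA rA (\<lambda>x. qA x - \<alpha> / image_dist \<alpha> (b 0) x * qA x)"
      unfolding T_eq by (rule sphere_integral_cong) (use r A0 \<alpha> in \<open>auto simp: P_def algebra_simps\<close>)
    also have "\<dots> = sphere_integral cA rA qA - E 0"
      unfolding E_def using r by (intro sphere_integral_diff continuous_intros q contb) auto
    finally show ?case by simp
  next
    case (Suc n)
    have "T (Suc n) = sphere_integral cA rA (\<lambda>x. \<alpha> / image_dist \<alpha> (b n) x * qA x - \<alpha> / image_dist \<alpha> (b (Suc n)) x * qA x)"
      unfolding T_eq by (rule sphere_integral_cong) (use r AS \<alpha> in \<open>auto simp: P_def algebra_simps\<close>)
    also have "\<dots> = E n - E (Suc n)"
      unfolding E_def using r by (intro sphere_integral_diff continuous_intros q contb) auto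
    finally show ?case using Suc by simp
  qed
  \<comment> \<open>The last charge has a strength that tends to 0, while its distance from the
    sphere \<open>A\<close> is at least the gap \<open>e\<close>.\<close>
  have "E \<longlonglongrightarrow> 0"
  proof -
    obtain M where "\<forall>x\<in>sphere cA rA. \<bar>qA x\<bar> \<le> M"
      using compact_imp_bounded[OF compact_continuous_image[OF q(1) compact_sphere]]
      unfolding bounded_iff by auto
    then have M: "\<And>x. x \<in> sphere cA rA \<Longrightarrow> \<bar>qA x\<bar> \<le> M" by blast
    define e where "e = dist cA cB - rA - rB"
    have e: "e > 0" using r by (simp add: e_def)
    have M0: "M \<ge> 0"
    proof -
      have "cA + rA *\<^sub>R axis 1 1 \<in> sphere cA rA" using r by (simp add: dist_norm)
      then show ?thesis using M by force
    qed
    have "\<bar>E m\<bar> \<le> 4 * pi * rA\<^sup>2 * (\<alpha> / e * M) / \<bar>sinh (b m)\<bar>" for m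
    proof -
      have "\<bar>E m\<bar> \<le> 4 * pi * rA\<^sup>2 * (\<alpha> / (\<bar>sinh (b m)\<bar> * e) * M)"
        unfolding E_def
      proof (rule sphere_integral_abs_le)
        show "continuous_on (sphere cA rA) (\<lambda>x. \<alpha> / image_dist \<alpha> (b m) x * qA x)"
          by (intro continuous_intros q contb)
        fix x assume x: "dist cA x = rA"
        have "dist cA cB \<le> dist cA x + dist x (coth_point \<alpha> (b m)) + dist (coth_point \<alpha> (b m)) cB"
          using dist_triangle[of cA cB x] dist_triangle[of x cB "coth_point \<alpha> (b m)"] by linarith
        then have "e \<le> norm (x - coth_point \<alpha> (b m))" using B[of m] x by (simp add: e_def dist_norm norm_minus_commute)
        then have "\<bar>sinh (b m)\<bar> * e \<le> image_dist \<alpha> (b m) x"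
          unfolding image_dist_eq[OF ab(2)] by (intro mult_left_mono) auto
        moreover have "\<bar>sinh (b m)\<bar> * e > 0" using e ab(2) by simp
        ultimately have "\<alpha> / image_dist \<alpha> (b m) x \<le> \<alpha> / (\<bar>sinh (b m)\<bar> * e)" "0 \<le> \<alpha> / image_dist \<alpha> (b m) x"
          using \<alpha> by (auto intro!: divide_left_mono mult_pos_pos)
        then show "\<bar>\<alpha> / image_dist \<alpha> (b m) x * qA x\<bar> \<le> \<alpha> / (\<bar>sinh (b m)\<bar> * e) * M"
          unfolding abs_mult using M[of x] x M0 by (intro mult_mono) auto
      qed (use r in auto)
      then show ?thesis by (simp add: mult_ac)
    qed
    moreover have "(\<lambda>m. 4 * pi * rA\<^sup>2 * (\<alpha> / e * M) / \<bar>sinh (b m)\<bar>) \<longlonglongrightarrow> 0"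
      by (intro tendsto_divide_0[OF tendsto_const] filterlim_at_top_imp_at_infinity lim)
    ultimately show ?thesis by (intro Lim_null_comparison[of E]) auto
  qed
  then have "(\<lambda>n. \<Sum>m\<le>n. T m) \<longlonglongrightarrow> sphere_integral cA rA qA - 0"
    unfolding partial by (intro tendsto_intros)
  then show ?thesis by (simp add: sums_def_le T_def)
qed

text \<open>The poles \<open>(0, 0, \<plusminus>\<alpha>)\<close> of the bispherical coordinates adapted to the two spheres.\<close>

definition pole_dist :: "real \<Rightarrow> real \<Rightarrow> real \<Rightarrow> real" where
  "pole_dist r1 r2 \<epsilon> = sqrt (((r2\<^sup>2 - r1\<^sup>2 - (r1 + r2 + \<epsilon>)\<^sup>2) / (2 * (r1 + r2 + \<epsilon>)))\<^sup>2 - r1\<^sup>2)"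

text \<open>The origin has the same power \<open>\<alpha>\<^sup>2\<close> with respect to both
  spheres; the centres are chosen for that. With \<open>\<alpha> = r sinh s\<close>, the identity
  \<open>(cosh s)\<^sup>2 = (sinh s)\<^sup>2 + 1\<close> makes the distance of a centre from the
  origin \<open>r cosh s\<close>, that is \<open>\<alpha> coth s\<close>.\<close>

lemma two_sphere_geometry:
  assumes r: "r1 > 0" "r2 > 0" "\<epsilon> > 0"
  defines "\<alpha> \<equiv> pole_dist r1 r2 \<epsilon>"
  shows "\<alpha> > 0"
    "\<alpha>\<^sup>2 = \<epsilon> * (2 * r1 + \<epsilon>) * (2 * r2 + \<epsilon>) * (2 * r1 + 2 * r2 + \<epsilon>) / (4 * (r1 + r2 + \<epsilon>)\<^sup>2)"
    "center1 r1 r2 \<epsilon> = coth_point \<alpha> (- arsinh (\<alpha> / r1))"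
    "center2 r1 r2 \<epsilon> = coth_point \<alpha> (arsinh (\<alpha> / r2))"
    "dist (center1 r1 r2 \<epsilon>) (center2 r1 r2 \<epsilon>) = r1 + r2 + \<epsilon>"
proof -
  define d where "d = r1 + r2 + \<epsilon>"
  define z where "z = (r2\<^sup>2 - r1\<^sup>2 - d\<^sup>2) / (2 * d)"
  have d: "d > 0" using r by (simp add: d_def)
  have zd: "2 * d * z = r2\<^sup>2 - r1\<^sup>2 - d\<^sup>2" using d by (simp add: z_def)
  have sq: "z\<^sup>2 - r1\<^sup>2 = \<epsilon> * (2 * r1 + \<epsilon>) * (2 * r2 + \<epsilon>) * (2 * r1 + 2 * r2 + \<epsilon>) / (4 * d\<^sup>2)"
  proof -
    \<comment> \<open>Heron's factorisation for lengths \<open>d\<close>, \<open>r1\<close>,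
      \<open>r2\<close>; the small factor \<open>d - r1 - r2\<close> is \<epsilon>.\<close>
    have "(2 * d * z)\<^sup>2 - (2 * d * r1)\<^sup>2 = \<epsilon> * (2 * r1 + \<epsilon>) * (2 * r2 + \<epsilon>) * (2 * r1 + 2 * r2 + \<epsilon>)"
      unfolding zd unfolding d_def by (simp add: power2_eq_square algebra_simps)
    then have "4 * d\<^sup>2 * (z\<^sup>2 - r1\<^sup>2) = \<epsilon> * (2 * r1 + \<epsilon>) * (2 * r2 + \<epsilon>) * (2 * r1 + 2 * r2 + \<epsilon>)"
      by (simp add: power_mult_distrib algebra_simps)
    then show ?thesis using d by (simp add: field_simps)
  qed
  moreover have "\<dots> > 0" using r d by (intro divide_pos_pos mult_pos_pos) auto
  ultimately have pos: "z\<^sup>2 - r1\<^sup>2 > 0" by simp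
  have \<alpha>: "\<alpha> = sqrt (z\<^sup>2 - r1\<^sup>2)" by (simp add: \<alpha>_def pole_dist_def z_def d_def)
  then show a0: "\<alpha> > 0" using pos by simp
  have a2: "\<alpha>\<^sup>2 = z\<^sup>2 - r1\<^sup>2" using \<alpha> pos by simp
  then show "\<alpha>\<^sup>2 = \<epsilon> * (2 * r1 + \<epsilon>) * (2 * r2 + \<epsilon>) * (2 * r1 + 2 * r2 + \<epsilon>) / (4 * (r1 + r2 + \<epsilon>)\<^sup>2)"
    using sq by (simp add: d_def)
  have a2': "\<alpha>\<^sup>2 = (z + d)\<^sup>2 - r2\<^sup>2"
    using zd a2 by (simp add: power2_eq_square algebra_simps)
  have zneg: "z < 0"
  proof -
    have "2 * d * z = - (2 * r1 * r1 + 2 * r1 * r2 + \<epsilon> * \<epsilon> + 2 * r1 * \<epsilon> + 2 * r2 * \<epsilon>)"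
      unfolding zd unfolding d_def by (simp add: power2_eq_square algebra_simps)
    moreover have "0 < 2 * r1 * r1 + 2 * r1 * r2 + \<epsilon> * \<epsilon> + 2 * r1 * \<epsilon> + 2 * r2 * \<epsilon>"
      using r by (intro add_pos_pos mult_pos_pos) auto
    ultimately have "2 * d * z < 0" by linarith
    then show ?thesis using d by (simp add: mult_less_0_iff)
  qed
  have zpos: "z + d > 0"
  proof -
    have "2 * d * (z + d) = 2 * r2 * r2 + 2 * r1 * r2 + \<epsilon> * \<epsilon> + 2 * r1 * \<epsilon> + 2 * r2 * \<epsilon>"
      unfolding distrib_left zd by (simp add: d_def power2_eq_square algebra_simps)
    also have "\<dots> > 0" using r by (intro add_pos_pos mult_pos_pos) auto
    finally show ?thesis using d by (simp add: zero_less_mult_iff)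
  qed
  have cosh: "r * cosh (arsinh (\<alpha> / r)) = y" if "r > 0" "\<alpha>\<^sup>2 = y\<^sup>2 - r\<^sup>2" "y > 0" for r y
  proof -
    define t where "t = arsinh (\<alpha> / r)"
    have "r * sinh t = \<alpha>" using that by (simp add: t_def)
    then have "r\<^sup>2 * (sinh t)\<^sup>2 = \<alpha>\<^sup>2" by (metis power_mult_distrib)
    moreover have "(r * cosh t)\<^sup>2 = r\<^sup>2 * (sinh t)\<^sup>2 + r\<^sup>2"
      unfolding power_mult_distrib cosh_square_eq distrib_left by simp
    ultimately have "(r * cosh t)\<^sup>2 = y\<^sup>2" using that(2) by linarith
    then have "(r * cosh (arsinh (\<alpha> / r)))\<^sup>2 = y\<^sup>2" unfolding t_def .
    moreover have "r * cosh (arsinh (\<alpha> / r)) \<ge> 0" using that(1) by simp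
    ultimately show ?thesis using that(3) power2_eq_imp_eq[of _ y] by (meson less_imp_le)
  qed
  have c1: "r1 * cosh (arsinh (\<alpha> / r1)) = - z" by (rule cosh) (use r a2 zneg in auto)
  have c2: "r2 * cosh (arsinh (\<alpha> / r2)) = z + d" by (rule cosh) (use r a2' zpos in auto)
  have e1: "center1 r1 r2 \<epsilon> = vector [0, 0, z]" and e2: "center2 r1 r2 \<epsilon> = vector [0, 0, z + d]"
    by (simp_all add: center1_def center2_def z_def d_def add.assoc)
  show "center1 r1 r2 \<epsilon> = coth_point \<alpha> (- arsinh (\<alpha> / r1))"
    using a0 r c1 unfolding e1 coth_point_def by (simp add: vector_3_eq_iff mult.commute)
  show "center2 r1 r2 \<epsilon> = coth_point \<alpha> (arsinh (\<alpha> / r2))"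
    using a0 r c2 unfolding e2 coth_point_def by (simp add: vector_3_eq_iff mult.commute)
  show "dist (center1 r1 r2 \<epsilon>) (center2 r1 r2 \<epsilon>) = r1 + r2 + \<epsilon>"
    unfolding e1 e2 dist_axis using d by (simp add: d_def)
qed

section \<open>Rays and the closure of the exterior domain\<close>

lemma sphere_ray:
  fixes c x :: "real ^ 3"
  assumes "dist c x = r" "r > 0" "t \<ge> 0"
  shows "dist c (x + t *\<^sub>R ((x - c) /\<^sub>R r)) = r + t" "dist x (x + t *\<^sub>R ((x - c) /\<^sub>R r)) = t"
proof -
  have n: "norm (x - c) = r" using assms by (simp add: dist_norm norm_minus_commute)
  have "x + t *\<^sub>R ((x - c) /\<^sub>R r) - c = (1 + t / r) *\<^sub>R (x - c)" by (simp add: algebra_simps divide_inverse)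
  then have "norm (x + t *\<^sub>R ((x - c) /\<^sub>R r) - c) = \<bar>1 + t / r\<bar> * norm (x - c)" by simp
  also have "\<dots> = r + t" using assms n by (simp add: field_simps)
  finally show "dist c (x + t *\<^sub>R ((x - c) /\<^sub>R r)) = r + t" by (simp add: dist_norm norm_minus_commute)
  show "dist x (x + t *\<^sub>R ((x - c) /\<^sub>R r)) = t" using assms n by (simp add: dist_norm)
qed

lemma sphere_ray_exterior:
  fixes c c1 c2 x :: "real ^ 3"
  assumes c: "c = c1 \<and> c' = c2 \<and> r = r1 \<and> r' = r2 \<or> c = c2 \<and> c' = c1 \<and> r = r2 \<and> r' = r1"
    and d: "r1 + r2 < dist c1 c2" and r: "0 < r1" "0 < r2"
    and x: "dist c x = r" and t: "0 < t" "t < dist c1 c2 - r1 - r2"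
  shows "x + t *\<^sub>R ((x - c) /\<^sub>R r) \<in> - (cball c1 r1 \<union> cball c2 r2)"
proof -
  let ?y = "x + t *\<^sub>R ((x - c) /\<^sub>R r)"
  have y: "dist c ?y = r + t" "dist x ?y = t" using sphere_ray[OF x, of t] c r t by auto
  have "dist c c' \<le> dist c ?y + dist c' ?y" using dist_triangle[of c c' ?y] by (simp add: dist_commute)
  then have "dist c' ?y > r'" using y t c by (auto simp: dist_commute)
  then show ?thesis using y t c by auto
qed

text \<open>\<open>C1_up_to_boundary\<close> is stated on the topological closure. A point of a
  sphere is a limit along its outward ray, which stays in the exterior as long as it is shorter than
  the gap.\<close>

lemma closure_exterior:
  fixes c1 c2 :: "real ^ 3"
  assumes d: "r1 + r2 < dist c1 c2" and r: "0 < r1" "0 < r2"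
  shows "- (ball c1 r1 \<union> ball c2 r2) \<subseteq> closure (- (cball c1 r1 \<union> cball c2 r2))"
proof
  fix x assume x: "x \<in> - (ball c1 r1 \<union> ball c2 r2)"
  show "x \<in> closure (- (cball c1 r1 \<union> cball c2 r2))"
    unfolding closure_approachable
  proof (intro allI impI)
    fix e :: real assume e: "e > 0"
    define t where "t = min e (dist c1 c2 - r1 - r2) / 2"
    have t: "0 < t" "t < dist c1 c2 - r1 - r2" "t < e" using e d by (auto simp: t_def min_def)
    show "\<exists>y\<in>- (cball c1 r1 \<union> cball c2 r2). dist y x < e"
    proof (cases "x \<in> - (cball c1 r1 \<union> cball c2 r2)")
      case True then show ?thesis using e by (intro bexI[of _ x]) auto
    next
      case False
      then consider "dist c1 x = r1" | "dist c2 x = r2" using x by force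
      then show ?thesis
      proof cases
        case 1
        show ?thesis using sphere_ray_exterior[OF _ d r 1 t(1,2), of c2 r2] sphere_ray(2)[OF 1 r(1), of t] t
          by (intro bexI[of _ "x + t *\<^sub>R ((x - c1) /\<^sub>R r1)"]) (auto simp: dist_commute)
      next
        case 2
        show ?thesis using sphere_ray_exterior[OF _ d r 2 t(1,2), of c1 r1] sphere_ray(2)[OF 2 r(2), of t] t
          by (intro bexI[of _ "x + t *\<^sub>R ((x - c2) /\<^sub>R r2)"]) (auto simp: dist_commute)
      qed
    qed
  qed
qed

section \<open>Flux series and the linear system for the boundary values\<close>

lemma sinh_ge_self: "x \<ge> 0 \<Longrightarrow> x \<le> sinh (x::real)"
proof -
  assume x: "x \<ge> 0"
  have "sinh 0 - 0 \<le> sinh x - x"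
    by (rule DERIV_nonneg_imp_nondecreasing[OF x]) (auto intro!: derivative_eq_intros exI simp: cosh_real_ge_1)
  then show ?thesis by simp
qed

lemma value_on_eq:
  assumes "f constant_on S" "x \<in> S"
  shows "f x = value_on S f"
proof -
  have "value_on S f = f x"
    unfolding value_on_def by (rule the_equality) (use assms in \<open>auto simp: constant_on_def\<close>)
  then show ?thesis by simp
qed

lemma bigo_at_infinity_tendsto_0:
  fixes w :: "real ^ 3 \<Rightarrow> real"
  assumes "w \<in> O[at_infinity](\<lambda>x. 1 / (norm x)\<^sup>2)"
  shows "(w \<longlongrightarrow> 0) at_infinity"
proof -
  obtain k where k: "k > 0" "\<forall>\<^sub>F x in at_infinity. norm (w x) \<le> k * norm (1 / (norm x)\<^sup>2)"
    using landau_o.bigE[OF assms] by auto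
  have "filterlim (\<lambda>x::real ^ 3. (norm x)\<^sup>2) at_top at_infinity"
    by (rule filterlim_compose[OF _ filterlim_norm_at_top]) real_asymp
  then have "((\<lambda>x::real ^ 3. 1 / (norm x)\<^sup>2) \<longlongrightarrow> 0) at_infinity"
    by (intro tendsto_divide_0[OF tendsto_const] filterlim_at_top_imp_at_infinity)
  from tendsto_mult[OF tendsto_const[of k] tendsto_norm[OF this]]
  have "((\<lambda>x::real ^ 3. k * norm (1 / (norm x)\<^sup>2)) \<longlongrightarrow> k * norm (0::real)) at_infinity" .
  then show ?thesis using k(2) by (intro Lim_null_comparison[OF k(2)]) simp
qed

text \<open>Write \<open>S = s1 + s2\<close>. For ball 1 the charges start at its centre, with
  parameter \<open>- s1\<close>; this is the image of infinity, so the first potential is 1 on the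
  sphere. Reflection in sphere 2 sends \<open>- (s1 + m S)\<close> to \<open>(m + 1) S\<close>, and
  reflection in sphere 1 sends that to \<open>- (s1 + (m + 1) S)\<close>. The second series
  exchanges the roles of the balls.\<close>

lemma boundary_flux_sums:
  fixes r1 r2 \<epsilon> :: real and u :: "real ^ 3 \<Rightarrow> real"
  assumes r: "r1 > 0" "r2 > 0" "\<epsilon> > 0"
    and u: "harmonic_on (exterior_domain r1 r2 \<epsilon>) u" "C1_up_to_boundary (exterior_domain r1 r2 \<epsilon>) u"
      "u constant_on sphere (center1 r1 r2 \<epsilon>) r1" "u constant_on sphere (center2 r1 r2 \<epsilon>) r2"
    and V: "harmonic_field UNIV H V dV"
    and lim: "(\<lambda>x. u x - H x) \<in> O[at_infinity](\<lambda>x. 1 / (norm x)\<^sup>2)"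
  defines "\<alpha> \<equiv> pole_dist r1 r2 \<epsilon>"
  defines "s1 \<equiv> arsinh (\<alpha> / r1)" and "s2 \<equiv> arsinh (\<alpha> / r2)"
  defines "U1 \<equiv> value_on (sphere (center1 r1 r2 \<epsilon>) r1) u" and "U2 \<equiv> value_on (sphere (center2 r1 r2 \<epsilon>) r2) u"
  shows "(\<lambda>m. 4 * pi * (\<alpha> / sinh (s1 + m * (s1 + s2)) * (H (coth_point \<alpha> (- (s1 + m * (s1 + s2)))) - U1) -
      \<alpha> / sinh ((m + 1) * (s1 + s2)) * (H (coth_point \<alpha> ((m + 1) * (s1 + s2))) - U2)))
      sums sphere_integral (center1 r1 r2 \<epsilon>) r1 (normal_deriv (center1 r1 r2 \<epsilon>) r1 u)" (is ?first)
    "(\<lambda>m. 4 * pi * (\<alpha> / sinh (s2 + m * (s1 + s2)) * (H (coth_point \<alpha> (s2 + m * (s1 + s2))) - U2) -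
      \<alpha> / sinh ((m + 1) * (s1 + s2)) * (H (coth_point \<alpha> (- ((m + 1) * (s1 + s2)))) - U1)))
      sums sphere_integral (center2 r1 r2 \<epsilon>) r2 (normal_deriv (center2 r1 r2 \<epsilon>) r2 u)" (is ?second)
proof -
  define c1 c2 where "c1 = center1 r1 r2 \<epsilon>" and "c2 = center2 r1 r2 \<epsilon>"
  note geo = two_sphere_geometry[OF r, folded \<alpha>_def, folded s1_def s2_def c1_def c2_def]
  have s: "s1 > 0" "s2 > 0" using geo(1) r by (auto simp: s1_def s2_def)
  have sinh: "\<alpha> / sinh s1 = r1" "\<alpha> / sinh s2 = r2" using geo(1) r by (auto simp: s1_def s2_def)
  define S where "S = s1 + s2"
  have S: "S > 0" using s by (simp add: S_def)
  have d: "r1 + r2 < dist c1 c2" using geo(5) r by simp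
  have ext: "exterior_domain r1 r2 \<epsilon> = - (cball c1 r1 \<union> cball c2 r2)"
    using r unfolding exterior_domain_def closure_Un by (simp add: c1_def c2_def Compl_eq_Diff_UNIV)
  obtain G where uc: "continuous_on (closure (- (cball c1 r1 \<union> cball c2 r2))) u"
    and Gc: "continuous_on (closure (- (cball c1 r1 \<union> cball c2 r2))) G"
    and G: "\<And>x. x \<in> - (cball c1 r1 \<union> cball c2 r2) \<Longrightarrow> GDERIV u x :> G x"
    using u(2) unfolding C1_up_to_boundary_def ext by blast
  note cl = closure_exterior[OF d r(1,2)]
  note cont = continuous_on_subset[OF uc cl] continuous_on_subset[OF Gc cl]
  have U: "u x = U1" if "x \<in> sphere c1 r1" for x using value_on_eq[OF u(3)] that by (simp add: U1_def c1_def)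
  have U': "u x = U2" if "x \<in> sphere c2 r2" for x using value_on_eq[OF u(4)] that by (simp add: U2_def c2_def)
  note ident = green_charge_identity[OF r(1,2) d _ u(1)[unfolded ext] cont G V bigo_at_infinity_tendsto_0[OF lim] U U']
  have disj: "p \<notin> ball c1 r1" if "p \<in> ball c2 r2" for p
    using that d dist_triangle[of c1 c2 p] by (auto simp: dist_commute)
  have sub: "sphere c1 r1 \<subseteq> - (ball c1 r1 \<union> ball c2 r2)" "sphere c2 r2 \<subseteq> - (ball c1 r1 \<union> ball c2 r2)"
  proof -
    have "x \<in> - (ball c1 r1 \<union> ball c2 r2)" if "dist c1 x = r1 \<or> dist c2 x = r2" for x
      using d that dist_triangle[of c1 c2 x] by (auto simp: dist_commute)
    then show "sphere c1 r1 \<subseteq> - (ball c1 r1 \<union> ball c2 r2)" "sphere c2 r2 \<subseteq> - (ball c1 r1 \<union> ball c2 r2)"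
      by auto
  qed
  define q1 q2 where "q1 x = G x \<bullet> (x - c1) / r1" and "q2 x = G x \<bullet> (x - c2) / r2" for x
  have q: "continuous_on (sphere c1 r1) q1" "continuous_on (sphere c2 r2) q2"
    unfolding q1_def q2_def
    by (intro continuous_intros continuous_on_subset[OF cont(2) sub(1)]; use r in simp)
      (intro continuous_intros continuous_on_subset[OF cont(2) sub(2)]; use r in simp)
  have nd1: "sphere_integral c1 r1 q1 = sphere_integral c1 r1 (normal_deriv c1 r1 u)"
  proof (rule sphere_integral_cong)
    fix x assume x: "dist c1 x = r1"
    show "q1 x = normal_deriv c1 r1 u x" unfolding q1_def
      by (rule normal_deriv_eq[OF r(1) x G cont _ _ _ sphere_ray_exterior[where c = c1 and c' = c2 and r = r1 and r' = r2, OF _ d r(1,2) x], symmetric])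
        (use sub x d in auto)
  qed (use r in simp)
  have nd2: "sphere_integral c2 r2 q2 = sphere_integral c2 r2 (normal_deriv c2 r2 u)"
  proof (rule sphere_integral_cong)
    fix x assume x: "dist c2 x = r2"
    show "q2 x = normal_deriv c2 r2 u x" unfolding q2_def
      by (rule normal_deriv_eq[OF r(2) x G cont _ _ _ sphere_ray_exterior[where c = c2 and c' = c1 and r = r2 and r' = r1, OF _ d r(1,2) x], symmetric])
        (use sub x d in auto)
  qed (use r in simp)
  have refl1: "image_dist \<alpha> a x = image_dist \<alpha> (- s1 - a) x" if "x \<in> sphere c1 r1" for a x
    by (rule image_dist_reflect) (use that geo s sinh r in auto)
  have refl2: "image_dist \<alpha> a x = image_dist \<alpha> (s2 - a) x" if "x \<in> sphere c2 r2" for a x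
    by (rule image_dist_reflect) (use that geo s sinh r in auto)
  have in1: "coth_point \<alpha> (- b) \<in> ball c1 r1" if "b \<ge> s1" for b
    using coth_point_in_ball(2)[OF geo(1) s(1) that] by (simp add: sinh geo(3))
  have in2: "coth_point \<alpha> b \<in> ball c2 r2" if "b \<ge> s2" for b
    using coth_point_in_ball(1)[OF geo(1) s(2) that] by (simp add: sinh geo(4))
  have mS: "real m * S \<ge> 0" for m using S by simp
  have pos: "s1 + real m * S > 0" "s2 + real m * S > 0" "(real m + 1) * S > 0" for m
    using s S mS[of m] by (auto intro: add_pos_nonneg mult_pos_pos)
  have sinh_abs: "\<bar>sinh x\<bar> = sinh x" "\<bar>sinh (- x)\<bar> = sinh x" if "x > 0" for x :: real
    using that by auto
  have atop: "filterlim (\<lambda>m. \<bar>sinh ((real m + 1) * S)\<bar>) at_top sequentially"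
  proof (rule filterlim_at_top_mono)
    show "filterlim (\<lambda>m. (real m + 1) * S) at_top sequentially" using S by real_asymp
    show "\<forall>\<^sub>F m in sequentially. (real m + 1) * S \<le> \<bar>sinh ((real m + 1) * S)\<bar>"
      using S by (intro always_eventually allI order_trans[OF sinh_ge_self abs_ge_self]) simp
  qed
  have "(\<lambda>m. 4 * pi * (\<alpha> / \<bar>sinh (- (s1 + m * S))\<bar> * (H (coth_point \<alpha> (- (s1 + m * S))) - U1) -
      \<alpha> / \<bar>sinh ((m + 1) * S)\<bar> * (H (coth_point \<alpha> ((m + 1) * S)) - U2))) sums sphere_integral c1 r1 q1"
  proof (rule image_charges_sums[OF geo(1) r(1,2) d, where qB = q2])
    show "- (s1 + real m * S) \<noteq> 0" "(real m + 1) * S \<noteq> 0" for m using pos[of m] by linarith+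
    show "coth_point \<alpha> (- (s1 + real m * S)) \<in> ball c1 r1" for m by (rule in1) (use mS in simp)
    show "coth_point \<alpha> ((real m + 1) * S) \<in> ball c2 r2" for m
      using in2[of "(real m + 1) * S"] mS[of m] s by (simp add: S_def algebra_simps)
    show "image_dist \<alpha> (- (s1 + real 0 * S)) x = \<alpha>" if "x \<in> sphere c1 r1" for x
      using refl1[OF that, of "- s1"] image_dist_0[of \<alpha> x] geo(1) by simp
    show "image_dist \<alpha> (- (s1 + real (Suc m) * S)) x = image_dist \<alpha> ((real m + 1) * S) x" if "x \<in> sphere c1 r1" for m x
      using refl1[OF that, of "- (s1 + real (Suc m) * S)"] by (simp add: add.commute)
    show "image_dist \<alpha> (- (s1 + real m * S)) x = image_dist \<alpha> ((real m + 1) * S) x" if "x \<in> sphere c2 r2" for m x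
      using refl2[OF that, of "- (s1 + real m * S)"] by (simp add: S_def algebra_simps)
    show "sphere_integral c1 r1 (\<lambda>x. newton p x * q1 x) + sphere_integral c2 r2 (\<lambda>x. newton p x * q2 x) = 4 * pi * (H p - U1)"
      if "p \<in> ball c1 r1" for p using ident[of p] that by (simp add: q1_def q2_def)
    show "sphere_integral c1 r1 (\<lambda>x. newton p x * q1 x) + sphere_integral c2 r2 (\<lambda>x. newton p x * q2 x) = 4 * pi * (H p - U2)"
      if "p \<in> ball c2 r2" for p using ident[of p] that disj[OF that] by (simp add: q1_def q2_def)
  qed (use atop q in auto)
  then show ?first by (simp only: sinh_abs pos nd1 c1_def[symmetric] S_def[symmetric])
  have "(\<lambda>m. 4 * pi * (\<alpha> / \<bar>sinh (s2 + m * S)\<bar> * (H (coth_point \<alpha> (s2 + m * S)) - U2) -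
      \<alpha> / \<bar>sinh (- ((m + 1) * S))\<bar> * (H (coth_point \<alpha> (- ((m + 1) * S))) - U1))) sums sphere_integral c2 r2 q2"
  proof (rule image_charges_sums[OF geo(1) r(2,1), where qB = q1 and cB = c1])
    show "r2 + r1 < dist c2 c1" using d by (simp add: dist_commute add.commute)
    show "s2 + real m * S \<noteq> 0" "- ((real m + 1) * S) \<noteq> 0" for m using pos[of m] by linarith+
    show "coth_point \<alpha> (s2 + real m * S) \<in> ball c2 r2" for m using in2 mS[of m] by simp
    show "coth_point \<alpha> (- ((real m + 1) * S)) \<in> ball c1 r1" for m
      by (rule in1) (use mS[of m] s in \<open>simp add: S_def algebra_simps\<close>)
    show "image_dist \<alpha> (s2 + real 0 * S) x = \<alpha>" if "x \<in> sphere c2 r2" for x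
      using refl2[OF that, of "s2"] image_dist_0[of \<alpha> x] geo(1) by simp
    show "image_dist \<alpha> (s2 + real (Suc m) * S) x = image_dist \<alpha> (- ((real m + 1) * S)) x" if "x \<in> sphere c2 r2" for m x
      using refl2[OF that, of "s2 + real (Suc m) * S"] by (simp add: add.commute)
    show "image_dist \<alpha> (s2 + real m * S) x = image_dist \<alpha> (- ((real m + 1) * S)) x" if "x \<in> sphere c1 r1" for m x
      using refl1[OF that, of "s2 + real m * S"] by (simp add: S_def algebra_simps)
    show "sphere_integral c2 r2 (\<lambda>x. newton p x * q2 x) + sphere_integral c1 r1 (\<lambda>x. newton p x * q1 x) = 4 * pi * (H p - U1)"
      if "p \<in> ball c1 r1" for p using ident[of p] that by (simp add: q1_def q2_def)
    show "sphere_integral c2 r2 (\<lambda>x. newton p x * q2 x) + sphere_integral c1 r1 (\<lambda>x. newton p x * q1 x) = 4 * pi * (H p - U2)"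
      if "p \<in> ball c2 r2" for p using ident[of p] that disj[OF that] by (simp add: q1_def q2_def)
    show "filterlim (\<lambda>m. \<bar>sinh (- ((real m + 1) * S))\<bar>) at_top sequentially" using atop by simp
  qed (use q in auto)
  then show ?second by (simp only: sinh_abs pos nd2 c2_def[symmetric] S_def[symmetric])
qed

text \<open>The addition theorem and \<open>sinh t < cosh t\<close> give
  \<open>sinh (t + x) \<ge> sinh t * exp x\<close> for \<open>x \<ge> 0\<close>, hence a geometric
  majorant.\<close>

lemma summable_inverse_sinh:
  assumes "t > 0" "S > 0"
  shows "summable (\<lambda>m. 1 / sinh (t + real m * S))"
proof (rule summable_comparison_test')
  show "summable (\<lambda>m. 1 / sinh t * exp (- S) ^ m)"
    using assms by (intro summable_mult summable_geometric) auto
  fix m :: nat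
  have e: "exp (real m * S) = cosh (real m * S) + sinh (real m * S)" by (simp add: cosh_plus_sinh)
  have "sinh t * exp (real m * S) \<le> sinh (t + real m * S)"
    unfolding sinh_add e distrib_left using assms
    by (intro add_left_mono mult_right_mono) (auto intro: less_imp_le sinh_less_cosh_real)
  moreover have "sinh t > 0" using assms by simp
  moreover have "sinh (t + real m * S) > 0" using assms by (simp add: add_pos_nonneg)
  ultimately have "1 / sinh (t + real m * S) \<le> 1 / (sinh t * exp (real m * S))"
    by (intro divide_left_mono mult_pos_pos) auto
  also have "\<dots> = 1 / sinh t * exp (- S) ^ m"
    by (simp add: exp_minus exp_of_nat_mult power_inverse divide_inverse)
  finally show "norm (1 / sinh (t + real m * S)) \<le> 1 / sinh t * exp (- S) ^ m"
    using \<open>sinh (t + real m * S) > 0\<close> by simp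
qed

text \<open>With the total charges \<open>K1\<close>, \<open>K2\<close>, \<open>L\<close> the flux
  conditions form a symmetric system for the two boundary values. Combining its equations with the
  weights \<open>b\<close> and \<open>a\<close> isolates the difference of the boundary values times
  the determinant \<open>D\<close>, for \<open>u\<close> and \<open>h\<close> alike, so
  \<open>D\<close> drops out of the quotient.\<close>

lemma concentration_factor_eq:
  fixes r1 r2 \<epsilon> \<alpha> s1 s2 a b T1 T2 :: real and ka kb kc :: "nat \<Rightarrow> real" and H u h :: "real ^ 3 \<Rightarrow> real"
  assumes r: "r1 > 0" "r2 > 0" "\<epsilon> > 0" and H: "harmonic_on UNIV H"
    and u: "is_u r1 r2 H \<epsilon> u" and h: "is_h r1 r2 \<epsilon> h"
  defines "\<alpha> \<equiv> pole_dist r1 r2 \<epsilon>"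
  defines "s1 \<equiv> arsinh (\<alpha> / r1)" and "s2 \<equiv> arsinh (\<alpha> / r2)"
  defines "ka \<equiv> \<lambda>m. \<alpha> / sinh (s1 + m * (s1 + s2))" and "kb \<equiv> \<lambda>m. \<alpha> / sinh (s2 + m * (s1 + s2))"
    and "kc \<equiv> \<lambda>m. \<alpha> / sinh ((real m + 1) * (s1 + s2))"
  defines "a \<equiv> \<Sum>m. ka m - kc m" and "b \<equiv> \<Sum>m. kb m - kc m"
    and "T1 \<equiv> \<Sum>m. ka m * (H (coth_point \<alpha> (- (s1 + m * (s1 + s2)))) - H 0) -
           kc m * (H (coth_point \<alpha> ((real m + 1) * (s1 + s2))) - H 0)"
    and "T2 \<equiv> \<Sum>m. kb m * (H (coth_point \<alpha> (s2 + m * (s1 + s2))) - H 0) -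
           kc m * (H (coth_point \<alpha> (- ((real m + 1) * (s1 + s2)))) - H 0)"
  assumes ab: "a + b \<noteq> 0"
  shows "concentration_factor r1 r2 \<epsilon> u h = 4 * pi * (a * T2 - b * T1) / (a + b)"
proof -
  define c1 c2 where "c1 = center1 r1 r2 \<epsilon>" and "c2 = center2 r1 r2 \<epsilon>"
  define U1 U2 h1 h2 where "U1 = value_on (sphere c1 r1) u" and "U2 = value_on (sphere c2 r2) u"
    and "h1 = value_on (sphere c1 r1) h" and "h2 = value_on (sphere c2 r2) h"
  have \<alpha>: "\<alpha> > 0" using two_sphere_geometry(1)[OF r] by (simp add: \<alpha>_def)
  have s: "s1 > 0" "s2 > 0" using \<alpha> r by (auto simp: s1_def s2_def)
  have sm: "summable (\<lambda>m. \<alpha> / sinh (t + real m * (s1 + s2)))" if "t > 0" for t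
    using summable_mult[OF summable_inverse_sinh[OF that, of "s1 + s2"], of \<alpha>] s by simp
  define K1 K2 L where "K1 = suminf ka" and "K2 = suminf kb" and "L = suminf kc"
  have "summable ka" "summable kb" unfolding ka_def kb_def by (intro sm s)+
  moreover have "summable kc" unfolding kc_def using sm[of "s1 + s2"] s by (simp add: distrib_right add.commute)
  ultimately have K: "ka sums K1" "kb sums K2" "kc sums L"
    by (auto simp: K1_def K2_def L_def summable_sums)
  have aK: "a = K1 - L" "b = K2 - L"
    unfolding a_def b_def by (auto intro!: sums_unique[symmetric] sums_diff K)
  obtain V dV where V: "harmonic_field UNIV H V dV" by (rule harmonic_on_imp_field[OF H])
  have alg: "4 * pi * (A * (x - w1) - C * (y - w2)) / (4 * pi) + A * (w1 - g0) - C * (w2 - g0) =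
      A * (x - g0) - C * (y - g0)" for A C x y w1 w2 g0 :: real
  proof -
    have "4 * pi * (A * (x - w1) - C * (y - w2)) / (4 * pi) = A * (x - w1) - C * (y - w2)" by simp
    then show ?thesis by (simp add: algebra_simps)
  qed
  \<comment> \<open>Convergence of the charge sums lets a constant \<open>g0\<close> move from
    \<open>g\<close> into the boundary values: \<open>H 0\<close> in the case of \<open>u\<close>,
    and 0 in the case of \<open>h\<close>, where \<open>g\<close> is 0 too.\<close>
  have system: "(\<lambda>m. ka m * (g (coth_point \<alpha> (- (s1 + m * (s1 + s2)))) - g0) - kc m * (g (coth_point \<alpha> ((real m + 1) * (s1 + s2))) - g0))
        sums (f1 / (4 * pi) + K1 * (w1 - g0) - L * (w2 - g0)) \<and>
      (\<lambda>m. kb m * (g (coth_point \<alpha> (s2 + m * (s1 + s2))) - g0) - kc m * (g (coth_point \<alpha> (- ((real m + 1) * (s1 + s2)))) - g0))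
        sums (f2 / (4 * pi) + K2 * (w2 - g0) - L * (w1 - g0))"
    if 1: "(\<lambda>m. 4 * pi * (\<alpha> / sinh (s1 + m * (s1 + s2)) * (g (coth_point \<alpha> (- (s1 + m * (s1 + s2)))) - w1) -
      \<alpha> / sinh ((real m + 1) * (s1 + s2)) * (g (coth_point \<alpha> ((real m + 1) * (s1 + s2))) - w2))) sums f1"
      and 2: "(\<lambda>m. 4 * pi * (\<alpha> / sinh (s2 + m * (s1 + s2)) * (g (coth_point \<alpha> (s2 + m * (s1 + s2))) - w2) -
      \<alpha> / sinh ((real m + 1) * (s1 + s2)) * (g (coth_point \<alpha> (- ((real m + 1) * (s1 + s2)))) - w1))) sums f2"
    for g :: "real ^ 3 \<Rightarrow> real" and g0 f1 f2 w1 w2 :: real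
  proof
    have "(\<lambda>m. (4 * pi * (\<alpha> / sinh (s1 + m * (s1 + s2)) * (g (coth_point \<alpha> (- (s1 + m * (s1 + s2)))) - w1) -
      \<alpha> / sinh ((real m + 1) * (s1 + s2)) * (g (coth_point \<alpha> ((real m + 1) * (s1 + s2))) - w2))) / (4 * pi)
       + ka m * (w1 - g0) - kc m * (w2 - g0)) sums (f1 / (4 * pi) + K1 * (w1 - g0) - L * (w2 - g0))"
      by (intro sums_diff sums_add sums_divide 1 sums_mult2 K)
    then show "(\<lambda>m. ka m * (g (coth_point \<alpha> (- (s1 + m * (s1 + s2)))) - g0) - kc m * (g (coth_point \<alpha> ((real m + 1) * (s1 + s2))) - g0))
        sums (f1 / (4 * pi) + K1 * (w1 - g0) - L * (w2 - g0))"
      unfolding ka_def kc_def alg .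
    have "(\<lambda>m. (4 * pi * (\<alpha> / sinh (s2 + m * (s1 + s2)) * (g (coth_point \<alpha> (s2 + m * (s1 + s2))) - w2) -
      \<alpha> / sinh ((real m + 1) * (s1 + s2)) * (g (coth_point \<alpha> (- ((real m + 1) * (s1 + s2)))) - w1))) / (4 * pi)
       + kb m * (w2 - g0) - kc m * (w1 - g0)) sums (f2 / (4 * pi) + K2 * (w2 - g0) - L * (w1 - g0))"
      by (intro sums_diff sums_add sums_divide 2 sums_mult2 K)
    then show "(\<lambda>m. kb m * (g (coth_point \<alpha> (s2 + m * (s1 + s2))) - g0) - kc m * (g (coth_point \<alpha> (- ((real m + 1) * (s1 + s2)))) - g0))
        sums (f2 / (4 * pi) + K2 * (w2 - g0) - L * (w1 - g0))"
      unfolding kb_def kc_def alg .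
  qed
  have hh: "harmonic_on (exterior_domain r1 r2 \<epsilon>) h" "C1_up_to_boundary (exterior_domain r1 r2 \<epsilon>) h"
    "h constant_on sphere (center1 r1 r2 \<epsilon>) r1" "h constant_on sphere (center2 r1 r2 \<epsilon>) r2"
    "(\<lambda>x. h x - 0) \<in> O[at_infinity](\<lambda>x. 1 / (norm x)\<^sup>2)" using h by (simp_all add: is_h_def)
  note flux_h = boundary_flux_sums[OF r hh(1-4) harmonic_field_const[of UNIV 0] hh(5),
      folded \<alpha>_def, folded s1_def s2_def c1_def c2_def, folded h1_def h2_def]
  have h1f: "sphere_integral c1 r1 (normal_deriv c1 r1 h) = 1" "sphere_integral c2 r2 (normal_deriv c2 r2 h) = - 1"
    using h by (simp_all add: is_h_def c1_def c2_def)
  have "(\<lambda>m. ka m * (0 - 0) - kc m * (0 - 0)) sums (1 / (4 * pi) + K1 * (h1 - 0) - L * (h2 - 0)) \<and>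
      (\<lambda>m. kb m * (0 - 0) - kc m * (0 - 0)) sums (- 1 / (4 * pi) + K2 * (h2 - 0) - L * (h1 - 0))"
    by (rule system[of "\<lambda>x. 0" h1 h2 1 "-1" 0, OF flux_h[unfolded h1f]])
  then have eq_h: "K1 * h1 - L * h2 = - 1 / (4 * pi)" "K2 * h2 - L * h1 = 1 / (4 * pi)"
    using sums_unique2[OF sums_zero] by fastforce+
  have uu: "harmonic_on (exterior_domain r1 r2 \<epsilon>) u" "C1_up_to_boundary (exterior_domain r1 r2 \<epsilon>) u"
    "u constant_on sphere (center1 r1 r2 \<epsilon>) r1" "u constant_on sphere (center2 r1 r2 \<epsilon>) r2"
    "(\<lambda>x. u x - H x) \<in> O[at_infinity](\<lambda>x. 1 / (norm x)\<^sup>2)" using u by (simp_all add: is_u_def)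
  note flux_u = boundary_flux_sums[OF r uu(1-4) V uu(5),
      folded \<alpha>_def, folded s1_def s2_def c1_def c2_def, folded U1_def U2_def]
  have u1f: "sphere_integral c1 r1 (normal_deriv c1 r1 u) = 0" "sphere_integral c2 r2 (normal_deriv c2 r2 u) = 0"
    using u by (simp_all add: is_u_def c1_def c2_def)
  have "(\<lambda>m. ka m * (H (coth_point \<alpha> (- (s1 + m * (s1 + s2)))) - H 0) - kc m * (H (coth_point \<alpha> ((real m + 1) * (s1 + s2))) - H 0))
        sums (0 / (4 * pi) + K1 * (U1 - H 0) - L * (U2 - H 0)) \<and>
      (\<lambda>m. kb m * (H (coth_point \<alpha> (s2 + m * (s1 + s2))) - H 0) - kc m * (H (coth_point \<alpha> (- ((real m + 1) * (s1 + s2)))) - H 0))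
        sums (0 / (4 * pi) + K2 * (U2 - H 0) - L * (U1 - H 0))"
    by (rule system[OF flux_u[unfolded u1f]])
  then have T: "T1 = K1 * (U1 - H 0) - L * (U2 - H 0)" "T2 = K2 * (U2 - H 0) - L * (U1 - H 0)"
    unfolding T1_def T2_def by (auto dest!: sums_unique)
  define D where "D = K1 * K2 - L * L"
  have 1: "a * T2 - b * T1 = - (U1 - U2) * D"
    unfolding T aK D_def by (simp add: algebra_simps)
  have 2: "(h1 - h2) * D * (4 * pi) = - (a + b)"
  proof -
    have "(h1 - h2) * D = (K2 - L) * (K1 * h1 - L * h2) - (K1 - L) * (K2 * h2 - L * h1)"
      unfolding D_def by (simp add: algebra_simps)
    also have "\<dots> = - (a + b) / (4 * pi)" unfolding eq_h aK by (simp add: field_simps)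
    finally show ?thesis by simp
  qed
  \<comment> \<open>Regularity of the system is obtained from the solution itself: \<open>h\<close>
    realises fluxes for which the combined right-hand side is not 0.\<close>
  then have D: "D \<noteq> 0" "h1 - h2 \<noteq> 0" using ab by auto
  have 3: "(U1 - U2) * D * (4 * pi) = - (4 * pi * (a * T2 - b * T1))"
    unfolding 1 by (simp add: algebra_simps)
  have "concentration_factor r1 r2 \<epsilon> u h = (U1 - U2) / (h1 - h2)"
    by (simp add: concentration_factor_def U1_def U2_def h1_def h2_def c1_def c2_def)
  also have "\<dots> = ((U1 - U2) * D * (4 * pi)) / ((h1 - h2) * D * (4 * pi))" using D by simp
  also have "\<dots> = - (4 * pi * (a * T2 - b * T1)) / - (a + b)"
    unfolding 2 3 ..
  finally show ?thesis by (simp only: minus_divide_divide)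
qed

section \<open>Taylor expansion on the axis\<close>

lemma fps_nth_funpow_deriv_0: "fps_nth ((fps_deriv ^^ n) F) 0 = fact n * fps_nth F n" for F :: "real fps"
proof (induction n arbitrary: F)
  case (Suc n)
  have "fps_nth ((fps_deriv ^^ Suc n) F) 0 = fps_nth ((fps_deriv ^^ n) (fps_deriv F)) 0" by (simp add: funpow_swap1)
  then show ?case by (simp add: Suc algebra_simps)
qed simp

lemma power_series_imp_taylor_coeff:
  fixes f :: "real \<Rightarrow> real"
  assumes "\<rho> > 0" "\<And>t. \<bar>t\<bar> < \<rho> \<Longrightarrow> (\<lambda>k. c k * t ^ k) sums f t"
  shows "(deriv ^^ n) f 0 / fact n = c n"
proof -
  have "f has_fps_expansion Abs_fps c"
  proof (rule has_fps_expansionI)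
    have "\<forall>\<^sub>F t in nhds 0. t \<in> ball (0::real) \<rho>" using assms(1) by (intro eventually_nhds_in_open) auto
    then show "\<forall>\<^sub>F t in nhds 0. (\<lambda>n. fps_nth (Abs_fps c) n * t ^ n) sums f t"
      by eventually_elim (use assms(2) in auto)
  qed
  then have "(deriv ^^ n) f has_fps_expansion (fps_deriv ^^ n) (Abs_fps c)"
    by (induction n) (auto intro: has_fps_expansion_deriv)
  then have "fps_nth ((fps_deriv ^^ n) (Abs_fps c)) 0 = (deriv ^^ n) f 0"
    by (rule has_fps_expansion_imp_0_eq_fps_nth_0[symmetric])
  then show ?thesis by (simp add: fps_nth_funpow_deriv_0 field_simps)
qed

text \<open>Green's representation formula on the sphere of radius \<open>R\<close> about \<open>0\<close>, evaluated on the axis, extends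
  holomorphically to \<open>\<bar>z\<bar> < R / 4\<close>, where the argument of the square root has positive real part.\<close>

lemma harmonic_axis_power_series:
  fixes H :: "real ^ 3 \<Rightarrow> real"
  assumes H: "harmonic_on UNIV H" and R: "R > 0"
  obtains c where "\<And>t. \<bar>t\<bar> < R / 4 \<Longrightarrow> (\<lambda>k. c k * t ^ k) sums H (t *\<^sub>R vector [0, 0, 1])"
proof -
  obtain V dV where V: "harmonic_field UNIV H V dV" by (rule harmonic_on_imp_field[OF H])
  note V' = harmonic_fieldD[OF V]
  define hh vv :: "real \<times> real \<Rightarrow> real" where "hh y = H (R *\<^sub>R direction (fst y) (snd y))"
    and "vv y = V (R *\<^sub>R direction (fst y) (snd y)) \<bullet> direction (fst y) (snd y)" for y
  define co :: "real \<times> real \<Rightarrow> real" where "co y = cos (fst y)" for y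
  \<comment> \<open>For real \<open>z\<close> this is the squared distance between a point of the
    sphere and \<open>(0, 0, z)\<close>; being a polynomial in \<open>z\<close>, it extends to
    complex arguments.\<close>
  define q s :: "complex \<Rightarrow> real \<times> real \<Rightarrow> complex" where "q z y = R\<^sup>2 - 2 * R * co y * z + z\<^sup>2" and "s z y = csqrt (q z y)" for z :: complex and y
  \<comment> \<open>\<open>f\<close> is minus the integrand of the Green flux for a charge on the
    axis, and \<open>fx\<close> is its derivative in \<open>z\<close>.\<close>
  define f fx :: "complex \<Rightarrow> real \<times> real \<Rightarrow> complex" where
    "f z y = (hh y * (R - co y * z) / s z y ^ 3 + vv y / s z y) * (R\<^sup>2 * sin (fst y))" and
    "fx z y = (hh y * (- co y / s z y ^ 3 - 3 * (R - co y * z) * (z - R * co y) / s z y ^ 5)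
      - vv y * (z - R * co y) / s z y ^ 3) * (R\<^sup>2 * sin (fst y))" for z :: complex and y
  define U where "U = ball (0::complex) (R / 4)"
  \<comment> \<open>For \<open>norm z < R / 4\<close> the linear term is at most
    \<open>R\<^sup>2 / 2\<close> and the quadratic one at most \<open>R\<^sup>2 / 16\<close>, so the
    real part stays positive.\<close>
  have q0: "q z y \<notin> \<real>\<^sub>\<le>\<^sub>0" if "z \<in> U" for z y
  proof -
    have z: "norm z < R / 4" using that by (simp add: U_def)
    have "\<bar>Re z\<bar> \<le> R / 4" using abs_Re_le_cmod[of z] z by linarith
    then have "\<bar>co y\<bar> * \<bar>Re z\<bar> \<le> 1 * (R / 4)" by (intro mult_mono) (auto simp: co_def)
    then have "R * (co y * Re z) \<le> R * (R / 4)" using R by (intro mult_left_mono) (auto simp: abs_mult[symmetric])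
    moreover have "norm (z\<^sup>2) \<le> (R / 4)\<^sup>2" unfolding norm_power using z by (intro power_mono) auto
    then have "Re (z\<^sup>2) \<ge> - ((R / 4)\<^sup>2)" using abs_Re_le_cmod[of "z\<^sup>2"] by linarith
    moreover have "Re (q z y) = R\<^sup>2 - 2 * (R * (co y * Re z)) + Re (z\<^sup>2)"
      by (simp add: q_def Re_power2 power2_eq_square)
    moreover have "R\<^sup>2 > 0" using R by simp
    ultimately have "Re (q z y) > 0" by (simp add: power2_eq_square)
    then show ?thesis by (auto simp: complex_nonpos_Reals_iff)
  qed
  have s0: "s z y \<noteq> 0" if "z \<in> U" for z y using q0[OF that, of y] by (auto simp: s_def)
  have dirc: "continuous_on S (\<lambda>y. direction (fst y) (snd y))" for S :: "(real \<times> real) set"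
    by (intro continuous_intros)
  have hc: "continuous_on S hh" "continuous_on S vv" for S
    unfolding hh_def[abs_def] vv_def[abs_def]
    by (intro continuous_intros continuous_on_compose2[OF V'(6)] continuous_on_compose2[OF V'(2)]; simp)+
  have sc: "continuous_on (U \<times> S) (\<lambda>x. s (fst x) (snd x))" for S
    unfolding s_def
  proof (rule continuous_on_compose2[OF holomorphic_on_imp_continuous_on[OF holomorphic_on_csqrt]])
    show "continuous_on (U \<times> S) (\<lambda>x. q (fst x) (snd x))" unfolding q_def co_def by (intro continuous_intros)
    show "(\<lambda>x. q (fst x) (snd x)) ` (U \<times> S) \<subseteq> - \<real>\<^sub>\<le>\<^sub>0" using q0 by auto
  qed
  have fc: "continuous_on (U \<times> S) (\<lambda>x. f (fst x) (snd x))" "continuous_on (U \<times> S) (\<lambda>x. fx (fst x) (snd x))" for S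
    unfolding f_def fx_def co_def
    by (intro continuous_intros sc continuous_on_compose2[OF hc(1)] continuous_on_compose2[OF hc(2)]; use s0 in auto)+
  have fcy: "continuous_on S (f z)" if "z \<in> U" for z S
  proof -
    have "continuous_on S (\<lambda>y. (z, y))" by (rule continuous_on_Pair[OF continuous_on_const continuous_on_id])
    from continuous_on_compose2[OF fc(1)[of S] this] that show ?thesis by auto
  qed
  define F where "F z = integral (cbox (0, 0) (pi, 2 * pi)) (f z)" for z
  have hol: "F holomorphic_on U"
    unfolding F_def
  proof (rule leibniz_rule_holomorphic)
    show "continuous_on (U \<times> cbox (0, 0) (pi, 2 * pi)) (\<lambda>(x, t). fx x t)"
      using fc(2) by (simp add: case_prod_unfold)
    show "convex U" by (simp add: U_def)
    show "f z integrable_on cbox (0, 0) (pi, 2 * pi)" if "z \<in> U" for z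
      by (intro integrable_continuous fcy that)
    show "((\<lambda>z. f z y) has_field_derivative fx z y) (at z within U)" if z: "z \<in> U" for z y
    proof -
      have "((\<lambda>z. s z y) has_field_derivative (z - R * co y) / s z y) (at z within U)"
      proof -
        have "((\<lambda>z. q z y) has_field_derivative 2 * (z - R * co y)) (at z within U)"
          unfolding q_def by (auto intro!: derivative_eq_intros simp: algebra_simps)
        from has_field_derivative_csqrt'[OF this q0[OF z]] show ?thesis
          unfolding s_def mult_divide_mult_cancel_left_if by simp
      qed
      then show ?thesis
        unfolding f_def fx_def using s0[OF z, of y]
        by (auto intro!: derivative_eq_intros simp: field_simps power_numeral_reduce)
    qed
  qed
  have val: "Re (F (of_real t)) = 4 * pi * H (t *\<^sub>R vector [0, 0, 1])" if t: "\<bar>t\<bar> < R / 4" for t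
  proof -
    define p :: "real ^ 3" where "p = t *\<^sub>R vector [0, 0, 1]"
    have tU: "of_real t \<in> U" using t by (simp add: U_def)
    have p3: "p $ 1 = 0" "p $ 2 = 0" "p $ 3 = t" by (simp_all add: p_def)
    have np: "norm p = \<bar>t\<bar>"
    proof -
      have "(norm p)\<^sup>2 = t\<^sup>2" by (simp add: norm_vector_3_power2 p3)
      then show ?thesis by (metis norm_ge_zero abs_of_nonneg real_sqrt_abs)
    qed
    have "Re (F (of_real t)) = integral (cbox (0, 0) (pi, 2 * pi)) (\<lambda>y. Re (f (of_real t) y))"
      unfolding F_def
      using integral_linear[OF integrable_continuous[OF fcy[OF tU]] bounded_linear_Re] by (simp add: o_def)
    also have "\<dots> = integral (cbox (0, 0) (pi, 2 * pi)) (\<lambda>y. - (green_field H V (newton p) (newton_grad p)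
        (0 + R *\<^sub>R direction (fst y) (snd y)) \<bullet> (0 + R *\<^sub>R direction (fst y) (snd y) - 0) / R * R\<^sup>2 * sin (fst y)))"
    proof (rule integral_cong)
      fix y :: "real \<times> real"
      let ?d = "direction (fst y) (snd y)"
      define n where "n = norm (R *\<^sub>R ?d - p)"
      have dd: "?d \<bullet> ?d = 1" by (simp add: dot_square_norm)
      have dp: "?d \<bullet> p = co y * t" "p \<bullet> ?d = co y * t" by (simp_all add: inner_vec_def sum_3 p3 co_def)
      have n2: "n\<^sup>2 = R\<^sup>2 - 2 * R * co y * t + t\<^sup>2"
        unfolding n_def power2_norm_eq_inner by (simp add: inner_diff_left inner_diff_right dd dp)
          (simp add: inner_vec_def sum_3 p3 co_def power2_eq_square algebra_simps)
      have npos: "n > 0"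
      proof -
        have "norm (R *\<^sub>R ?d) - norm p \<le> n" unfolding n_def by (rule norm_triangle_ineq2)
        then show ?thesis using np t R by simp
      qed
      have "q (of_real t) y = of_real (n\<^sup>2)" unfolding q_def n2 by simp
      then have s: "s (of_real t) y = of_real n" using npos by (simp add: s_def csqrt_of_real_nonneg)
      have "f (of_real t) y = of_real ((hh y * (R - co y * t) / n ^ 3 + vv y / n) * (R\<^sup>2 * sin (fst y)))"
        unfolding f_def s by simp
      then have "Re (f (of_real t) y) = (hh y * (R - co y * t) / n ^ 3 + vv y / n) * (R\<^sup>2 * sin (fst y))"
        by (simp only: Re_complex_of_real)
      also have "\<dots> = - (green_field H V (newton p) (newton_grad p) (R *\<^sub>R ?d) \<bullet> ?d * R\<^sup>2 * sin (fst y))"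
        by (simp add: green_field_def newton_def newton_grad_def n_def[symmetric] inner_diff_left dd dp hh_def vv_def
            algebra_simps diff_divide_distrib add_divide_distrib)
      finally show "Re (f (of_real t) y) = - (green_field H V (newton p) (newton_grad p)
        (0 + R *\<^sub>R ?d) \<bullet> (0 + R *\<^sub>R ?d - 0) / R * R\<^sup>2 * sin (fst y))"
        using R by simp
    qed
    also have "\<dots> = - sphere_flux (green_field H V (newton p) (newton_grad p)) 0 R"
      unfolding sphere_flux_def sphere_integral_direction integral_neg ..
    also have "\<dots> = 4 * pi * H p"
      using green_flux_point[OF V, of 0 p R] np t R by simp
    finally show ?thesis by (simp add: p_def)
  qed
  define c where "c k = Re ((deriv ^^ k) F 0 / fact k) / (4 * pi)" for k
  have "(\<lambda>k. c k * t ^ k) sums H (t *\<^sub>R vector [0, 0, 1])" if t: "\<bar>t\<bar> < R / 4" for t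
  proof -
    have S: "(\<lambda>k. (deriv ^^ k) F 0 / fact k * (of_real t - 0) ^ k) sums F (of_real t)"
      using hol t by (intro holomorphic_power_series) (auto simp: U_def)
    have r: "Re (z * (of_real t - 0) ^ k) = Re z * t ^ k" for z :: complex and k
      by (simp flip: of_real_power)
    have ck: "Re ((deriv ^^ k) F 0 / fact k * (of_real t - 0) ^ k) / (4 * pi) = c k * t ^ k" for k
      unfolding c_def r by simp
    have e: "Re (F (of_real t)) / (4 * pi) = H (t *\<^sub>R vector [0, 0, 1])" by (simp add: val[OF t])
    have "(\<lambda>k. Re ((deriv ^^ k) F 0 / fact k * (of_real t - 0) ^ k) / (4 * pi)) sums (Re (F (of_real t)) / (4 * pi))"
      by (intro sums_divide sums_Re S)
    then show ?thesis unfolding ck e .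
  qed
  then show ?thesis by (rule that)
qed

text \<open>Every \<open>t\<close> lies in the range of the expansion for some \<open>R\<close>,
  here \<open>4 * \<bar>t\<bar> + 4\<close>. All these expansions share their coefficients, which
  are determined by the derivatives at 0.\<close>

lemma taylor_coeff_sums:
  fixes H :: "real ^ 3 \<Rightarrow> real"
  assumes "harmonic_on UNIV H"
  shows "(\<lambda>k. taylor_coeff H k * t ^ k) sums H (t *\<^sub>R vector [0, 0, 1])"
proof -
  obtain c where c: "\<And>x. \<bar>x\<bar> < (4 * \<bar>t\<bar> + 4) / 4 \<Longrightarrow> (\<lambda>k. c k * x ^ k) sums H (x *\<^sub>R vector [0, 0, 1])"
    by (rule harmonic_axis_power_series[OF assms, of "4 * \<bar>t\<bar> + 4"]) auto
  have "taylor_coeff H k = c k" for k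
    unfolding taylor_coeff_def by (rule power_series_imp_taylor_coeff[where \<rho> = "(4 * \<bar>t\<bar> + 4) / 4", OF _ c]) auto
  then show ?thesis using c[of t] by simp
qed

section \<open>Asymptotics of the image charge series\<close>

lemma bounded_on_pos:
  fixes f :: "real \<Rightarrow> real"
  assumes c: "continuous_on {0<..} f" and l0: "(f \<longlongrightarrow> a) (at_right 0)" and l1: "(f \<longlongrightarrow> b) at_top"
  shows "\<exists>B>0. \<forall>s>0. \<bar>f s\<bar> \<le> B"
proof -
  have "\<forall>\<^sub>F s in at_right 0. dist (f s) a < 1" by (rule tendstoD[OF l0]) simp
  then obtain d where d: "d > 0" "\<And>s. 0 < s \<Longrightarrow> s < d \<Longrightarrow> dist (f s) a < 1"
    unfolding eventually_at_right_field by auto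
  have "\<forall>\<^sub>F s in at_top. dist (f s) b < 1" by (rule tendstoD[OF l1]) simp
  then obtain N where N: "\<And>s. s \<ge> N \<Longrightarrow> dist (f s) b < 1"
    unfolding eventually_at_top_linorder by auto
  have "compact (f ` {d/2..max N d})"
    using d by (intro compact_continuous_image continuous_on_subset[OF c]) auto
  then have "bounded (f ` {d/2..max N d})" by (rule compact_imp_bounded)
  then obtain M where M: "\<forall>x\<in>{d/2..max N d}. \<bar>f x\<bar> \<le> M"
    unfolding bounded_iff by auto
  show ?thesis
  proof (intro exI[of _ "\<bar>a\<bar> + \<bar>b\<bar> + \<bar>M\<bar> + 1"] conjI allI impI)
    fix s :: real assume s: "s > 0"
    consider "s < d" | "s \<ge> N" | "s \<in> {d/2..max N d}" using d by force
    then show "\<bar>f s\<bar> \<le> \<bar>a\<bar> + \<bar>b\<bar> + \<bar>M\<bar> + 1"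
    proof cases
      case 1 then show ?thesis using d(2)[OF s 1] by (simp add: dist_real_def)
    next
      case 2 then show ?thesis using N[of s] by (simp add: dist_real_def)
    next
      case 3 then show ?thesis using M by force
    qed
  qed auto
qed

text \<open>An antiderivative of \<open>csch_diff'\<close> that tends to 0 at both ends of the
  half-line, whence the integral 0. In \<open>csch_diff'\<close>, the quotient
  \<open>cosh s / (sinh s)\<^sup>2\<close> is the strength of a charge times its position in units
  of \<alpha>, and \<open>1 / s\<^sup>2\<close> is its leading term at 0.\<close>

definition csch_diff :: "real \<Rightarrow> real" where "csch_diff s = 1 / s - 1 / sinh s"
definition csch_diff' :: "real \<Rightarrow> real" where "csch_diff' s = cosh s / (sinh s)\<^sup>2 - 1 / s\<^sup>2"
definition csch_diff'' :: "real \<Rightarrow> real" where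
  "csch_diff'' s = 1 / sinh s - 2 * (cosh s)\<^sup>2 / sinh s ^ 3 + 2 / s ^ 3"

lemma csch_diff_derivative:
  assumes "s > 0"
  shows "(csch_diff has_real_derivative csch_diff' s) (at s)"
proof -
  have "sinh s \<noteq> 0" using assms by simp
  then show ?thesis
    unfolding csch_diff_def[abs_def] csch_diff'_def using assms
    by (auto intro!: derivative_eq_intros simp: power2_eq_square field_simps)
qed

lemma csch_diff'_derivative:
  assumes "s > 0"
  shows "(csch_diff' has_real_derivative csch_diff'' s) (at s)"
proof -
  have "sinh s \<noteq> 0" using assms by simp
  then show ?thesis
    unfolding csch_diff'_def[abs_def] csch_diff''_def using assms
    by (auto intro!: derivative_eq_intros simp: power2_eq_square power3_eq_cube field_simps)
qed

text \<open>The quantities are strengths, positions and products of them, each compared with its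
  leading term at 0. Dividing by \<open>1 + s\<^sup>2\<close> gives integrable decay at infinity;
  the additional \<open>1 / s\<close> in the cubic bound is the source of the logarithm.\<close>

definition csch_bound :: "real \<Rightarrow> bool" where
  "csch_bound B \<longleftrightarrow> B > 0 \<and> (\<forall>s>0. \<bar>csch_diff' s\<bar> \<le> B \<and> \<bar>csch_diff'' s\<bar> \<le> B / (1 + s\<^sup>2) \<and>
    \<bar>csch_diff s\<bar> \<le> B * s \<and> \<bar>(cosh s)\<^sup>2 / sinh s ^ 3 - 1 / s ^ 3\<bar> \<le> B / (s * (1 + s\<^sup>2)) \<and>
    \<bar>cosh s / sinh s - 1 / s\<bar> \<le> B * s \<and> \<bar>cosh s / sinh s - 1 / s\<bar> \<le> B)"

lemma csch_boundD:
  assumes "csch_bound B"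
  shows "B > 0" "\<And>s. s > 0 \<Longrightarrow> \<bar>csch_diff' s\<bar> \<le> B" "\<And>s. s > 0 \<Longrightarrow> \<bar>csch_diff'' s\<bar> \<le> B / (1 + s\<^sup>2)"
    "\<And>s. s > 0 \<Longrightarrow> \<bar>csch_diff s\<bar> \<le> B * s"
    "\<And>s. s > 0 \<Longrightarrow> \<bar>(cosh s)\<^sup>2 / sinh s ^ 3 - 1 / s ^ 3\<bar> \<le> B / (s * (1 + s\<^sup>2))"
    "\<And>s. s > 0 \<Longrightarrow> \<bar>cosh s / sinh s - 1 / s\<bar> \<le> B * s" "\<And>s. s > 0 \<Longrightarrow> \<bar>cosh s / sinh s - 1 / s\<bar> \<le> B"
  using assms unfolding csch_bound_def by simp_all

text \<open>Each quotient of an expression by its intended bound is continuous with finite limits at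
  0 and at infinity, hence bounded. The limits at 0 are read off from Taylor expansions.\<close>

lemma csch_bound_exists: obtains B where "csch_bound B"
proof -
  have nz: "sinh s \<noteq> 0" if "s > 0" for s :: real using that by simp
  have "continuous_on {0<..} csch_diff'" unfolding csch_diff'_def[abs_def] by (intro continuous_intros) (use nz in auto)
  moreover have "(csch_diff' \<longlongrightarrow> 1/6) (at_right 0)" unfolding csch_diff'_def[abs_def] by real_asymp
  moreover have "(csch_diff' \<longlongrightarrow> 0) at_top" unfolding csch_diff'_def[abs_def] by real_asymp
  ultimately obtain B1 where B1: "B1 > 0" "\<And>s. s > 0 \<Longrightarrow> \<bar>csch_diff' s\<bar> \<le> B1"
    using bounded_on_pos[of csch_diff' "1/6" "0"] by blast
  define f2 where "f2 s = csch_diff'' s * (1 + s\<^sup>2)" for s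
  have "continuous_on {0<..} f2" unfolding f2_def[abs_def] csch_diff''_def by (intro continuous_intros) (use nz in auto)
  moreover have "(f2 \<longlongrightarrow> 0) (at_right 0)" unfolding f2_def[abs_def] csch_diff''_def by real_asymp
  moreover have "(f2 \<longlongrightarrow> 0) at_top" unfolding f2_def[abs_def] csch_diff''_def by real_asymp
  ultimately obtain B2 where B2: "B2 > 0" "\<And>s. s > 0 \<Longrightarrow> \<bar>f2 s\<bar> \<le> B2"
    using bounded_on_pos[of f2 "0" "0"] by blast
  define f3 where "f3 s = csch_diff s / s" for s
  have "continuous_on {0<..} f3" unfolding f3_def[abs_def] csch_diff_def by (intro continuous_intros) (use nz in auto)
  moreover have "(f3 \<longlongrightarrow> 1/6) (at_right 0)" unfolding f3_def[abs_def] csch_diff_def by real_asymp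
  moreover have "(f3 \<longlongrightarrow> 0) at_top" unfolding f3_def[abs_def] csch_diff_def by real_asymp
  ultimately obtain B3 where B3: "B3 > 0" "\<And>s. s > 0 \<Longrightarrow> \<bar>f3 s\<bar> \<le> B3"
    using bounded_on_pos[of f3 "1/6" "0"] by blast
  define f4 where "f4 s = ((cosh s)\<^sup>2 / sinh s ^ 3 - 1 / s ^ 3) * (s * (1 + s\<^sup>2))" for s :: real
  have "continuous_on {0<..} f4" unfolding f4_def[abs_def] by (intro continuous_intros) (use nz in auto)
  moreover have "(f4 \<longlongrightarrow> 1/2) (at_right 0)" unfolding f4_def[abs_def] by real_asymp
  moreover have "(f4 \<longlongrightarrow> - 1) at_top" unfolding f4_def[abs_def] by real_asymp
  ultimately obtain B4 where B4: "B4 > 0" "\<And>s. s > 0 \<Longrightarrow> \<bar>f4 s\<bar> \<le> B4"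
    using bounded_on_pos[of f4 "1/2" "- 1"] by blast
  define f5 where "f5 s = (cosh s / sinh s - 1 / s) / s" for s :: real
  have "continuous_on {0<..} f5" unfolding f5_def[abs_def] by (intro continuous_intros) (use nz in auto)
  moreover have "(f5 \<longlongrightarrow> 1/3) (at_right 0)" unfolding f5_def[abs_def] by real_asymp
  moreover have "(f5 \<longlongrightarrow> 0) at_top" unfolding f5_def[abs_def] by real_asymp
  ultimately obtain B5 where B5: "B5 > 0" "\<And>s. s > 0 \<Longrightarrow> \<bar>f5 s\<bar> \<le> B5"
    using bounded_on_pos[of f5 "1/3" "0"] by blast
  define f6 where "f6 s = cosh s / sinh s - 1 / s" for s :: real
  have "continuous_on {0<..} f6" unfolding f6_def[abs_def] by (intro continuous_intros) (use nz in auto)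
  moreover have "(f6 \<longlongrightarrow> 0) (at_right 0)" unfolding f6_def[abs_def] by real_asymp
  moreover have "(f6 \<longlongrightarrow> 1) at_top" unfolding f6_def[abs_def] by real_asymp
  ultimately obtain B6 where B6: "B6 > 0" "\<And>s. s > 0 \<Longrightarrow> \<bar>f6 s\<bar> \<le> B6"
    using bounded_on_pos[of f6 "0" "1"] by blast
  define B where "B = B1 + B2 + B3 + B4 + B5 + B6"
  have le: "B > 0" "B1 \<le> B" "B2 \<le> B" "B3 \<le> B" "B4 \<le> B" "B5 \<le> B" "B6 \<le> B"
    using B1(1) B2(1) B3(1) B4(1) B5(1) B6(1) by (auto simp: B_def)
  have "csch_bound B"
    unfolding csch_bound_def
  proof (intro conjI allI impI)
    fix s :: real assume s: "s > 0"
    have "1 + s\<^sup>2 > 0" by (simp add: add_pos_nonneg)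
    then have p: "1 + s\<^sup>2 > 0" "s * (1 + s\<^sup>2) > 0" using mult_pos_pos[OF s] by blast+
    show "\<bar>csch_diff' s\<bar> \<le> B" using B1(2)[OF s] le by simp
    have "\<bar>csch_diff'' s\<bar> * (1 + s\<^sup>2) \<le> B" using B2(2)[OF s] le p by (simp add: f2_def abs_mult)
    then show "\<bar>csch_diff'' s\<bar> \<le> B / (1 + s\<^sup>2)" by (simp add: pos_le_divide_eq[OF p(1)])
    have "\<bar>csch_diff s\<bar> / s \<le> B" using B3(2)[OF s] le s by (simp add: f3_def abs_divide)
    then show "\<bar>csch_diff s\<bar> \<le> B * s" by (simp add: pos_divide_le_eq[OF s])
    have "\<bar>(cosh s)\<^sup>2 / sinh s ^ 3 - 1 / s ^ 3\<bar> * (s * (1 + s\<^sup>2)) \<le> B"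
      using B4(2)[OF s] le p unfolding f4_def abs_mult[of _ "s * (1 + s\<^sup>2)"] by simp
    then show "\<bar>(cosh s)\<^sup>2 / sinh s ^ 3 - 1 / s ^ 3\<bar> \<le> B / (s * (1 + s\<^sup>2))"
      by (simp only: pos_le_divide_eq[OF p(2)])
    have "\<bar>cosh s / sinh s - 1 / s\<bar> / s \<le> B" using B5(2)[OF s] le s by (simp add: f5_def abs_divide)
    then show "\<bar>cosh s / sinh s - 1 / s\<bar> \<le> B * s" by (simp only: pos_divide_le_eq[OF s])
    show "\<bar>cosh s / sinh s - 1 / s\<bar> \<le> B" using B6(2)[OF s] le by (simp add: f6_def)
  qed (rule le(1))
  then show ?thesis by (rule that)
qed

text \<open>Summability travels with the estimate, because \<open>suminf\<close> of a divergent
  series has no meaningful value.\<close>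

definition sum_bound :: "(nat \<Rightarrow> real) \<Rightarrow> real \<Rightarrow> bool" where
  "sum_bound f b \<longleftrightarrow> summable f \<and> \<bar>suminf f\<bar> \<le> b"

lemma sum_boundI:
  assumes "\<And>m. \<bar>f m\<bar> \<le> g m" "g sums s" "s \<le> b"
  shows "sum_bound f b"
proof -
  have g: "summable g" "suminf g = s" using assms(2) by (auto simp: sums_iff)
  have af: "summable (\<lambda>m. \<bar>f m\<bar>)" by (rule summable_comparison_test'[OF g(1)]) (use assms(1) in auto)
  have "\<bar>suminf f\<bar> \<le> (\<Sum>m. \<bar>f m\<bar>)" by (rule summable_rabs[OF af])
  also have "\<dots> \<le> suminf g" by (intro suminf_le assms(1) af g)
  finally show ?thesis using af g assms(3) summable_rabs_cancel by (auto simp: sum_bound_def)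
qed

lemma sum_bound_partial:
  assumes "\<And>m. \<bar>f m\<bar> \<le> g m" "\<And>n. (\<Sum>m<n. g m) \<le> b"
  shows "sum_bound f b"
proof -
  have g0: "g m \<ge> 0" for m using assms(1)[of m] by linarith
  have "summable g" by (rule bounded_imp_summable[of _ b]) (use g0 assms(2)[of "Suc _"] in \<open>auto simp: lessThan_Suc_atMost\<close>)
  then show ?thesis
    by (intro sum_boundI[OF assms(1)]) (auto intro: suminf_le_const assms(2))
qed

lemma sum_bound_add: "sum_bound f b \<Longrightarrow> sum_bound g c \<Longrightarrow> sum_bound (\<lambda>m. f m + g m) (b + c)"
  unfolding sum_bound_def by (auto simp: suminf_add[symmetric] intro: summable_add)

lemma sum_bound_cmult: "sum_bound f b \<Longrightarrow> sum_bound (\<lambda>m. k * f m) (\<bar>k\<bar> * b)"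
  unfolding sum_bound_def by (auto simp: suminf_mult abs_mult intro: summable_mult mult_left_mono)

lemma sum_bound_mono: "sum_bound f b \<Longrightarrow> b \<le> c \<Longrightarrow> sum_bound f c"
  by (auto simp: sum_bound_def)

lemma sum_bound_cong: "sum_bound f b \<Longrightarrow> (\<And>m. f m = g m) \<Longrightarrow> b = c \<Longrightarrow> sum_bound g c"
  by (metis ext)

text \<open>\<open>csch_diff'\<close> has integral \<open>0\<close> over \<open>(0, \<infinity>)\<close>, so its Riemann sums are \<open>O(S)\<close>.\<close>

lemma csch_riemann_sum:
  obtains C where "C > 0" "\<And>S \<xi>. 0 < S \<Longrightarrow> (\<And>m. \<xi> m > 0) \<Longrightarrow>
    (\<And>m. real m * S \<le> \<xi> m \<and> \<xi> m \<le> (real m + 1) * S) \<Longrightarrow> sum_bound (\<lambda>m. S * csch_diff' (\<xi> m)) (C * S)"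
proof -
  obtain B where "csch_bound B" by (rule csch_bound_exists)
  note B = csch_boundD[OF this]
  \<comment> \<open>The sample points are arbitrary in their cells, because in the application they
    come from the mean value theorem.\<close>
  have main: "sum_bound (\<lambda>m. S * csch_diff' (\<xi> m)) ((2 * B + B * pi) * S)"
    if S: "0 < S" and pos: "\<And>m. \<xi> m > 0" and \<xi>: "\<And>m. real m * S \<le> \<xi> m \<and> \<xi> m \<le> (real m + 1) * S" for S \<xi>
  proof -
    define G where "G m = csch_diff (real (Suc m) * S)" for m
    define t where "t m = real (Suc m) * S" for m
    have t: "t m > 0" for m using S by (simp add: t_def)
    have tS: "t (Suc m) = t m + S" for m by (simp add: t_def algebra_simps)
    have Gt: "G m = csch_diff (t m)" for m by (simp add: G_def t_def)
    \<comment> \<open>On one cell the sum and the integral differ by at most \<open>S\<close> times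
      the variation of \<open>csch_diff'\<close>. The bound on \<open>csch_diff''\<close> turns this
      into increments of \<open>arctan\<close>, whose total is at most \<pi>.\<close>
    have rest: "\<bar>S * csch_diff' (\<xi> (Suc m)) - (G (Suc m) - G m)\<bar> \<le> B * S * (arctan (t m) - arctan (t m - S))" for m
    proof -
      have "\<exists>z>t m. z < t m + S \<and> csch_diff (t m + S) - csch_diff (t m) = (t m + S - t m) * csch_diff' z"
        by (rule MVT2) (use S t[of m] in \<open>auto intro!: csch_diff_derivative\<close>)
      then obtain z where z: "t m < z" "z < t m + S" "G (Suc m) - G m = S * csch_diff' z"
        by (auto simp: Gt tS)
      have x: "t m \<le> \<xi> (Suc m)" "\<xi> (Suc m) \<le> t m + S" using \<xi>[of "Suc m"] by (auto simp: t_def algebra_simps)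
      have bd: "\<bar>csch_diff' a - csch_diff' b\<bar> \<le> B / (1 + (t m)\<^sup>2) * \<bar>a - b\<bar>"
        if ab: "a \<in> {t m..t m + S}" "b \<in> {t m..t m + S}" for a b
      proof -
        have "norm (csch_diff' a - csch_diff' b) \<le> B / (1 + (t m)\<^sup>2) * norm (a - b)"
        proof (rule field_differentiable_bound[of "{t m..t m + S}" csch_diff' csch_diff''])
          show "(csch_diff' has_real_derivative csch_diff'' x) (at x within {t m..t m + S})"
            if "x \<in> {t m..t m + S}" for x
            using that t[of m] by (auto intro!: has_field_derivative_at_within csch_diff'_derivative)
          show "norm (csch_diff'' x) \<le> B / (1 + (t m)\<^sup>2)" if x: "x \<in> {t m..t m + S}" for x
          proof -
            have "(t m)\<^sup>2 \<le> x\<^sup>2" using x t[of m] by (intro power_mono) auto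
            then have "B / (1 + x\<^sup>2) \<le> B / (1 + (t m)\<^sup>2)"
              using B(1) by (intro divide_left_mono mult_pos_pos add_pos_nonneg) auto
            then show ?thesis using B(3)[of x] x t[of m] by simp
          qed
        qed (use ab in auto)
        then show ?thesis by simp
      qed
      have at: "S / (1 + (t m)\<^sup>2) \<le> arctan (t m) - arctan (t m - S)"
      proof -
        have "\<exists>y>t m - S. y < t m \<and> arctan (t m) - arctan (t m - S) = (t m - (t m - S)) * inverse (1 + y\<^sup>2)"
          by (rule MVT2) (use S in \<open>auto intro!: DERIV_arctan\<close>)
        then obtain y where y: "t m - S < y" "y < t m" "arctan (t m) - arctan (t m - S) = S * inverse (1 + y\<^sup>2)" by auto
        have "0 \<le> t m - S" using S by (simp add: t_def algebra_simps)
        then have "y\<^sup>2 \<le> (t m)\<^sup>2" using y by (intro power_mono) auto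
        then have "inverse (1 + (t m)\<^sup>2) \<le> inverse (1 + y\<^sup>2)" by (intro le_imp_inverse_le add_pos_nonneg) auto
        then show ?thesis using y(3) S by (simp add: divide_inverse)
      qed
      have "\<bar>S * csch_diff' (\<xi> (Suc m)) - (G (Suc m) - G m)\<bar> = S * \<bar>csch_diff' (\<xi> (Suc m)) - csch_diff' z\<bar>"
        unfolding z(3) right_diff_distrib[symmetric] abs_mult using S by simp
      also have "\<dots> \<le> S * (B / (1 + (t m)\<^sup>2) * \<bar>\<xi> (Suc m) - z\<bar>)"
        by (intro mult_left_mono bd) (use x z S in auto)
      also have "\<dots> \<le> S * (B / (1 + (t m)\<^sup>2) * S)"
        using x z S B(1) by (intro mult_left_mono) (auto intro!: divide_nonneg_nonneg)
      also have "\<dots> = B * S * (S / (1 + (t m)\<^sup>2))" by simp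
      also have "\<dots> \<le> B * S * (arctan (t m) - arctan (t m - S))"
        by (intro mult_left_mono at) (use B S in auto)
      finally show ?thesis .
    qed
    have r1: "sum_bound (\<lambda>m. S * csch_diff' (\<xi> (Suc m)) - (G (Suc m) - G m)) (B * S * pi)"
    proof (rule sum_bound_partial[OF rest])
      fix n
      have tele: "(\<Sum>m<n. arctan (t m) - arctan (t m - S)) = arctan (real n * S) - arctan 0"
        by (induction n) (auto simp: t_def algebra_simps)
      have "arctan (real n * S) \<le> pi" using arctan_ubound[of "real n * S"] pi_gt_zero by linarith
      then have "(\<Sum>m<n. arctan (t m) - arctan (t m - S)) \<le> pi" unfolding tele by simp
      then have "B * S * (\<Sum>m<n. arctan (t m) - arctan (t m - S)) \<le> B * S * pi"
        using B S by (intro mult_left_mono) auto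
      then show "(\<Sum>m<n. B * S * (arctan (t m) - arctan (t m - S))) \<le> B * S * pi"
        by (simp only: sum_distrib_left)
    qed
    have "G \<longlonglongrightarrow> 0"
    proof -
      have "(csch_diff \<longlongrightarrow> 0) at_top" unfolding csch_diff_def[abs_def] by real_asymp
      moreover have "filterlim (\<lambda>m. real (Suc m) * S) at_top sequentially" using S by real_asymp
      ultimately show ?thesis unfolding G_def[abs_def] by (rule filterlim_compose)
    qed
    then have "(\<lambda>m. G (Suc m) - G m) sums (0 - G 0)" by (rule telescope_sums)
    then have r2: "sum_bound (\<lambda>m. G (Suc m) - G m) (B * S)"
      using B(4)[of S] S by (auto simp: sum_bound_def sums_iff G_def)
    have r3: "sum_bound (\<lambda>m. S * csch_diff' (\<xi> (Suc m))) (B * S * pi + B * S)"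
      using sum_bound_add[OF r1 r2] by simp
    then have sm: "summable (\<lambda>m. S * csch_diff' (\<xi> m))" 
      using summable_Suc_iff[of "\<lambda>m. S * csch_diff' (\<xi> m)"] unfolding sum_bound_def by blast
    \<comment> \<open>The cell that touches 0 is bounded directly by the supremum of
      \<open>csch_diff'\<close>.\<close>
    have "(\<Sum>m. S * csch_diff' (\<xi> m)) = (\<Sum>m. S * csch_diff' (\<xi> (Suc m))) + S * csch_diff' (\<xi> 0)"
      using suminf_split_head[OF sm] by simp
    moreover have "\<bar>S * csch_diff' (\<xi> 0)\<bar> \<le> S * B" unfolding abs_mult using B(2)[OF pos[of 0]] S by (intro mult_mono) auto
    ultimately have "\<bar>\<Sum>m. S * csch_diff' (\<xi> m)\<bar> \<le> (B * S * pi + B * S) + S * B" using r3 unfolding sum_bound_def by linarith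
    then show ?thesis using sm by (simp add: sum_bound_def algebra_simps)
  qed
  show ?thesis
    by (rule that[of "2 * B + B * pi"]) (use B(1) main in \<open>auto intro!: add_pos_pos\<close>)
qed

text \<open>Comparison with the integral of \<open>1 / (s (1 + s\<^sup>2))\<close>, an
  antiderivative of which is \<open>- ln (1 + 1 / s\<^sup>2) / 2\<close>. The integral diverges
  logarithmically at 0, so the first term is kept apart; it contributes the 1.\<close>

lemma sum_inverse_cubic_bound:
  assumes h: "h > 0"
  shows "(\<Sum>m<n. 1 / ((h * real (Suc m)) * (1 + (h * real (Suc m))\<^sup>2))) \<le> (1 + ln (1 + 1 / h\<^sup>2) / 2) / h"
proof -
  define f where "f s = 1 / (s * (1 + s\<^sup>2))" for s :: real
  define g where "g s = ln (1 + s\<^sup>2) / 2 - ln s" for s :: real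
  have g_eq: "g s = ln (1 + 1 / s\<^sup>2) / 2" if s: "s > 0" for s
  proof -
    have "1 + 1 / s\<^sup>2 = (1 + s\<^sup>2) / s\<^sup>2" using s by (simp add: field_simps)
    moreover have "ln ((1 + s\<^sup>2) / s\<^sup>2) = ln (1 + s\<^sup>2) - ln (s\<^sup>2)"
    proof -
      have "1 + s\<^sup>2 > 0" by (simp add: add_pos_nonneg)
      then show ?thesis using s by (simp add: ln_div)
    qed
    ultimately show ?thesis using s by (simp add: g_def ln_realpow)
  qed
  have g0: "g s \<ge> 0" if "s > 0" for s using that by (auto simp: g_eq intro!: ln_ge_zero)
  have gd: "(g has_real_derivative - f s) (at s)" if s: "s > 0" for s
  proof -
    have p: "1 + s\<^sup>2 > 0" by (simp add: add_pos_nonneg)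
    have "((\<lambda>s. 1 + s\<^sup>2) has_real_derivative 2 * s) (at s)" by (auto intro!: derivative_eq_intros)
    from DERIV_diff[OF DERIV_cdivide[OF DERIV_chain2[OF DERIV_ln_divide[OF p] this], of 2] DERIV_ln_divide[OF s]]
    have "(g has_real_derivative 1 / (1 + s\<^sup>2) * (2 * s) / 2 - 1 / s) (at s)"
      unfolding g_def[abs_def] .
    moreover have "1 / q * (2 * s) / 2 - 1 / s = (s\<^sup>2 - q) / (s * q)" if "q > 0" for q
      using s that by (simp add: field_simps power2_eq_square)
    from this[OF p] have "1 / (1 + s\<^sup>2) * (2 * s) / 2 - 1 / s = - f s"
      unfolding f_def by simp
    ultimately show ?thesis by simp
  qed
  have step: "f (s + h) * h \<le> g s - g (s + h)" if s: "s > 0" for s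
  proof -
    have "\<exists>z>s. z < s + h \<and> g (s + h) - g s = (s + h - s) * (- f z)"
      by (rule MVT2) (use s h gd in auto)
    then obtain z where z: "s < z" "z < s + h" "g (s + h) - g s = h * (- f z)" by auto
    have "z * (1 + z\<^sup>2) \<le> (s + h) * (1 + (s + h)\<^sup>2)"
      using z s by (intro mult_mono add_mono power_mono) auto
    then have "f (s + h) \<le> f z" unfolding f_def using z s h
      by (intro divide_left_mono mult_pos_pos add_pos_nonneg) auto
    then have "h * f (s + h) \<le> h * f z" using h by simp
    then show ?thesis using z(3) by (simp add: mult.commute)
  qed
  have "f h \<le> 1 / h"
  proof -
    have "h * 1 \<le> h * (1 + h\<^sup>2)" using h by (intro mult_left_mono) auto
    then show ?thesis unfolding f_def using h by (intro divide_left_mono) (auto intro!: mult_pos_pos add_pos_nonneg)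
  qed
  have "(\<Sum>m<n. f (h * real (Suc m))) \<le> (1 + g h) / h"
  proof (cases n)
    case 0
    then show ?thesis using g0[OF h] h by simp
  next
    case (Suc k)
    have "(\<Sum>m<Suc k. f (h * real (Suc m))) * h \<le> 1 + g h - g (h * real (Suc k))"
    proof (induction k)
      case 0
      then show ?case using \<open>f h \<le> 1 / h\<close> h by (simp add: field_simps)
    next
      case (Suc k)
      have "f (h * real (Suc k) + h) * h \<le> g (h * real (Suc k)) - g (h * real (Suc k) + h)"
        by (rule step) (use h in simp)
      moreover have "h * real (Suc k) + h = h * real (Suc (Suc k))" by (simp add: algebra_simps)
      ultimately show ?case using Suc by (simp only: sum.lessThan_Suc distrib_right)
    qed
    moreover have "g (h * real (Suc k)) \<ge> 0" by (rule g0) (use h in simp)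
    ultimately have "(\<Sum>m<n. f (h * real (Suc m))) * h \<le> 1 + g h" unfolding Suc by linarith
    then show ?thesis using h by (simp add: pos_le_divide_eq)
  qed
  then show ?thesis by (simp add: f_def g_eq[OF h])
qed

text \<open>The remainder \<open>L\<close> is again an everywhere convergent power series, hence
  bounded and Lipschitz on bounded sets. The split isolates the linear term, whose error is
  controlled by cancellation rather than by size.\<close>

lemma power_series_quadratic_remainder:
  fixes c :: "nat \<Rightarrow> real"
  assumes g: "\<And>t. (\<lambda>k. c k * t ^ k) sums g t"
  obtains L where "\<And>t. g t = g 0 + c 1 * t + t\<^sup>2 * L t"
    "\<And>M. \<exists>B>0. \<forall>x y. \<bar>x\<bar> \<le> M \<longrightarrow> \<bar>y\<bar> \<le> M \<longrightarrow> \<bar>L x\<bar> \<le> B \<and> \<bar>L x - L y\<bar> \<le> B * \<bar>x - y\<bar>"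
proof
  define L where "L t = (\<Sum>k. c (k + 2) * t ^ k)" for t
  have sm0: "summable (\<lambda>k. c k * t ^ k)" for t using g sums_summable by blast
  then have sm1: "summable (\<lambda>k. c (Suc k) * t ^ k)" for t by (simp add: summable_powser_split_head)
  then have sm2: "summable (\<lambda>k. c (Suc (Suc k)) * t ^ k)" for t
    by (simp add: summable_powser_split_head[of "\<lambda>k. c (Suc k)"])
  have g0: "g 0 = c 0" using sums_unique2[OF g[of 0] powser_sums_zero] by simp
  show "g t = g 0 + c 1 * t + t\<^sup>2 * L t" for t
  proof -
    have "g t = c 0 + suminf (\<lambda>k. c (Suc k) * t ^ k) * t"
      using powser_split_head(1)[OF sm0[of t]] g[of t] by (simp add: sums_iff)
    also have "suminf (\<lambda>k. c (Suc k) * t ^ k) = c 1 + L t * t"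
      using powser_split_head(1)[OF sm1[of t]] by (simp add: L_def)
    finally show ?thesis by (simp add: g0 power2_eq_square algebra_simps)
  qed
  define L' where "L' t = (\<Sum>k. diffs (\<lambda>k. c (k + 2)) k * t ^ k)" for t
  have sm: "summable (\<lambda>k. c (k + 2) * t ^ k)" for t using sm2 by simp
  have der: "(L has_real_derivative L' t) (at t)" for t
    unfolding L_def[abs_def] L'_def by (rule termdiffs_strong_converges_everywhere[OF sm])
  have sm': "summable (\<lambda>k. diffs (\<lambda>k. c (k + 2)) k * t ^ k)" for t
    by (rule termdiff_converges_all[OF sm])
  have der': "(L' has_real_derivative (\<Sum>k. diffs (diffs (\<lambda>k. c (k + 2))) k * t ^ k)) (at t)" for t
    unfolding L'_def[abs_def] by (rule termdiffs_strong_converges_everywhere[OF sm'])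
  have cL: "continuous_on S L" for S using der by (meson DERIV_isCont continuous_at_imp_continuous_on)
  have cL': "continuous_on S L'" for S using der' by (meson DERIV_isCont continuous_at_imp_continuous_on)
  show "\<exists>B>0. \<forall>x y. \<bar>x\<bar> \<le> M \<longrightarrow> \<bar>y\<bar> \<le> M \<longrightarrow> \<bar>L x\<bar> \<le> B \<and> \<bar>L x - L y\<bar> \<le> B * \<bar>x - y\<bar>" for M
  proof -
    have "bounded (L ` {-M..M})" "bounded (L' ` {-M..M})"
      by (intro compact_imp_bounded compact_continuous_image cL cL' compact_Icc)+
    then obtain B1 B2 where "\<forall>x\<in>{-M..M}. \<bar>L x\<bar> \<le> B1" "\<forall>x\<in>{-M..M}. \<bar>L' x\<bar> \<le> B2"
      unfolding bounded_iff by auto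
    then have B1: "\<And>x. x \<in> {-M..M} \<Longrightarrow> \<bar>L x\<bar> \<le> B1" and B2: "\<And>x. x \<in> {-M..M} \<Longrightarrow> \<bar>L' x\<bar> \<le> B2" by blast+
    have *: "\<bar>L x - L y\<bar> \<le> B2 * \<bar>x - y\<bar>" if "\<bar>x\<bar> \<le> M" "\<bar>y\<bar> \<le> M" for x y
    proof -
      have "norm (L x - L y) \<le> B2 * norm (x - y)"
        by (rule field_differentiable_bound[of "{-M..M}" L L'])
          (use that B2 in \<open>auto intro: has_field_derivative_at_within der\<close>)
      then show ?thesis by simp
    qed
    have lip: "\<bar>L x - L y\<bar> \<le> (\<bar>B1\<bar> + \<bar>B2\<bar> + 1) * \<bar>x - y\<bar>" if "\<bar>x\<bar> \<le> M" "\<bar>y\<bar> \<le> M" for x y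
    proof -
      have "B2 * \<bar>x - y\<bar> \<le> (\<bar>B1\<bar> + \<bar>B2\<bar> + 1) * \<bar>x - y\<bar>" by (intro mult_right_mono) auto
      with that * show ?thesis by (meson order_trans)
    qed
    have "\<bar>L x\<bar> \<le> \<bar>B1\<bar> + \<bar>B2\<bar> + 1" if "\<bar>x\<bar> \<le> M" for x
    proof -
      have "x \<in> {-M..M}" using that by (auto simp: abs_le_iff)
      then show ?thesis using B1[of x] abs_ge_self[of B1] by linarith
    qed
    with lip show ?thesis by (intro exI[of _ "\<bar>B1\<bar> + \<bar>B2\<bar> + 1"]) auto
  qed
qed

section \<open>Comparison of the charges with their limits\<close>

definition zeta2 :: real where "zeta2 = (\<Sum>m. 1 / (1 + real m)\<^sup>2)"

lemma summable_inverse_square_shift: "x > 0 \<Longrightarrow> k \<ge> 2 \<Longrightarrow> summable (\<lambda>m. 1 / (x + real m) ^ k)"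
  using Polygamma_converges'[of x k] by (simp add: inverse_eq_divide)

lemma zeta2_nonneg: "zeta2 \<ge> 0"
  unfolding zeta2_def by (intro suminf_nonneg summable_inverse_square_shift) auto

lemma sum_bound_square:
  assumes "\<And>m. \<bar>f m\<bar> \<le> A / (1 + real m)\<^sup>2"
  shows "sum_bound f (A * zeta2)"
proof (rule sum_boundI)
  show "\<bar>f m\<bar> \<le> A * (1 / (1 + real m)\<^sup>2)" for m using assms[of m] by simp
  show "(\<lambda>m. A * (1 / (1 + real m)\<^sup>2)) sums (A * zeta2)"
    unfolding zeta2_def by (intro sums_mult summable_sums summable_inverse_square_shift) auto
qed simp

text \<open>The reciprocals are affine in \<open>m\<close>, and both coefficients are off by at most
  \<open>K * \<alpha>\<^sup>2\<close>. Since \<open>1 + m \<le> \<kappa> (p + m q)\<close>, the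
  relative error of the reciprocals is at most \<open>K * \<kappa> * \<alpha>\<^sup>2\<close>,
  uniformly in \<open>m\<close>. As this is at most \<open>1 / 2\<close>, inverting costs no more
  than a factor 2.\<close>

lemma offset_comparison:
  fixes p q K \<alpha> \<sigma> S :: real and m :: nat
  assumes pq: "p > 0" "q > 0" and \<alpha>: "\<alpha> > 0"
    and \<sigma>: "\<sigma> > 0" "\<bar>\<sigma> / \<alpha> - p\<bar> \<le> K * \<alpha>\<^sup>2" and S: "S > 0" "\<bar>S / \<alpha> - q\<bar> \<le> K * \<alpha>\<^sup>2"
  defines "\<kappa> \<equiv> 1 / p + 1 / q"
  assumes small: "K * \<kappa> * \<alpha>\<^sup>2 \<le> 1 / 2"
  defines "s \<equiv> \<sigma> + real m * S" and "t \<equiv> 1 / (p + real m * q)"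
  shows "s > 0" "t > 0" "t \<le> \<kappa> / (1 + real m)" "t \<le> \<kappa>" "\<alpha> / s \<le> 2 * t" "\<bar>\<alpha> / s - t\<bar> \<le> 2 * (K * \<kappa> * \<alpha>\<^sup>2) * t"
    "\<alpha> / (2 * \<kappa>) * (1 + real m) \<le> s"
proof -
  have \<kappa>: "\<kappa> > 0" using pq by (simp add: \<kappa>_def add_pos_pos)
  have K: "K \<ge> 0" using \<sigma>(2) \<alpha> by (meson abs_ge_zero order_trans zero_le_mult_iff zero_less_power not_le)
  show s: "s > 0" using \<sigma> S by (simp add: s_def add_pos_nonneg)
  have d: "p + real m * q > 0" using pq by (simp add: add_pos_nonneg)
  then show t: "t > 0" by (simp add: t_def)
  have le: "1 + real m \<le> \<kappa> * (p + real m * q)"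
  proof -
    have "\<kappa> * (p + real m * q) = 1 + real m + (p / q + real m * q / p)"
      unfolding \<kappa>_def using pq by (simp add: field_simps)
    moreover have "p / q + real m * q / p \<ge> 0" using pq by simp
    ultimately show ?thesis by linarith
  qed
  then show tk: "t \<le> \<kappa> / (1 + real m)" using d by (simp add: t_def field_simps)
  have "\<kappa> / (1 + real m) \<le> \<kappa> / 1" using \<kappa> by (intro divide_left_mono) auto
  then show "t \<le> \<kappa>" using tk by simp
  define w \<delta> where "w = \<alpha> / s" and "\<delta> = K * \<kappa> * \<alpha>\<^sup>2"
  have w: "w > 0" using s \<alpha> by (simp add: w_def)
  have \<delta>: "0 \<le> \<delta>" "\<delta> \<le> 1 / 2" using K \<kappa> small by (auto simp: \<delta>_def)
  have "1 / w - 1 / t = (\<sigma> / \<alpha> - p) + real m * (S / \<alpha> - q)"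
    using \<alpha> by (simp add: w_def t_def s_def field_simps)
  then have "\<bar>1 / w - 1 / t\<bar> \<le> \<bar>\<sigma> / \<alpha> - p\<bar> + real m * \<bar>S / \<alpha> - q\<bar>"
    by (metis abs_mult abs_of_nat abs_triangle_ineq)
  also have "\<dots> \<le> K * \<alpha>\<^sup>2 + real m * (K * \<alpha>\<^sup>2)" using \<sigma> S by (intro add_mono mult_left_mono) auto
  also have "\<dots> = K * \<alpha>\<^sup>2 * (1 + real m)" by (simp add: algebra_simps)
  also have "\<dots> \<le> K * \<alpha>\<^sup>2 * (\<kappa> * (p + real m * q))" using K by (intro mult_left_mono le) auto
  also have "\<dots> = \<delta> / t" by (simp add: \<delta>_def t_def)
  finally have D: "\<bar>1 / w - 1 / t\<bar> \<le> \<delta> / t" .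
  have "1 / t - \<delta> / t \<le> 1 / w" using D by linarith
  moreover have "1 / 2 / t \<le> (1 - \<delta>) / t" using \<delta> t by (intro divide_right_mono) auto
  ultimately have "1 / (2 * t) \<le> 1 / w" by (simp add: diff_divide_distrib)
  then have w2: "w \<le> 2 * t" using w t by (simp add: field_simps)
  then show "\<alpha> / s \<le> 2 * t" by (simp add: w_def)
  have "w - t = (w * t) * (1 / t - 1 / w)" using w t by (simp add: field_simps)
  then have "\<bar>w - t\<bar> = (w * t) * \<bar>1 / w - 1 / t\<bar>" using w t by (simp add: abs_mult abs_minus_commute)
  also have "\<dots> \<le> (w * t) * (\<delta> / t)" using w t by (intro mult_left_mono D) auto
  also have "\<dots> = \<delta> * w" using t by simp
  also have "\<dots> \<le> \<delta> * (2 * t)" using w2 \<delta> by (intro mult_left_mono) auto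
  finally show "\<bar>\<alpha> / s - t\<bar> \<le> 2 * (K * \<kappa> * \<alpha>\<^sup>2) * t" by (simp add: w_def \<delta>_def mult_ac)
  have "\<alpha> \<le> 2 * t * s" using w2 s by (simp add: w_def field_simps)
  also have "\<dots> \<le> 2 * (\<kappa> / (1 + real m)) * s" using tk s by (intro mult_right_mono) auto
  finally show "\<alpha> / (2 * \<kappa>) * (1 + real m) \<le> s" using \<kappa> by (simp add: field_simps)
qed

lemma small_parameter:
  fixes \<alpha> :: real
  assumes "0 \<le> y" "y \<le> x" "0 < \<alpha>" "\<alpha> < min 1 (1 / (2 * (x + 1)))"
  shows "y * \<alpha>\<^sup>2 \<le> 1 / 2"
proof -
  have "\<alpha> \<le> 1 / (2 * (x + 1))" "2 * (x + 1) > 0" using assms by auto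
  then have "\<alpha> * (2 * (x + 1)) \<le> 1" by (simp only: pos_le_divide_eq)
  then have xa: "x * \<alpha> \<le> 1 / 2" using assms(3) by (simp add: algebra_simps)
  have "\<alpha> < 1" using assms(4) by simp
  then have "\<alpha>\<^sup>2 \<le> \<alpha>" using assms(3) by (simp add: power2_eq_square mult_left_le)
  then have "y * \<alpha>\<^sup>2 \<le> x * \<alpha>" using assms by (intro mult_mono) auto
  then show ?thesis using xa by linarith
qed

text \<open>Writing \<open>1 / sinh s\<close> as \<open>1 / s - csch_diff s\<close> splits the
  error. By the mean value theorem the \<open>csch_diff\<close> part is
  \<open>\<alpha> (S - \<sigma>)\<close> times \<open>csch_diff'\<close> at a point of the
  \<open>m\<close>-th cell, so it forms a Riemann sum. The rational part is of order
  \<open>\<alpha>\<^sup>2\<close> and decays like \<open>1 / (1 + m)\<^sup>2\<close>.\<close>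

lemma offset_constant_bound:
  fixes p q K :: real
  assumes pq: "p > 0" "q > 0" and K: "K \<ge> 0"
  obtains C \<alpha>0 where "C \<ge> 0" "\<alpha>0 > 0" "\<And>\<alpha> \<sigma> S. 0 < \<alpha> \<Longrightarrow> \<alpha> < \<alpha>0 \<Longrightarrow> 0 < \<sigma> \<Longrightarrow> \<sigma> \<le> S \<Longrightarrow>
    \<bar>\<sigma> / \<alpha> - p\<bar> \<le> K * \<alpha>\<^sup>2 \<Longrightarrow> \<bar>S / \<alpha> - q\<bar> \<le> K * \<alpha>\<^sup>2 \<Longrightarrow>
    sum_bound (\<lambda>m. (\<alpha> / sinh (\<sigma> + real m * S) - \<alpha> / sinh (S + real m * S)) -
      (1 / (p + real m * q) - 1 / (q + real m * q))) (C * \<alpha>\<^sup>2)"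
proof -
  obtain CR where CR: "CR > 0" "\<And>S \<xi>. 0 < S \<Longrightarrow> (\<And>m. \<xi> m > 0) \<Longrightarrow>
    (\<And>m. real m * S \<le> \<xi> m \<and> \<xi> m \<le> (real m + 1) * S) \<Longrightarrow> sum_bound (\<lambda>m. S * csch_diff' (\<xi> m)) (CR * S)"
    using csch_riemann_sum by metis
  define \<kappa>1 \<kappa>2 where "\<kappa>1 = 1 / p + 1 / q" and "\<kappa>2 = 1 / q + 1 / q"
  have \<kappa>: "\<kappa>1 > 0" "\<kappa>2 > 0" using pq by (auto simp: \<kappa>1_def \<kappa>2_def add_pos_pos)
  \<comment> \<open>\<open>8 * K\<close> is the error \<open>2 * K\<close> of
    \<open>(S - \<sigma>) / \<alpha>\<close>, doubled once for each factor of \<open>w * w'\<close>.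
    The bracket with \<kappa>1 and \<kappa>2 is the relative error of that product.\<close>
  define A where "A = (8 * K + \<bar>q - p\<bar> * (4 * K * \<kappa>1 + 2 * K * \<kappa>2)) * (\<kappa>1 * \<kappa>2)"
  define \<alpha>0 where "\<alpha>0 = min 1 (1 / (2 * (K * (\<kappa>1 + \<kappa>2) + 1)))"
  define C where "C = CR * (q + K) + A * zeta2"
  have a0: "\<alpha>0 > 0" using K \<kappa> by (auto simp: \<alpha>0_def intro!: add_nonneg_pos)
  have A0: "A \<ge> 0" unfolding A_def using K \<kappa> by (intro mult_nonneg_nonneg add_nonneg_nonneg) auto
  have C0: "C \<ge> 0" unfolding C_def using CR K pq zeta2_nonneg A0 by (intro add_nonneg_nonneg mult_nonneg_nonneg) auto
  have "sum_bound (\<lambda>m. (\<alpha> / sinh (\<sigma> + real m * S) - \<alpha> / sinh (S + real m * S)) -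
      (1 / (p + real m * q) - 1 / (q + real m * q))) (C * \<alpha>\<^sup>2)"
    if \<alpha>: "0 < \<alpha>" "\<alpha> < \<alpha>0" and \<sigma>: "0 < \<sigma>" "\<sigma> \<le> S"
      and h: "\<bar>\<sigma> / \<alpha> - p\<bar> \<le> K * \<alpha>\<^sup>2" "\<bar>S / \<alpha> - q\<bar> \<le> K * \<alpha>\<^sup>2" for \<alpha> \<sigma> S
  proof -
    have S: "S > 0" using \<sigma> by simp
    have a1: "\<alpha> < 1" using \<alpha> by (simp add: \<alpha>0_def)
    have small: "K * \<kappa>1 * \<alpha>\<^sup>2 \<le> 1 / 2" "K * \<kappa>2 * \<alpha>\<^sup>2 \<le> 1 / 2"
    proof -
      have "K * \<kappa>1 \<le> K * (\<kappa>1 + \<kappa>2)" "K * \<kappa>2 \<le> K * (\<kappa>1 + \<kappa>2)" using K \<kappa> by (auto intro!: mult_left_mono)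
      then show "K * \<kappa>1 * \<alpha>\<^sup>2 \<le> 1 / 2" "K * \<kappa>2 * \<alpha>\<^sup>2 \<le> 1 / 2"
        using small_parameter[of "K * \<kappa>1" "K * (\<kappa>1 + \<kappa>2)" \<alpha>] small_parameter[of "K * \<kappa>2" "K * (\<kappa>1 + \<kappa>2)" \<alpha>]
          K \<kappa> \<alpha> unfolding \<alpha>0_def by auto
    qed
    define s s' where "s m = \<sigma> + real m * S" and "s' m = S + real m * S" for m
    define t t' where "t m = 1 / (p + real m * q)" and "t' m = 1 / (q + real m * q)" for m
    note o = offset_comparison[OF pq \<alpha>(1) \<sigma>(1) h(1) S h(2) small(1)[unfolded \<kappa>1_def], folded s_def t_def \<kappa>1_def]
    note o' = offset_comparison[OF pq(2) pq(2) \<alpha>(1) S h(2) S h(2) small(2)[unfolded \<kappa>2_def], folded s'_def t'_def \<kappa>2_def]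
    have ss': "s m \<le> s' m" "s' m - s m = S - \<sigma>" for m using \<sigma> by (simp_all add: s_def s'_def)
    have "\<exists>\<xi>. s m \<le> \<xi> \<and> \<xi> \<le> s' m \<and> csch_diff (s' m) - csch_diff (s m) = (s' m - s m) * csch_diff' \<xi>" for m
    proof (cases "s m < s' m")
      case True
      have "\<exists>z>s m. z < s' m \<and> csch_diff (s' m) - csch_diff (s m) = (s' m - s m) * csch_diff' z"
        by (rule MVT2[OF True]) (use o(1)[of m] in \<open>auto intro!: csch_diff_derivative\<close>)
      then show ?thesis by (meson less_imp_le)
    next
      case False
      then have "s m = s' m" using ss'(1)[of m] by simp
      then show ?thesis by auto
    qed
    then obtain \<xi> where \<xi>: "\<And>m. s m \<le> \<xi> m" "\<And>m. \<xi> m \<le> s' m"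
      "\<And>m. csch_diff (s' m) - csch_diff (s m) = (s' m - s m) * csch_diff' (\<xi> m)" by metis
    have r: "sum_bound (\<lambda>m. S * csch_diff' (\<xi> m)) (CR * S)"
    proof (rule CR(2)[OF S])
      show "\<xi> m > 0" for m using \<xi>(1)[of m] o(1)[of m] by linarith
      show "real m * S \<le> \<xi> m \<and> \<xi> m \<le> (real m + 1) * S" for m
        using \<xi>(1,2)[of m] \<sigma> by (simp add: s_def s'_def algebra_simps)
    qed
    have r1: "sum_bound (\<lambda>m. \<alpha> * ((S - \<sigma>) / S) * (S * csch_diff' (\<xi> m))) (CR * (q + K) * \<alpha>\<^sup>2)"
    proof (rule sum_bound_mono[OF sum_bound_cmult[OF r]])
      have "\<bar>\<alpha> * ((S - \<sigma>) / S)\<bar> * (CR * S) = \<alpha> * CR * (S - \<sigma>)" using \<alpha> S \<sigma> by simp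
      also have "\<dots> \<le> \<alpha> * CR * S" using \<alpha> CR \<sigma> by (intro mult_left_mono) auto
      also have "\<dots> \<le> \<alpha> * CR * ((q + K) * \<alpha>)"
      proof (rule mult_left_mono)
        have "\<alpha>\<^sup>2 \<le> 1" using \<alpha>(1) a1 by (simp add: power_le_one)
        then have "K * \<alpha>\<^sup>2 \<le> K * 1" using K by (intro mult_left_mono) auto
        then have "S / \<alpha> \<le> q + K" using h(2) by linarith
        then show "S \<le> (q + K) * \<alpha>" using \<alpha>(1) by (simp add: pos_divide_le_eq)
      qed (use \<alpha> CR in simp)
      also have "\<dots> = CR * (q + K) * \<alpha>\<^sup>2" by (simp add: power2_eq_square)
      finally show "\<bar>\<alpha> * ((S - \<sigma>) / S)\<bar> * (CR * S) \<le> CR * (q + K) * \<alpha>\<^sup>2" .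
    qed
    define e where "e m = (\<alpha> / s m - \<alpha> / s' m) - (t m - t' m)" for m
    have r2: "sum_bound e (A * \<alpha>\<^sup>2 * zeta2)"
    proof (rule sum_bound_square)
      fix m
      define w w' where "w = \<alpha> / s m" and "w' = \<alpha> / s' m"
      have w: "0 < w" "0 < w'" "w \<le> 2 * t m" "w' \<le> 2 * t' m"
        using o(1,5)[of m] o'(1,5)[of m] \<alpha> by (auto simp: w_def w'_def)
      have tt: "0 < t m" "0 < t' m" using o(2) o'(2) by auto
      have "t m - t' m = (q - p) * (t m * t' m)"
      proof -
        have "p + real m * q > 0" "q + real m * q > 0" using pq by (auto intro: add_pos_nonneg)
        then show ?thesis by (simp add: t_def t'_def field_simps)
      qed
      moreover have "w - w' = (S - \<sigma>) / \<alpha> * (w * w')"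
        unfolding ss'(2)[of m, symmetric] using o(1)[of m] o'(1)[of m] \<alpha> by (simp add: w_def w'_def field_simps)
      ultimately have "e m = ((S - \<sigma>) / \<alpha> - (q - p)) * (w * w') + (q - p) * (w * w' - t m * t' m)"
        unfolding e_def w_def[symmetric] w'_def[symmetric] by (simp add: algebra_simps)
      moreover have "\<bar>(S - \<sigma>) / \<alpha> - (q - p)\<bar> \<le> 2 * K * \<alpha>\<^sup>2"
        using h by (simp add: diff_divide_distrib)
      moreover have "w * w' \<le> (2 * t m) * (2 * t' m)" using w tt by (intro mult_mono) auto
      moreover have "\<bar>w * w' - t m * t' m\<bar> \<le> (4 * K * \<kappa>1 + 2 * K * \<kappa>2) * \<alpha>\<^sup>2 * (t m * t' m)"
      proof -
        have "w * w' - t m * t' m = (w - t m) * w' + t m * (w' - t' m)" by (simp add: algebra_simps)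
        then have "\<bar>w * w' - t m * t' m\<bar> \<le> \<bar>w - t m\<bar> * w' + t m * \<bar>w' - t' m\<bar>"
          using w tt abs_triangle_ineq[of "(w - t m) * w'" "t m * (w' - t' m)"] by (simp add: abs_mult)
        also have "\<dots> \<le> (2 * (K * \<kappa>1 * \<alpha>\<^sup>2) * t m) * (2 * t' m) + t m * (2 * (K * \<kappa>2 * \<alpha>\<^sup>2) * t' m)"
          using o(6)[of m] o'(6)[of m] w tt K \<kappa>
          by (intro add_mono mult_mono mult_left_mono) (auto simp: w_def w'_def)
        finally show ?thesis by (simp add: algebra_simps)
      qed
      ultimately have "\<bar>e m\<bar> \<le> (2 * K * \<alpha>\<^sup>2) * ((2 * t m) * (2 * t' m)) +
          \<bar>q - p\<bar> * ((4 * K * \<kappa>1 + 2 * K * \<kappa>2) * \<alpha>\<^sup>2 * (t m * t' m))"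
      proof -
        assume e: "e m = ((S - \<sigma>) / \<alpha> - (q - p)) * (w * w') + (q - p) * (w * w' - t m * t' m)"
          and b: "\<bar>(S - \<sigma>) / \<alpha> - (q - p)\<bar> \<le> 2 * K * \<alpha>\<^sup>2" "w * w' \<le> (2 * t m) * (2 * t' m)"
          "\<bar>w * w' - t m * t' m\<bar> \<le> (4 * K * \<kappa>1 + 2 * K * \<kappa>2) * \<alpha>\<^sup>2 * (t m * t' m)"
        have "\<bar>e m\<bar> \<le> \<bar>(S - \<sigma>) / \<alpha> - (q - p)\<bar> * (w * w') + \<bar>q - p\<bar> * \<bar>w * w' - t m * t' m\<bar>"
          unfolding e using w by (metis abs_mult abs_of_pos abs_triangle_ineq mult_pos_pos)
        also have "\<dots> \<le> (2 * K * \<alpha>\<^sup>2) * ((2 * t m) * (2 * t' m)) +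
          \<bar>q - p\<bar> * ((4 * K * \<kappa>1 + 2 * K * \<kappa>2) * \<alpha>\<^sup>2 * (t m * t' m))"
          using b w K by (intro add_mono mult_mono) auto
        finally show ?thesis .
      qed
      also have "\<dots> = (8 * K + \<bar>q - p\<bar> * (4 * K * \<kappa>1 + 2 * K * \<kappa>2)) * \<alpha>\<^sup>2 * (t m * t' m)"
        by (simp add: algebra_simps)
      also have "\<dots> \<le> (8 * K + \<bar>q - p\<bar> * (4 * K * \<kappa>1 + 2 * K * \<kappa>2)) * \<alpha>\<^sup>2 *
          (\<kappa>1 / (1 + real m) * (\<kappa>2 / (1 + real m)))"
        using o(3)[of m] o'(3)[of m] tt K \<kappa> by (intro mult_left_mono mult_mono) auto
      also have "\<dots> = A * \<alpha>\<^sup>2 / (1 + real m)\<^sup>2" by (simp add: A_def power2_eq_square)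
      finally show "\<bar>e m\<bar> \<le> A * \<alpha>\<^sup>2 / (1 + real m)\<^sup>2" .
    qed
    have "sum_bound (\<lambda>m. \<alpha> * ((S - \<sigma>) / S) * (S * csch_diff' (\<xi> m)) + e m) (CR * (q + K) * \<alpha>\<^sup>2 + A * \<alpha>\<^sup>2 * zeta2)"
      by (rule sum_bound_add[OF r1 r2])
    then show ?thesis
    proof (rule sum_bound_cong)
      fix m
      have "\<alpha> * ((S - \<sigma>) / S) * (S * csch_diff' (\<xi> m)) = \<alpha> * (csch_diff (s' m) - csch_diff (s m))"
        unfolding \<xi>(3) ss'(2) using S by simp
      then show "\<alpha> * ((S - \<sigma>) / S) * (S * csch_diff' (\<xi> m)) + e m =
          (\<alpha> / sinh (\<sigma> + real m * S) - \<alpha> / sinh (S + real m * S)) - (1 / (p + real m * q) - 1 / (q + real m * q))"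
        unfolding s_def[symmetric] s'_def[symmetric] t_def[symmetric] t'_def[symmetric] e_def csch_diff_def
        by (simp add: right_diff_distrib)
    qed (simp add: C_def algebra_simps)
  qed
  then show ?thesis using that C0 a0 by blast
qed

text \<open>Strength times \<open>g - g 0\<close> is a linear term, \<open>\<tau> * c 1\<close>
  times \<open>\<alpha>\<^sup>2 cosh s / (sinh s)\<^sup>2\<close>, plus a cubic term with the
  remainder \<open>L\<close>. The linear error is a Riemann sum plus \<open>e1\<close>. In the cubic
  term \<open>e3\<close> replaces the hyperbolic factor by \<open>1 / s ^ 3\<close>, and
  \<open>e2\<close> accounts for the passage from there to the limit \<open>t\<close>.\<close>

lemma offset_power_series_bound:
  fixes p q K :: real and c :: "nat \<Rightarrow> real"
  assumes pq: "p > 0" "q > 0" and K: "K \<ge> 0" and g: "\<And>t. (\<lambda>k. c k * t ^ k) sums g t"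
  obtains C \<alpha>0 where "C \<ge> 0" "\<alpha>0 > 0" "\<And>\<alpha> \<sigma> S \<tau>. 0 < \<alpha> \<Longrightarrow> \<alpha> < \<alpha>0 \<Longrightarrow> 0 < \<sigma> \<Longrightarrow> \<sigma> \<le> S \<Longrightarrow> \<bar>\<tau>\<bar> = 1 \<Longrightarrow>
    \<bar>\<sigma> / \<alpha> - p\<bar> \<le> K * \<alpha>\<^sup>2 \<Longrightarrow> \<bar>S / \<alpha> - q\<bar> \<le> K * \<alpha>\<^sup>2 \<Longrightarrow>
    sum_bound (\<lambda>m. \<alpha> / sinh (\<sigma> + real m * S) *
        (g (\<tau> * (\<alpha> * cosh (\<sigma> + real m * S) / sinh (\<sigma> + real m * S))) - g 0) -
      1 / (p + real m * q) * (g (\<tau> * (1 / (p + real m * q))) - g 0)) (C * (\<alpha>\<^sup>2 * (1 + \<bar>ln \<alpha>\<bar>)))"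
proof -
  obtain CR where CR: "CR > 0" "\<And>S \<xi>. 0 < S \<Longrightarrow> (\<And>m. \<xi> m > 0) \<Longrightarrow>
    (\<And>m. real m * S \<le> \<xi> m \<and> \<xi> m \<le> (real m + 1) * S) \<Longrightarrow> sum_bound (\<lambda>m. S * csch_diff' (\<xi> m)) (CR * S)"
    using csch_riemann_sum by metis
  obtain B where "csch_bound B" by (rule csch_bound_exists)
  note B = csch_boundD[OF this]
  obtain L where L: "\<And>t. g t = g 0 + c 1 * t + t\<^sup>2 * L t"
    "\<And>M. \<exists>B>0. \<forall>x y. \<bar>x\<bar> \<le> M \<longrightarrow> \<bar>y\<bar> \<le> M \<longrightarrow> \<bar>L x\<bar> \<le> B \<and> \<bar>L x - L y\<bar> \<le> B * \<bar>x - y\<bar>"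
    using power_series_quadratic_remainder[OF g] by metis
  define \<kappa> where "\<kappa> = 1 / p + 1 / q"
  have \<kappa>: "\<kappa> > 0" using pq by (auto simp: \<kappa>_def add_pos_pos)
  \<comment> \<open>Bounds the three arguments at which \<open>L\<close> is evaluated:
    \<open>t\<close> and \<open>w\<close> are at most \<open>2 * \<kappa>\<close>, and the true
    position differs from \<open>w\<close> by at most \<open>B\<close>.\<close>
  define M where "M = 2 * \<kappa> + B"
  obtain D where D: "D > 0" "\<And>x. \<bar>x\<bar> \<le> M \<Longrightarrow> \<bar>L x\<bar> \<le> D"
    "\<And>x y. \<bar>x\<bar> \<le> M \<Longrightarrow> \<bar>y\<bar> \<le> M \<Longrightarrow> \<bar>L x - L y\<bar> \<le> D * \<bar>x - y\<bar>"
    using L(2)[of M] by blast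
  define \<alpha>0 where "\<alpha>0 = min 1 (1 / (2 * (K * \<kappa> + 1)))"
  have a0: "\<alpha>0 > 0" using K \<kappa> by (auto simp: \<alpha>0_def intro!: add_nonneg_pos)
  \<comment> \<open>With \<open>\<bar>w - t\<bar> \<le> 2 * \<delta> * t\<close> and
    \<open>w \<le> 2 * t\<close>, the factor 6 is \<open>2 * (2 + 1)\<close> from
    \<open>w\<^sup>2 - t\<^sup>2\<close>, and 14 is \<open>2 * (4 + 2 + 1)\<close> from
    \<open>w ^ 3 - t ^ 3\<close>.\<close>
  define E where "E = \<bar>c 1\<bar> * (6 * K * \<kappa>) + (4 * B * D + 14 * K * \<kappa> * D * \<kappa> + 2 * K * \<kappa> * D * \<kappa>\<^sup>2)"
  define C where "C = \<bar>c 1\<bar> * CR + E * \<kappa>\<^sup>2 * zeta2 + D * B * (2 * \<kappa>) * (1 + ln (1 + 4 * \<kappa>\<^sup>2))"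
  have E0: "E \<ge> 0" unfolding E_def using K \<kappa> B(1) D(1) by (intro add_nonneg_nonneg mult_nonneg_nonneg) auto
  have C0: "C \<ge> 0" unfolding C_def using E0 CR(1) \<kappa> B(1) D(1) zeta2_nonneg
    by (intro add_nonneg_nonneg mult_nonneg_nonneg ln_ge_zero) auto
  have "sum_bound (\<lambda>m. \<alpha> / sinh (\<sigma> + real m * S) *
        (g (\<tau> * (\<alpha> * cosh (\<sigma> + real m * S) / sinh (\<sigma> + real m * S))) - g 0) -
      1 / (p + real m * q) * (g (\<tau> * (1 / (p + real m * q))) - g 0)) (C * (\<alpha>\<^sup>2 * (1 + \<bar>ln \<alpha>\<bar>)))"
    if \<alpha>: "0 < \<alpha>" "\<alpha> < \<alpha>0" and \<sigma>: "0 < \<sigma>" "\<sigma> \<le> S" and \<tau>: "\<bar>\<tau>\<bar> = 1"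
      and h: "\<bar>\<sigma> / \<alpha> - p\<bar> \<le> K * \<alpha>\<^sup>2" "\<bar>S / \<alpha> - q\<bar> \<le> K * \<alpha>\<^sup>2" for \<alpha> \<sigma> S \<tau>
  proof -
    have S: "S > 0" using \<sigma> by simp
    have a1: "\<alpha> < 1" using \<alpha> by (simp add: \<alpha>0_def)
    have small: "K * \<kappa> * \<alpha>\<^sup>2 \<le> 1 / 2"
      by (rule small_parameter[OF _ order_refl \<alpha>(1) \<alpha>(2)[unfolded \<alpha>0_def]]) (use K \<kappa> in simp)
    have \<tau>2: "\<tau>\<^sup>2 = 1" using \<tau> by (metis power2_abs power_one)
    define s where "s m = \<sigma> + real m * S" for m
    define t where "t m = 1 / (p + real m * q)" for m
    define x where "x m = \<alpha> * cosh (s m) / sinh (s m)" for m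
    define w where "w m = \<alpha> / s m" for m
    define \<delta> where "\<delta> = K * \<kappa> * \<alpha>\<^sup>2"
    note o = offset_comparison[OF pq \<alpha>(1) \<sigma>(1) h(1) S h(2) small[unfolded \<kappa>_def], folded s_def t_def \<kappa>_def, folded w_def \<delta>_def]
    have \<delta>0: "\<delta> \<ge> 0" using K \<kappa> by (simp add: \<delta>_def)
    have w0: "w m > 0" for m using o(1)[of m] \<alpha> by (simp add: w_def)
    have t0: "t m > 0" for m by (rule o(2))
    have xw: "\<bar>x m - w m\<bar> \<le> \<alpha> * (B * s m)" "\<bar>x m - w m\<bar> \<le> B" for m
    proof -
      have e: "x m - w m = \<alpha> * (cosh (s m) / sinh (s m) - 1 / s m)" by (simp add: x_def w_def right_diff_distrib)
      show "\<bar>x m - w m\<bar> \<le> \<alpha> * (B * s m)" unfolding e abs_mult using B(6)[OF o(1), of m] \<alpha> by simp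
      have "\<alpha> * \<bar>cosh (s m) / sinh (s m) - 1 / s m\<bar> \<le> 1 * B" using B(1) B(7)[OF o(1), of m] \<alpha> a1 by (intro mult_mono) auto
      then show "\<bar>x m - w m\<bar> \<le> B" unfolding e abs_mult using \<alpha> by simp
    qed
    have tk: "t m \<le> \<kappa>" for m by (rule o(4))
    have inM: "\<bar>\<tau> * x m\<bar> \<le> M" "\<bar>\<tau> * w m\<bar> \<le> M" "\<bar>\<tau> * t m\<bar> \<le> M" for m
      using xw(2)[of m] o(5)[of m] tk[of m] w0[of m] t0[of m] B(1) \<tau> by (auto simp: abs_mult M_def)
    have sq: "(t m)\<^sup>2 \<le> \<kappa>\<^sup>2 / (1 + real m)\<^sup>2" for m
      using power_mono[OF o(3)[of m], of 2] t0[of m] by (simp add: power_divide)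
    have r1: "sum_bound (\<lambda>m. c 1 * \<tau> * (\<alpha>\<^sup>2 / S) * (S * csch_diff' (s m))) (\<bar>c 1\<bar> * CR * \<alpha>\<^sup>2)"
    proof (rule sum_bound_mono[OF sum_bound_cmult])
      show "sum_bound (\<lambda>m. S * csch_diff' (s m)) (CR * S)"
        by (rule CR(2)[OF S]) (use o(1) \<sigma> in \<open>auto simp: s_def algebra_simps\<close>)
      show "\<bar>c 1 * \<tau> * (\<alpha>\<^sup>2 / S)\<bar> * (CR * S) \<le> \<bar>c 1\<bar> * CR * \<alpha>\<^sup>2" using \<tau> S by (simp add: abs_mult)
    qed
    have wt2: "\<bar>(w m)\<^sup>2 - (t m)\<^sup>2\<bar> \<le> 6 * \<delta> * (t m)\<^sup>2" for m
    proof -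
      have "\<bar>(w m)\<^sup>2 - (t m)\<^sup>2\<bar> = \<bar>w m - t m\<bar> * (w m + t m)"
        using w0[of m] t0[of m] by (simp add: power2_eq_square square_diff_square_factored abs_mult mult.commute)
      also have "\<dots> \<le> (2 * \<delta> * t m) * (2 * t m + t m)"
        using o(5,6)[of m] w0[of m] t0[of m] \<delta>0 by (intro mult_mono) auto
      finally show ?thesis by (simp add: power2_eq_square)
    qed
    define e1 where "e1 m = c 1 * \<tau> * ((w m)\<^sup>2 - (t m)\<^sup>2)" for m
    define e2 where "e2 m = (w m) ^ 3 * (L (\<tau> * x m) - L (\<tau> * w m)) + ((w m) ^ 3 * L (\<tau> * w m) - (t m) ^ 3 * L (\<tau> * t m))" for m
    define e3 where "e3 m = \<alpha> ^ 3 * ((cosh (s m))\<^sup>2 / sinh (s m) ^ 3 - 1 / s m ^ 3) * L (\<tau> * x m)" for m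
    have r2: "sum_bound (\<lambda>m. e1 m + e2 m) (E * \<alpha>\<^sup>2 * \<kappa>\<^sup>2 * zeta2)"
    proof (rule sum_bound_square)
      fix m
      have 1: "\<bar>e1 m\<bar> \<le> \<bar>c 1\<bar> * (6 * \<delta> * (t m)\<^sup>2)"
        unfolding e1_def abs_mult \<tau> using wt2[of m] by (simp add: mult_left_mono)
      have 2: "\<bar>(w m) ^ 3 * (L (\<tau> * x m) - L (\<tau> * w m))\<bar> \<le> 4 * B * D * \<alpha>\<^sup>2 * (t m)\<^sup>2"
      proof -
        have "\<bar>(w m) ^ 3 * (L (\<tau> * x m) - L (\<tau> * w m))\<bar> \<le> (w m) ^ 3 * (D * \<bar>\<tau> * x m - \<tau> * w m\<bar>)"
          unfolding abs_mult using w0[of m] D(3)[OF inM(1,2)] by (simp add: mult_left_mono)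
        also have "\<bar>\<tau> * x m - \<tau> * w m\<bar> = \<bar>x m - w m\<bar>"
          unfolding right_diff_distrib[symmetric] abs_mult \<tau> by simp
        also have "(w m) ^ 3 * (D * \<bar>x m - w m\<bar>) \<le> (w m) ^ 3 * (D * (\<alpha> * (B * s m)))"
          using xw(1)[of m] w0[of m] D(1) by (intro mult_left_mono) auto
        also have "\<dots> = D * B * \<alpha>\<^sup>2 * (w m)\<^sup>2"
          using o(1)[of m] by (simp add: w_def power3_eq_cube power2_eq_square)
        also have "\<dots> \<le> D * B * \<alpha>\<^sup>2 * (2 * t m)\<^sup>2"
          using D(1) B(1) w0[of m] o(5)[of m] by (intro mult_left_mono power_mono) auto
        finally show ?thesis by (simp add: power_mult_distrib mult_ac)
      qed
      have 3: "\<bar>(w m) ^ 3 * L (\<tau> * w m) - (t m) ^ 3 * L (\<tau> * t m)\<bar> \<le> (14 * \<delta> * \<kappa> * D + 2 * \<delta> * D * \<kappa>\<^sup>2) * (t m)\<^sup>2"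
      proof -
        have "(w m) ^ 3 * L (\<tau> * w m) - (t m) ^ 3 * L (\<tau> * t m) =
          ((w m) ^ 3 - (t m) ^ 3) * L (\<tau> * w m) + (t m) ^ 3 * (L (\<tau> * w m) - L (\<tau> * t m))"
          by (simp add: algebra_simps)
        then have "\<bar>(w m) ^ 3 * L (\<tau> * w m) - (t m) ^ 3 * L (\<tau> * t m)\<bar> \<le>
          \<bar>(w m) ^ 3 - (t m) ^ 3\<bar> * \<bar>L (\<tau> * w m)\<bar> + (t m) ^ 3 * \<bar>L (\<tau> * w m) - L (\<tau> * t m)\<bar>"
          using t0[of m] abs_triangle_ineq[of "((w m) ^ 3 - (t m) ^ 3) * L (\<tau> * w m)" "(t m) ^ 3 * (L (\<tau> * w m) - L (\<tau> * t m))"]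
          by (simp add: abs_mult)
        also have "\<dots> \<le> (14 * \<delta> * \<kappa> * (t m)\<^sup>2) * D + (t m) ^ 3 * (D * (2 * \<delta> * t m))"
        proof (intro add_mono mult_mono mult_left_mono)
          have "(w m) ^ 3 - (t m) ^ 3 = (w m - t m) * ((w m)\<^sup>2 + w m * t m + (t m)\<^sup>2)"
            by (simp add: power2_eq_square power3_eq_cube algebra_simps)
          then have "\<bar>(w m) ^ 3 - (t m) ^ 3\<bar> = \<bar>w m - t m\<bar> * ((w m)\<^sup>2 + w m * t m + (t m)\<^sup>2)"
            using w0[of m] t0[of m] by (simp add: abs_mult)
          also have "\<dots> \<le> (2 * \<delta> * t m) * ((2 * t m)\<^sup>2 + (2 * t m) * t m + (t m)\<^sup>2)"
            using o(5,6)[of m] w0[of m] t0[of m] \<delta>0 by (intro mult_mono add_mono power_mono) auto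
          also have "\<dots> = 14 * \<delta> * t m * (t m)\<^sup>2" by (simp add: power2_eq_square)
          also have "\<dots> \<le> 14 * \<delta> * \<kappa> * (t m)\<^sup>2" using tk[of m] \<delta>0 by (intro mult_right_mono mult_left_mono) auto
          finally show "\<bar>(w m) ^ 3 - (t m) ^ 3\<bar> \<le> 14 * \<delta> * \<kappa> * (t m)\<^sup>2" .
          show "\<bar>L (\<tau> * w m)\<bar> \<le> D" by (rule D(2)[OF inM(2)])
          have "\<bar>L (\<tau> * w m) - L (\<tau> * t m)\<bar> \<le> D * \<bar>\<tau> * w m - \<tau> * t m\<bar>" by (rule D(3)[OF inM(2,3)])
          also have "\<bar>\<tau> * w m - \<tau> * t m\<bar> = \<bar>w m - t m\<bar>"
            unfolding right_diff_distrib[symmetric] abs_mult \<tau> by simp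
          also have "D * \<bar>w m - t m\<bar> \<le> D * (2 * \<delta> * t m)" using o(6)[of m] D(1) by (intro mult_left_mono) auto
          finally show "\<bar>L (\<tau> * w m) - L (\<tau> * t m)\<bar> \<le> D * (2 * \<delta> * t m)" .
        qed (use \<delta>0 \<kappa> t0[of m] in auto)
        also have "(t m) ^ 3 * (D * (2 * \<delta> * t m)) = 2 * \<delta> * D * (t m)\<^sup>2 * (t m)\<^sup>2"
          by (simp add: power2_eq_square power3_eq_cube)
        also have "\<dots> \<le> 2 * \<delta> * D * \<kappa>\<^sup>2 * (t m)\<^sup>2"
          using tk[of m] t0[of m] D(1) \<delta>0 by (intro mult_right_mono mult_left_mono power_mono) auto
        finally show ?thesis by (simp add: algebra_simps)
      qed
      have "\<bar>e1 m + e2 m\<bar> \<le> \<bar>c 1\<bar> * (6 * \<delta> * (t m)\<^sup>2) + (4 * B * D * \<alpha>\<^sup>2 * (t m)\<^sup>2 +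
          (14 * \<delta> * \<kappa> * D + 2 * \<delta> * D * \<kappa>\<^sup>2) * (t m)\<^sup>2)"
        unfolding e2_def using 1 2 3 by linarith
      also have "\<dots> = E * \<alpha>\<^sup>2 * (t m)\<^sup>2" by (simp add: E_def \<delta>_def algebra_simps)
      also have "\<dots> \<le> E * \<alpha>\<^sup>2 * (\<kappa>\<^sup>2 / (1 + real m)\<^sup>2)" using E0 sq[of m] by (intro mult_left_mono) auto
      finally show "\<bar>e1 m + e2 m\<bar> \<le> E * \<alpha>\<^sup>2 * \<kappa>\<^sup>2 / (1 + real m)\<^sup>2" by simp
    qed
    \<comment> \<open>Chosen so that \<open>hh * (m + 1) \<le> s m\<close>, by the last part of
      \<open>offset_comparison\<close>.\<close>
    define hh where "hh = \<alpha> / (2 * \<kappa>)"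
    have hh: "hh > 0" using \<alpha> \<kappa> by (simp add: hh_def)
    have r3: "sum_bound e3 (\<alpha> ^ 3 * B * D * ((1 + ln (1 + 1 / hh\<^sup>2) / 2) / hh))"
    proof (rule sum_bound_partial)
      fix m
      have hs: "hh * real (Suc m) \<le> s m" using o(7)[of m] by (simp add: hh_def add.commute)
      have hp: "hh * real (Suc m) > 0" using hh by simp
      have "\<bar>e3 m\<bar> \<le> \<alpha> ^ 3 * (B / (s m * (1 + (s m)\<^sup>2))) * D"
        unfolding e3_def abs_mult using \<alpha> B(1) B(5)[OF o(1), of m] D(2)[OF inM(1), of m] o(1)[of m]
        by (intro mult_mono) (auto intro!: divide_nonneg_nonneg mult_nonneg_nonneg)
      also have "\<dots> \<le> \<alpha> ^ 3 * (B / ((hh * real (Suc m)) * (1 + (hh * real (Suc m))\<^sup>2))) * D"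
      proof (intro mult_right_mono mult_left_mono divide_left_mono mult_mono add_mono power_mono hs)
        show "0 < s m * (1 + (s m)\<^sup>2) * (hh * real (Suc m) * (1 + (hh * real (Suc m))\<^sup>2))"
          using o(1)[of m] hh by (intro mult_pos_pos add_pos_nonneg) auto
      qed (use \<alpha> B(1) D(1) hp o(1)[of m] hh in \<open>auto intro: less_imp_le\<close>)
      finally show "\<bar>e3 m\<bar> \<le> \<alpha> ^ 3 * B * D * (1 / ((hh * real (Suc m)) * (1 + (hh * real (Suc m))\<^sup>2)))"
        by (simp add: mult_ac)
    next
      fix n
      show "(\<Sum>m<n. \<alpha> ^ 3 * B * D * (1 / ((hh * real (Suc m)) * (1 + (hh * real (Suc m))\<^sup>2))))
          \<le> \<alpha> ^ 3 * B * D * ((1 + ln (1 + 1 / hh\<^sup>2) / 2) / hh)"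
        unfolding sum_distrib_left[symmetric] using \<alpha> B(1) D(1)
        by (intro mult_left_mono sum_inverse_cubic_bound[OF hh]) auto
    qed
    \<comment> \<open>Dividing by \<open>hh\<close> costs one power of \<alpha>, and the logarithm
      of \<open>1 + 1 / hh\<^sup>2\<close> is at most \<open>2 * \<bar>ln \<alpha>\<bar>\<close>
      plus a constant. This is the origin of the logarithm in the final error.\<close>
    have "\<alpha> ^ 3 * B * D * ((1 + ln (1 + 1 / hh\<^sup>2) / 2) / hh) \<le> D * B * (2 * \<kappa>) * (1 + ln (1 + 4 * \<kappa>\<^sup>2)) * (\<alpha>\<^sup>2 * (1 + \<bar>ln \<alpha>\<bar>))"
    proof -
      have la: "\<bar>ln \<alpha>\<bar> = - ln \<alpha>" using \<alpha>(1) a1 by (simp add: abs_if)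
      have "1 + 1 / hh\<^sup>2 \<le> (1 + 4 * \<kappa>\<^sup>2) / \<alpha>\<^sup>2"
        using \<alpha>(1) a1 \<kappa> by (simp add: hh_def power_divide power_mult_distrib add_divide_distrib power_le_one)
      then have "ln (1 + 1 / hh\<^sup>2) \<le> ln ((1 + 4 * \<kappa>\<^sup>2) / \<alpha>\<^sup>2)"
        using \<alpha>(1) by (subst ln_le_cancel_iff) (auto intro!: add_pos_nonneg divide_pos_pos)
      also have "\<dots> = ln (1 + 4 * \<kappa>\<^sup>2) - 2 * ln \<alpha>"
      proof -
        have "1 + 4 * \<kappa>\<^sup>2 > 0" by (simp add: add_pos_nonneg)
        then show ?thesis using \<alpha>(1) by (simp add: ln_div ln_realpow)
      qed
      finally have l1: "ln (1 + 1 / hh\<^sup>2) \<le> ln (1 + 4 * \<kappa>\<^sup>2) + 2 * \<bar>ln \<alpha>\<bar>" using la by simp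
      define k where "k = ln (1 + 4 * \<kappa>\<^sup>2)"
      have k: "k \<ge> 0" unfolding k_def by (intro ln_ge_zero) auto
      have "1 + ln (1 + 1 / hh\<^sup>2) / 2 \<le> 1 + k / 2 + \<bar>ln \<alpha>\<bar>" using l1 by (simp add: k_def)
      also have "\<dots> \<le> (1 + k) * (1 + \<bar>ln \<alpha>\<bar>)" using k by (simp add: algebra_simps)
      finally have "1 + ln (1 + 1 / hh\<^sup>2) / 2 \<le> (1 + k) * (1 + \<bar>ln \<alpha>\<bar>)" .
      then have le: "\<alpha> ^ 3 * B * D / hh * (1 + ln (1 + 1 / hh\<^sup>2) / 2) \<le> \<alpha> ^ 3 * B * D / hh * ((1 + k) * (1 + \<bar>ln \<alpha>\<bar>))"
        using \<alpha> B(1) D(1) hh by (intro mult_left_mono) auto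
      have c: "\<alpha> ^ 3 * B * D / hh = D * B * (2 * \<kappa>) * \<alpha>\<^sup>2"
        using \<alpha> \<kappa> by (simp add: hh_def power2_eq_square power3_eq_cube)
      have "\<alpha> ^ 3 * B * D * ((1 + ln (1 + 1 / hh\<^sup>2) / 2) / hh) = \<alpha> ^ 3 * B * D / hh * (1 + ln (1 + 1 / hh\<^sup>2) / 2)"
        by simp
      also note le
      also have "\<alpha> ^ 3 * B * D / hh * ((1 + k) * (1 + \<bar>ln \<alpha>\<bar>)) = D * B * (2 * \<kappa>) * (1 + k) * (\<alpha>\<^sup>2 * (1 + \<bar>ln \<alpha>\<bar>))"
        unfolding c by (simp only: mult_ac)
      finally show ?thesis unfolding k_def .
    qed
    then have r3': "sum_bound e3 (D * B * (2 * \<kappa>) * (1 + ln (1 + 4 * \<kappa>\<^sup>2)) * (\<alpha>\<^sup>2 * (1 + \<bar>ln \<alpha>\<bar>)))"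
      by (rule sum_bound_mono[OF r3])
    have r12: "sum_bound (\<lambda>m. c 1 * \<tau> * (\<alpha>\<^sup>2 / S) * (S * csch_diff' (s m)) + (e1 m + e2 m))
        ((\<bar>c 1\<bar> * CR + E * \<kappa>\<^sup>2 * zeta2) * (\<alpha>\<^sup>2 * (1 + \<bar>ln \<alpha>\<bar>)))"
    proof (rule sum_bound_mono[OF sum_bound_add[OF r1 r2]])
      have "0 \<le> \<bar>c 1\<bar> * CR + E * \<kappa>\<^sup>2 * zeta2" using CR(1) E0 zeta2_nonneg by (intro add_nonneg_nonneg mult_nonneg_nonneg) auto
      then have "(\<bar>c 1\<bar> * CR + E * \<kappa>\<^sup>2 * zeta2) * (\<alpha>\<^sup>2 * 1) \<le> (\<bar>c 1\<bar> * CR + E * \<kappa>\<^sup>2 * zeta2) * (\<alpha>\<^sup>2 * (1 + \<bar>ln \<alpha>\<bar>))"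
        by (intro mult_left_mono) auto
      then show "\<bar>c 1\<bar> * CR * \<alpha>\<^sup>2 + E * \<alpha>\<^sup>2 * \<kappa>\<^sup>2 * zeta2 \<le> (\<bar>c 1\<bar> * CR + E * \<kappa>\<^sup>2 * zeta2) * (\<alpha>\<^sup>2 * (1 + \<bar>ln \<alpha>\<bar>))"
        by (simp add: algebra_simps)
    qed
    show ?thesis
    proof (rule sum_bound_cong[OF sum_bound_add[OF r12 r3']])
      fix m
      have sm: "s m > 0" "sinh (s m) > 0" using o(1)[of m] by auto
      have g1: "\<alpha> / sinh (s m) * (g (\<tau> * x m) - g 0) = c 1 * \<tau> * (\<alpha>\<^sup>2 * (cosh (s m) / (sinh (s m))\<^sup>2))
          + \<alpha> ^ 3 * ((cosh (s m))\<^sup>2 / sinh (s m) ^ 3) * L (\<tau> * x m)"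
        unfolding L(1)[of "\<tau> * x m"] power_mult_distrib \<tau>2 using sm(2)
        by (simp add: x_def power_divide power_mult_distrib field_simps power2_eq_square power3_eq_cube)
      have g2: "t m * (g (\<tau> * t m) - g 0) = c 1 * \<tau> * (t m)\<^sup>2 + (t m) ^ 3 * L (\<tau> * t m)"
        unfolding L(1)[of "\<tau> * t m"] power_mult_distrib \<tau>2
        by (simp add: algebra_simps power2_eq_square power3_eq_cube)
      have w2: "(w m)\<^sup>2 = \<alpha>\<^sup>2 * (1 / (s m)\<^sup>2)" "(w m) ^ 3 = \<alpha> ^ 3 * (1 / s m ^ 3)" by (simp_all add: w_def power_divide)
      have "c 1 * \<tau> * (\<alpha>\<^sup>2 / S) * (S * csch_diff' (s m)) = c 1 * \<tau> * (\<alpha>\<^sup>2 * (cosh (s m) / (sinh (s m))\<^sup>2) - (w m)\<^sup>2)"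
        unfolding w2 csch_diff'_def using S by (simp add: right_diff_distrib)
      moreover have "e3 m = \<alpha> ^ 3 * ((cosh (s m))\<^sup>2 / sinh (s m) ^ 3) * L (\<tau> * x m) - (w m) ^ 3 * L (\<tau> * x m)"
        unfolding w2 e3_def by (simp add: algebra_simps)
      ultimately have "c 1 * \<tau> * (\<alpha>\<^sup>2 / S) * (S * csch_diff' (s m)) + (e1 m + e2 m) + e3 m =
        \<alpha> / sinh (s m) * (g (\<tau> * x m) - g 0) - t m * (g (\<tau> * t m) - g 0)"
        unfolding g1 g2 e1_def e2_def by (simp add: algebra_simps)
      then show "c 1 * \<tau> * (\<alpha>\<^sup>2 / S) * (S * csch_diff' (s m)) + (e1 m + e2 m) + e3 m =
        \<alpha> / sinh (\<sigma> + real m * S) * (g (\<tau> * (\<alpha> * cosh (\<sigma> + real m * S) / sinh (\<sigma> + real m * S))) - g 0) -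
        1 / (p + real m * q) * (g (\<tau> * (1 / (p + real m * q))) - g 0)"
        by (simp only: s_def t_def x_def)
    qed (simp add: C_def algebra_simps)
  qed
  then show ?thesis using that C0 a0 by blast
qed

section \<open>The parameters as functions of the gap\<close>

lemma arsinh_bound: "\<exists>B>0. \<forall>x>0. \<bar>arsinh x - x\<bar> \<le> B * (x :: real) ^ 3"
proof -
  define f where "f x = (ln (x + sqrt (x\<^sup>2 + 1)) - x) / x ^ 3" for x :: real
  have pos: "x + sqrt (x\<^sup>2 + 1) > 0" if "x > 0" for x :: real using that by (simp add: add_pos_nonneg)
  have "continuous_on {0<..} f"
    unfolding f_def[abs_def] by (intro continuous_intros) (use pos in force)+
  moreover have "(f \<longlongrightarrow> - 1 / 6) (at_right 0)" unfolding f_def[abs_def] by real_asymp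
  moreover have "(f \<longlongrightarrow> 0) at_top" unfolding f_def[abs_def] by real_asymp
  ultimately obtain B where B: "B > 0" "\<And>s. s > 0 \<Longrightarrow> \<bar>f s\<bar> \<le> B"
    using bounded_on_pos[of f "- 1 / 6" 0] by blast
  have "\<bar>arsinh x - x\<bar> \<le> B * x ^ 3" if x: "x > 0" for x :: real
  proof -
    have x3: "x ^ 3 > 0" using x by simp
    have "f x = (arsinh x - x) / x ^ 3" by (simp only: f_def arsinh_real_def)
    then have "\<bar>f x\<bar> = \<bar>arsinh x - x\<bar> / x ^ 3" by (simp only: abs_divide abs_of_pos[OF x3])
    then have "\<bar>arsinh x - x\<bar> / x ^ 3 \<le> B" using B(2)[OF x] by (simp only:)
    then show ?thesis by (simp only: pos_divide_le_eq[OF x3])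
  qed
  then have "\<forall>x>0. \<bar>arsinh x - x\<bar> \<le> B * x ^ 3" by simp
  then show ?thesis by (intro exI[of _ B] conjI B(1))
qed

text \<open>\<open>arsinh\<close> is odd, so it deviates from the identity by a cubic term, and
  after division by \<alpha> the errors are quadratic rather than linear.\<close>

lemma arsinh_offsets:
  fixes r1 r2 :: real
  assumes r: "r1 > 0" "r2 > 0"
  shows "\<exists>K\<ge>0. \<forall>\<alpha>>0. \<bar>arsinh (\<alpha> / r1) / \<alpha> - 1 / r1\<bar> \<le> K * \<alpha>\<^sup>2 \<and> \<bar>arsinh (\<alpha> / r2) / \<alpha> - 1 / r2\<bar> \<le> K * \<alpha>\<^sup>2 \<and>
    \<bar>(arsinh (\<alpha> / r1) + arsinh (\<alpha> / r2)) / \<alpha> - (1 / r1 + 1 / r2)\<bar> \<le> K * \<alpha>\<^sup>2"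
proof -
  obtain B :: real where B: "B > 0" and B': "\<forall>x>0. \<bar>arsinh x - x\<bar> \<le> B * x ^ 3"
    using arsinh_bound by blast
  have one: "\<bar>arsinh (\<alpha> / r) / \<alpha> - 1 / r\<bar> \<le> B / r ^ 3 * \<alpha>\<^sup>2" if "r > 0" "\<alpha> > 0" for r \<alpha> :: real
  proof -
    have "arsinh (\<alpha> / r) / \<alpha> - 1 / r = (arsinh (\<alpha> / r) - \<alpha> / r) / \<alpha>"
      using that by (simp add: diff_divide_distrib)
    then have "\<bar>arsinh (\<alpha> / r) / \<alpha> - 1 / r\<bar> = \<bar>arsinh (\<alpha> / r) - \<alpha> / r\<bar> / \<alpha>"
      by (simp only: abs_divide abs_of_pos[OF that(2)])
    also have "\<dots> \<le> B * (\<alpha> / r) ^ 3 / \<alpha>" using that B' by (intro divide_right_mono) auto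
    also have "\<dots> = B / r ^ 3 * \<alpha>\<^sup>2" using that by (simp add: power_divide power2_eq_square power3_eq_cube)
    finally show ?thesis .
  qed
  define K where "K = B / r1 ^ 3 + B / r2 ^ 3"
  have le: "B / r1 ^ 3 \<le> K" "B / r2 ^ 3 \<le> K" "K \<ge> 0" using B r by (auto simp: K_def)
  show ?thesis
  proof (intro exI[of _ K] conjI allI impI)
    fix \<alpha> :: real assume \<alpha>: "\<alpha> > 0"
    have 1: "B / r1 ^ 3 * \<alpha>\<^sup>2 \<le> K * \<alpha>\<^sup>2" "B / r2 ^ 3 * \<alpha>\<^sup>2 \<le> K * \<alpha>\<^sup>2" using le by (intro mult_right_mono; simp)+
    show "\<bar>arsinh (\<alpha> / r1) / \<alpha> - 1 / r1\<bar> \<le> K * \<alpha>\<^sup>2" "\<bar>arsinh (\<alpha> / r2) / \<alpha> - 1 / r2\<bar> \<le> K * \<alpha>\<^sup>2"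
      using one[OF r(1) \<alpha>] one[OF r(2) \<alpha>] 1 by linarith+
    have "K * \<alpha>\<^sup>2 = B / r1 ^ 3 * \<alpha>\<^sup>2 + B / r2 ^ 3 * \<alpha>\<^sup>2" by (simp add: K_def distrib_right)
    then show "\<bar>(arsinh (\<alpha> / r1) + arsinh (\<alpha> / r2)) / \<alpha> - (1 / r1 + 1 / r2)\<bar> \<le> K * \<alpha>\<^sup>2"
      using one[OF r(1) \<alpha>] one[OF r(2) \<alpha>] unfolding add_divide_distrib by linarith
  qed (rule le(3))
qed

lemma pole_dist_bounds:
  assumes r: "r1 > 0" "r2 > 0"
  shows "\<exists>c>0. \<exists>C>0. \<forall>\<epsilon>. 0 < \<epsilon> \<longrightarrow> \<epsilon> < 1 \<longrightarrow>
    c * \<epsilon> \<le> (pole_dist r1 r2 \<epsilon>)\<^sup>2 \<and> (pole_dist r1 r2 \<epsilon>)\<^sup>2 \<le> C * \<epsilon>"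
proof -
  define c where "c = 2 * r1 * (2 * r2) * (2 * r1 + 2 * r2) / (4 * (r1 + r2 + 1)\<^sup>2)"
  define C where "C = (2 * r1 + 1) * (2 * r2 + 1) * (2 * r1 + 2 * r2 + 1) / (4 * (r1 + r2)\<^sup>2)"
  have "c > 0" "C > 0" unfolding c_def C_def using r by (intro divide_pos_pos mult_pos_pos zero_less_power; simp)+
  moreover have "c * \<epsilon> \<le> (pole_dist r1 r2 \<epsilon>)\<^sup>2 \<and> (pole_dist r1 r2 \<epsilon>)\<^sup>2 \<le> C * \<epsilon>" if e: "0 < \<epsilon>" "\<epsilon> < 1" for \<epsilon>
  proof -
    define Q where "Q = (2 * r1 + \<epsilon>) * (2 * r2 + \<epsilon>) * (2 * r1 + 2 * r2 + \<epsilon>) / (4 * (r1 + r2 + \<epsilon>)\<^sup>2)"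
    have "(pole_dist r1 r2 \<epsilon>)\<^sup>2 = Q * \<epsilon>"
      using two_sphere_geometry(2)[OF r e(1)] by (simp add: Q_def mult_ac)
    moreover have "c \<le> Q" unfolding c_def Q_def using r e
      by (intro frac_le mult_mono power_mono mult_nonneg_nonneg add_nonneg_nonneg) auto
    moreover have "Q \<le> C" unfolding C_def Q_def using r e
      by (intro frac_le mult_mono power_mono mult_nonneg_nonneg add_nonneg_nonneg) auto
    ultimately show ?thesis using e by simp
  qed
  ultimately show ?thesis by blast
qed

lemma pole_dist_log_bound:
  assumes r: "r1 > 0" "r2 > 0"
  shows "\<exists>K>0. \<exists>\<epsilon>0>0. \<forall>\<epsilon>. 0 < \<epsilon> \<longrightarrow> \<epsilon> < \<epsilon>0 \<longrightarrow>
    (pole_dist r1 r2 \<epsilon>)\<^sup>2 * (1 + \<bar>ln (pole_dist r1 r2 \<epsilon>)\<bar>) \<le> K * (\<epsilon> * \<bar>ln \<epsilon>\<bar>)"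
proof -
  obtain c C where cC: "c > 0" "C > 0" and cC': "\<forall>\<epsilon>. 0 < \<epsilon> \<longrightarrow> \<epsilon> < 1 \<longrightarrow>
    c * \<epsilon> \<le> (pole_dist r1 r2 \<epsilon>)\<^sup>2 \<and> (pole_dist r1 r2 \<epsilon>)\<^sup>2 \<le> C * \<epsilon>"
    using pole_dist_bounds[OF r] by blast
  define L where "L = \<bar>ln c\<bar> + \<bar>ln C\<bar>"
  \<comment> \<open>Below \<open>exp (- 1)\<close> one has
    \<open>\<bar>ln \<epsilon>\<bar> \<ge> 1\<close>, which absorbs the additive constants.\<close>
  have "(pole_dist r1 r2 \<epsilon>)\<^sup>2 * (1 + \<bar>ln (pole_dist r1 r2 \<epsilon>)\<bar>) \<le> C * (2 + L) * (\<epsilon> * \<bar>ln \<epsilon>\<bar>)"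
    if e: "0 < \<epsilon>" "\<epsilon> < exp (- 1)" for \<epsilon>
  proof -
    define \<alpha> where "\<alpha> = pole_dist r1 r2 \<epsilon>"
    have \<alpha>: "\<alpha> > 0" unfolding \<alpha>_def by (rule two_sphere_geometry(1)[OF r e(1)])
    have "exp (- 1 :: real) < 1" by simp
    then have "\<epsilon> < 1" using e by linarith
    then have b: "c * \<epsilon> \<le> \<alpha>\<^sup>2" "\<alpha>\<^sup>2 \<le> C * \<epsilon>" using cC' e(1) by (simp_all add: \<alpha>_def)
    have "ln \<epsilon> \<le> ln (exp (- 1))" using e by (subst ln_le_cancel_iff) auto
    then have le: "1 \<le> \<bar>ln \<epsilon>\<bar>" by simp
    have "ln (c * \<epsilon>) \<le> ln (\<alpha>\<^sup>2)" "ln (\<alpha>\<^sup>2) \<le> ln (C * \<epsilon>)" using b \<alpha> cC e by simp_all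
    then have "ln c + ln \<epsilon> \<le> 2 * ln \<alpha>" "2 * ln \<alpha> \<le> ln C + ln \<epsilon>" using \<alpha> cC e by (simp_all add: ln_mult ln_realpow)
    then have "2 * \<bar>ln \<alpha>\<bar> \<le> L + \<bar>ln \<epsilon>\<bar>" unfolding L_def by linarith
    moreover have "L * 1 \<le> L * \<bar>ln \<epsilon>\<bar>" using le by (intro mult_left_mono) (auto simp: L_def)
    moreover have "(2 + L) * \<bar>ln \<epsilon>\<bar> = 2 * \<bar>ln \<epsilon>\<bar> + L * \<bar>ln \<epsilon>\<bar>" by (simp only: distrib_right)
    moreover have "L \<ge> 0" by (simp add: L_def)
    ultimately have "1 + \<bar>ln \<alpha>\<bar> \<le> (2 + L) * \<bar>ln \<epsilon>\<bar>" using le by linarith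
    then have "\<alpha>\<^sup>2 * (1 + \<bar>ln \<alpha>\<bar>) \<le> (C * \<epsilon>) * ((2 + L) * \<bar>ln \<epsilon>\<bar>)" using b cC e(1) by (intro mult_mono) auto
    then show ?thesis by (simp add: \<alpha>_def mult_ac)
  qed
  moreover have "C * (2 + L) > 0" using cC by (auto simp: L_def intro!: mult_pos_pos add_pos_nonneg)
  moreover have "exp (- 1 :: real) > 0" by simp
  ultimately show ?thesis by blast
qed

text \<open>The limit of \<open>\<alpha> / sinh (\<sigma> + m S)\<close>, and of its position up to sign, as \<open>\<alpha>\<close> tends to \<open>0\<close> with
  \<open>\<sigma> / \<alpha> \<rightarrow> p\<close> and \<open>S / \<alpha> \<rightarrow> q\<close>.\<close>

definition offset :: "real \<Rightarrow> real \<Rightarrow> nat \<Rightarrow> real" where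
  "offset p q m = 1 / (p + real m * q)"

lemma offset_bounds:
  assumes pq: "p > 0" "q > 0"
  shows "offset p q m > 0" "offset p q m \<le> (1 / p + 1 / q) / (1 + real m)" "offset p q m \<le> 1 / p + 1 / q"
    "(offset p q m)\<^sup>2 \<le> (1 / p + 1 / q)\<^sup>2 / (1 + real m)\<^sup>2"
proof -
  \<comment> \<open>The case \<open>\<alpha> = 1\<close>, \<open>K = 0\<close>,
    \<open>\<sigma> = p\<close>, \<open>S = q\<close>, in which \<open>\<alpha> / s\<close> is the
    limit itself.\<close>
  note o = offset_comparison[OF pq zero_less_one, of p 0 q m, folded offset_def]
  show p: "offset p q m > 0" "offset p q m \<le> (1 / p + 1 / q) / (1 + real m)" "offset p q m \<le> 1 / p + 1 / q"
    using o(2-4) pq by auto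
  show "(offset p q m)\<^sup>2 \<le> (1 / p + 1 / q)\<^sup>2 / (1 + real m)\<^sup>2"
    using power_mono[OF p(2), of 2] p(1) by (simp add: power_divide)
qed

text \<open>Each offset decays only like \<open>1 / m\<close>, but the difference is
  \<open>q - p\<close> times a product of two offsets.\<close>

lemma summable_offset_diff:
  assumes "p > 0" "q > 0"
  shows "summable (\<lambda>m. offset p q m - offset q q m)"
proof -
  have "\<bar>offset p q m - offset q q m\<bar> \<le> \<bar>q - p\<bar> * ((1 / p + 1 / q) * (1 / q + 1 / q)) / (1 + real m)\<^sup>2" for m
  proof -
    have "p + real m * q > 0" "q + real m * q > 0" using assms by (auto intro: add_pos_nonneg)
    then have "offset p q m - offset q q m = (q - p) * (offset p q m * offset q q m)"
      by (simp add: offset_def field_simps)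
    then have "\<bar>offset p q m - offset q q m\<bar> = \<bar>q - p\<bar> * (offset p q m * offset q q m)"
      using offset_bounds(1)[OF assms, of m] offset_bounds(1)[OF assms(2,2), of m] by (simp add: abs_mult)
    also have "\<dots> \<le> \<bar>q - p\<bar> * ((1 / p + 1 / q) / (1 + real m) * ((1 / q + 1 / q) / (1 + real m)))"
      using offset_bounds[OF assms, of m] offset_bounds[OF assms(2,2), of m] assms
      by (intro mult_left_mono mult_mono) auto
    also have "x * (a / n * (b / n)) = x * (a * b) / n\<^sup>2" for x a b n :: real
      by (simp add: power2_eq_square)
    finally show ?thesis .
  qed
  from sum_bound_square[OF this] show ?thesis by (simp add: sum_bound_def)
qed

text \<open>An interchange of summations. The tail of the power series at \<open>t m\<close> is at
  most \<open>t m * R n\<close>, where \<open>R n\<close> is the tail of an absolutely convergent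
  series at \<kappa>; the factor \<open>t m\<close> is there because \<open>g - g 0\<close> vanishes
  at 0. With the strength \<open>t m\<close> in front the bound is summable in \<open>m\<close> and
  tends to 0 with \<open>n\<close>.\<close>

lemma offset_series_sums:
  fixes c :: "nat \<Rightarrow> real"
  assumes pq: "p > 0" "q > 0" and \<tau>: "\<bar>\<tau>\<bar> = 1" and g: "\<And>t. (\<lambda>k. c k * t ^ k) sums g t"
  shows "summable (\<lambda>m. offset p q m * (g (\<tau> * offset p q m) - g 0))"
    "(\<lambda>k. c (Suc k) * \<tau> ^ Suc k * (\<Sum>m. offset p q m ^ (k + 2))) sums
      (\<Sum>m. offset p q m * (g (\<tau> * offset p q m) - g 0))"
proof -
  define t where "t = offset p q"
  define \<kappa> where "\<kappa> = 1 / p + 1 / q"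
  have \<kappa>: "\<kappa> > 0" using pq by (simp add: \<kappa>_def add_pos_pos)
  note t = offset_bounds[OF pq, folded t_def \<kappa>_def]
  have sm0: "summable (\<lambda>k. c k * x ^ k)" for x using g sums_summable by blast
  then have sm1: "summable (\<lambda>k. c (Suc k) * x ^ k)" for x by (simp add: summable_powser_split_head)
  define a where "a k = \<bar>c (Suc k)\<bar> * \<kappa> ^ k" for k
  have a: "summable a"
    using powser_insidea[OF sm1[of "\<kappa> + 1"], of \<kappa>] \<kappa> unfolding a_def[abs_def] by (simp add: abs_mult power_abs)
  define R where "R n = suminf a - sum a {..<n}" for n
  have R: "(\<lambda>k. a (k + n)) sums R n" for n
    unfolding R_def using summable_sums[OF a] by (simp add: sums_iff_shift)
  have R0: "R \<longlonglongrightarrow> 0"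
    unfolding R_def using tendsto_diff[OF tendsto_const summable_LIMSEQ[OF a], of "suminf a"] by simp
  have g0: "g 0 = c 0" using sums_unique2[OF g[of 0] powser_sums_zero] by simp
  have \<psi>: "(\<lambda>k. c (Suc k) * x ^ Suc k) sums (g x - g 0)" for x
    using sums_Suc_iff[of "\<lambda>k. c k * x ^ k" "g x - g 0"] g[of x] g0 by simp
  have tail: "\<bar>(g (\<tau> * t m) - g 0) - (\<Sum>k<n. c (Suc k) * (\<tau> * t m) ^ Suc k)\<bar> \<le> t m * R n" for m n
  proof -
    have s: "(\<lambda>k. c (Suc (k + n)) * (\<tau> * t m) ^ Suc (k + n)) sums
        ((g (\<tau> * t m) - g 0) - (\<Sum>k<n. c (Suc k) * (\<tau> * t m) ^ Suc k))"
      using \<psi>[of "\<tau> * t m"] sums_iff_shift'[of "\<lambda>k. c (Suc k) * (\<tau> * t m) ^ Suc k" n] by simp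
    have "sum_bound (\<lambda>k. c (Suc (k + n)) * (\<tau> * t m) ^ Suc (k + n)) (t m * R n)"
    proof (rule sum_boundI)
      show "(\<lambda>k. t m * a (k + n)) sums (t m * R n)" by (rule sums_mult[OF R])
      fix k
      have "\<bar>c (Suc (k + n)) * (\<tau> * t m) ^ Suc (k + n)\<bar> = \<bar>c (Suc (k + n))\<bar> * (t m * t m ^ (k + n))"
        using t(1)[of m] \<tau> by (simp add: abs_mult power_abs)
      also have "\<dots> \<le> \<bar>c (Suc (k + n))\<bar> * (t m * \<kappa> ^ (k + n))"
        using t(1,3)[of m] by (intro mult_left_mono power_mono) auto
      finally show "\<bar>c (Suc (k + n)) * (\<tau> * t m) ^ Suc (k + n)\<bar> \<le> t m * a (k + n)"
        by (simp add: a_def mult_ac)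
    qed simp
    then show ?thesis using sums_unique[OF s] by (simp add: sum_bound_def)
  qed
  have bd: "sum_bound (\<lambda>m. t m * ((g (\<tau> * t m) - g 0) - (\<Sum>k<n. c (Suc k) * (\<tau> * t m) ^ Suc k))) (R n * \<kappa>\<^sup>2 * zeta2)" for n
  proof (rule sum_bound_square)
    fix m
    have Rn: "R n \<ge> 0" using sums_le[OF _ sums_zero R[of n]] by (simp add: a_def \<kappa> less_imp_le)
    have "\<bar>t m * ((g (\<tau> * t m) - g 0) - (\<Sum>k<n. c (Suc k) * (\<tau> * t m) ^ Suc k))\<bar> \<le> t m * (t m * R n)"
      unfolding abs_mult using t(1)[of m] tail[of m n] by simp
    also have "\<dots> = R n * (t m)\<^sup>2" by (simp add: power2_eq_square)
    also have "\<dots> \<le> R n * (\<kappa>\<^sup>2 / (1 + real m)\<^sup>2)" using t(4)[of m] Rn by (intro mult_left_mono) auto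
    finally show "\<bar>t m * ((g (\<tau> * t m) - g 0) - (\<Sum>k<n. c (Suc k) * (\<tau> * t m) ^ Suc k))\<bar> \<le> R n * \<kappa>\<^sup>2 / (1 + real m)\<^sup>2"
      by simp
  qed
  have s1: "summable (\<lambda>m. t m * (g (\<tau> * t m) - g 0))" using bd[of 0] by (simp add: sum_bound_def)
  then show "summable (\<lambda>m. offset p q m * (g (\<tau> * offset p q m) - g 0))" by (simp add: t_def)
  have s2: "summable (\<lambda>m. t m ^ (k + 2))" for k
  proof -
    have "\<bar>t m ^ (k + 2)\<bar> \<le> \<kappa> ^ k * \<kappa>\<^sup>2 / (1 + real m)\<^sup>2" for m
    proof -
      have "\<bar>t m ^ (k + 2)\<bar> = t m ^ k * (t m)\<^sup>2" using t(1)[of m] by (simp add: power_add power2_eq_square)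
      also have "\<dots> \<le> \<kappa> ^ k * (\<kappa>\<^sup>2 / (1 + real m)\<^sup>2)"
        using t(1,3,4)[of m] \<kappa> by (intro mult_mono power_mono) auto
      finally show ?thesis by simp
    qed
    from sum_bound_square[OF this] show ?thesis by (simp add: sum_bound_def)
  qed
  define P where "P n = (\<Sum>k<n. c (Suc k) * \<tau> ^ Suc k * (\<Sum>m. t m ^ (k + 2)))" for n
  define W where "W = (\<Sum>m. t m * (g (\<tau> * t m) - g 0))"
  have "W - P n = (\<Sum>m. t m * ((g (\<tau> * t m) - g 0) - (\<Sum>k<n. c (Suc k) * (\<tau> * t m) ^ Suc k)))" for n
  proof -
    have "P n = (\<Sum>k<n. \<Sum>m. c (Suc k) * \<tau> ^ Suc k * t m ^ (k + 2))"
      unfolding P_def by (intro sum.cong refl suminf_mult[symmetric] s2)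
    also have "\<dots> = (\<Sum>m. \<Sum>k<n. c (Suc k) * \<tau> ^ Suc k * t m ^ (k + 2))"
      by (intro suminf_sum[symmetric] summable_mult s2)
    finally have P: "P n = (\<Sum>m. \<Sum>k<n. c (Suc k) * \<tau> ^ Suc k * t m ^ (k + 2))" .
    have "summable (\<lambda>m. \<Sum>k<n. c (Suc k) * \<tau> ^ Suc k * t m ^ (k + 2))" by (intro summable_sum summable_mult s2)
    from suminf_diff[OF s1 this]
    have "W - P n = (\<Sum>m. t m * (g (\<tau> * t m) - g 0) - (\<Sum>k<n. c (Suc k) * \<tau> ^ Suc k * t m ^ (k + 2)))"
      unfolding W_def P .
    also have "\<dots> = (\<Sum>m. t m * ((g (\<tau> * t m) - g 0) - (\<Sum>k<n. c (Suc k) * (\<tau> * t m) ^ Suc k)))"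
      by (simp add: right_diff_distrib sum_distrib_left power_mult_distrib mult_ac)
    finally show ?thesis .
  qed
  then have "\<bar>W - P n\<bar> \<le> R n * \<kappa>\<^sup>2 * zeta2" for n using bd[of n] by (simp add: sum_bound_def)
  moreover have "(\<lambda>n. R n * \<kappa>\<^sup>2 * zeta2) \<longlonglongrightarrow> 0 * \<kappa>\<^sup>2 * zeta2" by (intro tendsto_intros R0)
  ultimately have "(\<lambda>n. W - P n) \<longlonglongrightarrow> 0"
    by (intro Lim_null_comparison[of "\<lambda>n. W - P n" "\<lambda>n. R n * \<kappa>\<^sup>2 * zeta2"]) auto
  from tendsto_diff[OF tendsto_const[of W] this] have "P \<longlonglongrightarrow> W" by simp
  then show "(\<lambda>k. c (Suc k) * \<tau> ^ Suc k * (\<Sum>m. offset p q m ^ (k + 2))) sums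
      (\<Sum>m. offset p q m * (g (\<tau> * offset p q m) - g 0))"
    unfolding sums_def P_def[abs_def] W_def t_def by simp
qed

section \<open>Passing error bounds to series, quotients and products\<close>

lemma sum_bound_diffD:
  assumes "sum_bound (\<lambda>m. x m - y m) b" "summable y"
  shows "summable x" "\<bar>suminf x - suminf y\<bar> \<le> b"
proof -
  show "summable x" using summable_add[of "\<lambda>m. x m - y m" y] assms by (simp add: sum_bound_def)
  then show "\<bar>suminf x - suminf y\<bar> \<le> b" using assms suminf_diff[of x y] by (simp add: sum_bound_def)
qed

lemma quotient_bigo:
  fixes N D \<eta> :: "'a \<Rightarrow> real"
  assumes N: "(\<lambda>x. N x - N0) \<in> O[F](\<eta>)" and D: "(\<lambda>x. D x - D0) \<in> O[F](\<eta>)"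
    and \<eta>: "(\<eta> \<longlongrightarrow> 0) F" and D0: "D0 \<noteq> 0"
  shows "(\<lambda>x. N x / D x - N0 / D0) \<in> O[F](\<eta>)" "\<forall>\<^sub>F x in F. D x \<noteq> 0"
proof -
  obtain k where k: "\<forall>\<^sub>F x in F. norm (D x - D0) \<le> k * norm (\<eta> x)" using landau_o.bigE[OF D] by blast
  have "((\<lambda>x. k * norm (\<eta> x)) \<longlongrightarrow> k * norm (0::real)) F" by (intro tendsto_intros \<eta>)
  then have "((\<lambda>x. D x - D0) \<longlongrightarrow> 0) F" using k by (intro Lim_null_comparison[OF k]) simp
  then have Dl: "(D \<longlongrightarrow> D0) F" by (simp add: LIM_zero_iff)
  show ev: "\<forall>\<^sub>F x in F. D x \<noteq> 0" by (rule tendsto_imp_eventually_ne[OF Dl D0])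
  have "((\<lambda>x. 1 / D x) \<longlongrightarrow> 1 / D0) F" by (intro tendsto_intros Dl D0)
  then have i: "(\<lambda>x. 1 / D x) \<in> O[F](\<lambda>_. 1)" by (intro bigoI_tendsto[of _ _ "1 / D0"]) auto
  have "(\<lambda>x. N0 / D0 * (D x - D0)) \<in> O[F](\<eta>)" using D by (cases "N0 / D0 = 0") auto
  from sum_in_bigo(2)[OF N this] have "(\<lambda>x. (N x - N0) - N0 / D0 * (D x - D0)) \<in> O[F](\<eta>)" .
  from landau_o.big.mult[OF this i]
  have "(\<lambda>x. ((N x - N0) - N0 / D0 * (D x - D0)) * (1 / D x)) \<in> O[F](\<lambda>x. \<eta> x * 1)" .
  then have "(\<lambda>x. ((N x - N0) - N0 / D0 * (D x - D0)) * (1 / D x)) \<in> O[F](\<eta>)" by simp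
  moreover have "\<forall>\<^sub>F x in F. ((N x - N0) - N0 / D0 * (D x - D0)) * (1 / D x) = N x / D x - N0 / D0"
    using ev by eventually_elim (use D0 in \<open>simp add: field_simps\<close>)
  note landau_o.big.in_cong[OF this]
  ultimately show "(\<lambda>x. N x / D x - N0 / D0) \<in> O[F](\<eta>)" by simp
qed

lemma product_bigo:
  fixes f h \<eta> :: "'a \<Rightarrow> real"
  assumes f: "(\<lambda>x. f x - f0) \<in> O[F](\<eta>)" and h: "(\<lambda>x. h x - h0) \<in> O[F](\<eta>)" and \<eta>: "(\<eta> \<longlongrightarrow> 0) F"
  shows "(\<lambda>x. f x * h x - f0 * h0) \<in> O[F](\<eta>)"
proof -
  have "\<eta> \<in> O[F](\<lambda>_. 1)" by (rule bigoI_tendsto[of _ _ 0]) (use \<eta> in auto)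
  then have h1: "(\<lambda>x. h x - h0) \<in> O[F](\<lambda>_. 1)" by (rule landau_o.big_trans[OF h])
  have "(\<lambda>x. (f x - f0) * (h x - h0)) \<in> O[F](\<lambda>x. \<eta> x * 1)" by (intro landau_o.big.mult f h1)
  then have 1: "(\<lambda>x. (f x - f0) * (h x - h0)) \<in> O[F](\<eta>)" by simp
  have 2: "(\<lambda>x. f0 * (h x - h0)) \<in> O[F](\<eta>)" using h by (cases "f0 = 0") auto
  have 3: "(\<lambda>x. h0 * (f x - f0)) \<in> O[F](\<eta>)" using f by (cases "h0 = 0") auto
  have "(\<lambda>x. (f x - f0) * (h x - h0) + (f0 * (h x - h0) + h0 * (f x - f0))) \<in> O[F](\<eta>)"
    by (intro sum_in_bigo 1 2 3)
  then show ?thesis by (simp add: algebra_simps)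
qed

lemma coth_point_eq:
  "coth_point \<alpha> a = (\<alpha> * cosh a / sinh a) *\<^sub>R vector [0, 0, 1]"
  "coth_point \<alpha> (- a) = (- 1 * (\<alpha> * cosh a / sinh a)) *\<^sub>R vector [0, 0, 1]"
  by (simp_all add: coth_point_def vector_3_eq_iff)

text \<open>Collects the comparisons for the parameters \<open>s1\<close>, \<open>s2\<close> and
  \<open>S\<close> under one constant and one threshold. The sign in the argument of
  \<open>g\<close> tells on which side of the origin the image charges lie.\<close>

lemma image_series_limits:
  fixes r1 r2 :: real and c :: "nat \<Rightarrow> real" and g :: "real \<Rightarrow> real"
  assumes r: "r1 > 0" "r2 > 0" and g: "\<And>t. (\<lambda>k. c k * t ^ k) sums g t"
  defines "q \<equiv> 1 / r1 + 1 / r2"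
  defines "ta \<equiv> offset (1 / r1) q" and "tb \<equiv> offset (1 / r2) q" and "tc \<equiv> offset q q"
  defines "s1 \<equiv> \<lambda>\<alpha>. arsinh (\<alpha> / r1)" and "s2 \<equiv> \<lambda>\<alpha>. arsinh (\<alpha> / r2)"
  defines "S \<equiv> \<lambda>\<alpha>. s1 \<alpha> + s2 \<alpha>"
  defines "k \<equiv> \<lambda>\<alpha> \<sigma> m. \<alpha> / sinh (\<sigma> + real m * S \<alpha>)"
    and "z \<equiv> \<lambda>\<alpha> \<sigma> m. \<alpha> * cosh (\<sigma> + real m * S \<alpha>) / sinh (\<sigma> + real m * S \<alpha>)"
  shows "\<exists>C\<ge>0. \<exists>\<alpha>0>0. \<forall>\<alpha>. 0 < \<alpha> \<longrightarrow> \<alpha> < \<alpha>0 \<longrightarrow>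
    \<bar>(\<Sum>m. k \<alpha> (s1 \<alpha>) m - k \<alpha> (S \<alpha>) m) - (\<Sum>m. ta m - tc m)\<bar> \<le> C * (\<alpha>\<^sup>2 * (1 + \<bar>ln \<alpha>\<bar>)) \<and>
    \<bar>(\<Sum>m. k \<alpha> (s2 \<alpha>) m - k \<alpha> (S \<alpha>) m) - (\<Sum>m. tb m - tc m)\<bar> \<le> C * (\<alpha>\<^sup>2 * (1 + \<bar>ln \<alpha>\<bar>)) \<and>
    \<bar>(\<Sum>m. k \<alpha> (s1 \<alpha>) m * (g (- 1 * z \<alpha> (s1 \<alpha>) m) - g 0) - k \<alpha> (S \<alpha>) m * (g (1 * z \<alpha> (S \<alpha>) m) - g 0)) -
      ((\<Sum>m. ta m * (g (- 1 * ta m) - g 0)) - (\<Sum>m. tc m * (g (1 * tc m) - g 0)))\<bar> \<le> C * (\<alpha>\<^sup>2 * (1 + \<bar>ln \<alpha>\<bar>)) \<and>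
    \<bar>(\<Sum>m. k \<alpha> (s2 \<alpha>) m * (g (1 * z \<alpha> (s2 \<alpha>) m) - g 0) - k \<alpha> (S \<alpha>) m * (g (- 1 * z \<alpha> (S \<alpha>) m) - g 0)) -
      ((\<Sum>m. tb m * (g (1 * tb m) - g 0)) - (\<Sum>m. tc m * (g (- 1 * tc m) - g 0)))\<bar> \<le> C * (\<alpha>\<^sup>2 * (1 + \<bar>ln \<alpha>\<bar>))"
proof -
  define p1 p2 where "p1 = 1 / r1" and "p2 = 1 / r2"
  have p: "p1 > 0" "p2 > 0" "q > 0" using r by (auto simp: p1_def p2_def q_def add_pos_pos)
  obtain K where K: "K \<ge> 0" and K': "\<forall>\<alpha>>0. \<bar>s1 \<alpha> / \<alpha> - p1\<bar> \<le> K * \<alpha>\<^sup>2 \<and> \<bar>s2 \<alpha> / \<alpha> - p2\<bar> \<le> K * \<alpha>\<^sup>2 \<and> \<bar>S \<alpha> / \<alpha> - q\<bar> \<le> K * \<alpha>\<^sup>2"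
    using arsinh_offsets[OF r] unfolding s1_def s2_def S_def p1_def p2_def q_def by blast
  define const where "const p C \<alpha>0 \<longleftrightarrow> C \<ge> 0 \<and> \<alpha>0 > 0 \<and> (\<forall>\<alpha> \<sigma>. 0 < \<alpha> \<longrightarrow> \<alpha> < \<alpha>0 \<longrightarrow> 0 < \<sigma> \<longrightarrow> \<sigma> \<le> S \<alpha> \<longrightarrow>
    \<bar>\<sigma> / \<alpha> - p\<bar> \<le> K * \<alpha>\<^sup>2 \<longrightarrow> sum_bound (\<lambda>m. (k \<alpha> \<sigma> m - k \<alpha> (S \<alpha>) m) - (offset p q m - tc m)) (C * \<alpha>\<^sup>2))"
    for p C \<alpha>0
  define ser where "ser p C \<alpha>0 \<longleftrightarrow> C \<ge> 0 \<and> \<alpha>0 > 0 \<and> (\<forall>\<alpha> \<sigma> \<tau>. 0 < \<alpha> \<longrightarrow> \<alpha> < \<alpha>0 \<longrightarrow> 0 < \<sigma> \<longrightarrow> \<sigma> \<le> S \<alpha> \<longrightarrow> \<bar>\<tau>\<bar> = 1 \<longrightarrow>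
    \<bar>\<sigma> / \<alpha> - p\<bar> \<le> K * \<alpha>\<^sup>2 \<longrightarrow> sum_bound (\<lambda>m. k \<alpha> \<sigma> m * (g (\<tau> * z \<alpha> \<sigma> m) - g 0) - offset p q m * (g (\<tau> * offset p q m) - g 0))
      (C * (\<alpha>\<^sup>2 * (1 + \<bar>ln \<alpha>\<bar>))))" for p C \<alpha>0
  have const_ex: "\<exists>C \<alpha>0. const p C \<alpha>0" if "p > 0" for p
  proof (rule offset_constant_bound[OF that p(3) K])
    fix C \<alpha>0 :: real assume 1: "C \<ge> 0" "\<alpha>0 > 0" and 2: "\<And>\<alpha> \<sigma> S. 0 < \<alpha> \<Longrightarrow> \<alpha> < \<alpha>0 \<Longrightarrow> 0 < \<sigma> \<Longrightarrow> \<sigma> \<le> S \<Longrightarrow>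
      \<bar>\<sigma> / \<alpha> - p\<bar> \<le> K * \<alpha>\<^sup>2 \<Longrightarrow> \<bar>S / \<alpha> - q\<bar> \<le> K * \<alpha>\<^sup>2 \<Longrightarrow>
      sum_bound (\<lambda>m. (\<alpha> / sinh (\<sigma> + real m * S) - \<alpha> / sinh (S + real m * S)) -
        (1 / (p + real m * q) - 1 / (q + real m * q))) (C * \<alpha>\<^sup>2)"
    have "const p C \<alpha>0" unfolding const_def k_def tc_def offset_def using 1 2 K' by simp
    then show ?thesis by (intro exI)
  qed
  have ser_ex: "\<exists>C \<alpha>0. ser p C \<alpha>0" if "p > 0" for p
  proof (rule offset_power_series_bound[OF that p(3) K g])
    fix C \<alpha>0 :: real assume 1: "C \<ge> 0" "\<alpha>0 > 0" and 2: "\<And>\<alpha> \<sigma> S \<tau>. 0 < \<alpha> \<Longrightarrow> \<alpha> < \<alpha>0 \<Longrightarrow> 0 < \<sigma> \<Longrightarrow> \<sigma> \<le> S \<Longrightarrow> \<bar>\<tau>\<bar> = 1 \<Longrightarrow>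
      \<bar>\<sigma> / \<alpha> - p\<bar> \<le> K * \<alpha>\<^sup>2 \<Longrightarrow> \<bar>S / \<alpha> - q\<bar> \<le> K * \<alpha>\<^sup>2 \<Longrightarrow>
      sum_bound (\<lambda>m. \<alpha> / sinh (\<sigma> + real m * S) *
          (g (\<tau> * (\<alpha> * cosh (\<sigma> + real m * S) / sinh (\<sigma> + real m * S))) - g 0) -
        1 / (p + real m * q) * (g (\<tau> * (1 / (p + real m * q))) - g 0)) (C * (\<alpha>\<^sup>2 * (1 + \<bar>ln \<alpha>\<bar>)))"
    have "ser p C \<alpha>0" unfolding ser_def k_def z_def offset_def
      by (intro conjI allI impI 1 2) (use K' in auto)
    then show ?thesis by (intro exI)
  qed
  obtain C1 a1 where 1: "const p1 C1 a1" using const_ex[OF p(1)] by (elim exE)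
  obtain C2 a2 where 2: "const p2 C2 a2" using const_ex[OF p(2)] by (elim exE)
  obtain C3 a3 where 3: "ser p1 C3 a3" using ser_ex[OF p(1)] by (elim exE)
  obtain C4 a4 where 4: "ser p2 C4 a4" using ser_ex[OF p(2)] by (elim exE)
  obtain C5 a5 where 5: "ser q C5 a5" using ser_ex[OF p(3)] by (elim exE)
  have serD: "sum_bound (\<lambda>m. k \<alpha> \<sigma> m * (g (\<tau> * z \<alpha> \<sigma> m) - g 0) - offset p q m * (g (\<tau> * offset p q m) - g 0))
      (C * (\<alpha>\<^sup>2 * (1 + \<bar>ln \<alpha>\<bar>)))"
    if "ser p C \<alpha>0" "0 < \<alpha>" "\<alpha> < \<alpha>0" "0 < \<sigma>" "\<sigma> \<le> S \<alpha>" "\<bar>\<tau>\<bar> = 1" "\<bar>\<sigma> / \<alpha> - p\<bar> \<le> K * \<alpha>\<^sup>2" for p C \<alpha>0 \<alpha> \<sigma> \<tau>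
    using that unfolding ser_def by simp
  define C where "C = C1 + C2 + C3 + C4 + C5"
  define \<alpha>0 where "\<alpha>0 = Min {a1, a2, a3, a4, a5}"
  have Cn: "C1 \<ge> 0" "C2 \<ge> 0" "C3 \<ge> 0" "C4 \<ge> 0" "C5 \<ge> 0" using 1 2 3 4 5 by (simp_all add: const_def ser_def)
  have a0: "\<alpha>0 > 0" using 1 2 3 4 5 by (simp add: \<alpha>0_def const_def ser_def)
  have smc: "summable (\<lambda>m. ta m - tc m)" "summable (\<lambda>m. tb m - tc m)"
    unfolding ta_def tb_def tc_def p1_def[symmetric] p2_def[symmetric] by (intro summable_offset_diff p)+
  have sms: "summable (\<lambda>m. offset p q m * (g (\<tau> * offset p q m) - g 0))" if "p > 0" "\<bar>\<tau>\<bar> = 1" for p \<tau>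
    by (rule offset_series_sums(1)[OF that(1) p(3) that(2) g])
  show ?thesis
  proof (rule exI[of _ C], intro conjI, simp add: C_def Cn, rule exI[of _ \<alpha>0], intro conjI allI impI, rule a0)
    fix \<alpha> :: real assume \<alpha>: "0 < \<alpha>" "\<alpha> < \<alpha>0"
    define w where "w = \<alpha>\<^sup>2 * (1 + \<bar>ln \<alpha>\<bar>)"
    have w0: "w \<ge> 0" by (simp add: w_def)
    have "\<alpha>\<^sup>2 * 1 \<le> \<alpha>\<^sup>2 * (1 + \<bar>ln \<alpha>\<bar>)" by (intro mult_left_mono) auto
    then have ww: "\<alpha>\<^sup>2 \<le> w" by (simp add: w_def)
    have al: "\<alpha> < a1" "\<alpha> < a2" "\<alpha> < a3" "\<alpha> < a4" "\<alpha> < a5" using \<alpha>(2) by (simp_all add: \<alpha>0_def)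
    have s: "0 < s1 \<alpha>" "s1 \<alpha> \<le> S \<alpha>" "0 < s2 \<alpha>" "s2 \<alpha> \<le> S \<alpha>" "0 < S \<alpha>"
    proof -
      have "0 < s1 \<alpha>" "0 < s2 \<alpha>" using \<alpha>(1) r by (simp_all add: s1_def s2_def)
      then show "0 < s1 \<alpha>" "s1 \<alpha> \<le> S \<alpha>" "0 < s2 \<alpha>" "s2 \<alpha> \<le> S \<alpha>" "0 < S \<alpha>" unfolding S_def by linarith+
    qed
    have b1: "sum_bound (\<lambda>m. (k \<alpha> (s1 \<alpha>) m - k \<alpha> (S \<alpha>) m) - (ta m - tc m)) (C1 * \<alpha>\<^sup>2)"
      using 1 \<alpha>(1) al(1) s K' unfolding const_def ta_def p1_def[symmetric] by simp
    have b2: "sum_bound (\<lambda>m. (k \<alpha> (s2 \<alpha>) m - k \<alpha> (S \<alpha>) m) - (tb m - tc m)) (C2 * \<alpha>\<^sup>2)"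
      using 2 \<alpha>(1) al(2) s K' unfolding const_def tb_def p2_def[symmetric] by simp
    have b3: "sum_bound (\<lambda>m. k \<alpha> (s1 \<alpha>) m * (g (- 1 * z \<alpha> (s1 \<alpha>) m) - g 0) - ta m * (g (- 1 * ta m) - g 0)) (C3 * w)"
      unfolding ta_def p1_def[symmetric] w_def by (rule serD[OF 3 \<alpha>(1) al(3) s(1,2)]) (use K' \<alpha>(1) in auto)
    have b4: "sum_bound (\<lambda>m. k \<alpha> (s2 \<alpha>) m * (g (1 * z \<alpha> (s2 \<alpha>) m) - g 0) - tb m * (g (1 * tb m) - g 0)) (C4 * w)"
      unfolding tb_def p2_def[symmetric] w_def by (rule serD[OF 4 \<alpha>(1) al(4) s(3,4)]) (use K' \<alpha>(1) in auto)
    have b5: "sum_bound (\<lambda>m. k \<alpha> (S \<alpha>) m * (g (\<tau> * z \<alpha> (S \<alpha>) m) - g 0) - tc m * (g (\<tau> * tc m) - g 0)) (C5 * w)"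
      if "\<bar>\<tau>\<bar> = 1" for \<tau>
      unfolding tc_def w_def by (rule serD[OF 5 \<alpha>(1) al(5) s(5) order_refl that]) (use K' \<alpha>(1) in auto)
    have le: "C1 * \<alpha>\<^sup>2 \<le> C * w" "C2 * \<alpha>\<^sup>2 \<le> C * w" "C3 * w + C5 * w \<le> C * w" "C4 * w + C5 * w \<le> C * w"
      unfolding distrib_right[symmetric]
      by (intro mult_mono ww; use Cn w0 in \<open>simp add: C_def\<close>)+
    note d1 = sum_bound_diffD[OF b1 smc(1)] and d2 = sum_bound_diffD[OF b2 smc(2)]
    have sa: "summable (\<lambda>m. ta m * (g (- 1 * ta m) - g 0))" unfolding ta_def p1_def[symmetric] by (rule sms) (use p in auto)
    have sb: "summable (\<lambda>m. tb m * (g (1 * tb m) - g 0))" unfolding tb_def p2_def[symmetric] by (rule sms) (use p in auto)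
    have sc: "summable (\<lambda>m. tc m * (g (\<tau> * tc m) - g 0))" if "\<bar>\<tau>\<bar> = 1" for \<tau> unfolding tc_def by (rule sms) (use p that in auto)
    have t: "\<bar>1::real\<bar> = 1" "\<bar>- 1::real\<bar> = 1" by simp_all
    note d3 = sum_bound_diffD[OF b3 sa] and d4 = sum_bound_diffD[OF b4 sb]
    note d5 = sum_bound_diffD[OF b5[OF t(1)] sc[OF t(1)]] and d6 = sum_bound_diffD[OF b5[OF t(2)] sc[OF t(2)]]
    show "\<bar>(\<Sum>m. k \<alpha> (s1 \<alpha>) m - k \<alpha> (S \<alpha>) m) - (\<Sum>m. ta m - tc m)\<bar> \<le> C * (\<alpha>\<^sup>2 * (1 + \<bar>ln \<alpha>\<bar>))"
      "\<bar>(\<Sum>m. k \<alpha> (s2 \<alpha>) m - k \<alpha> (S \<alpha>) m) - (\<Sum>m. tb m - tc m)\<bar> \<le> C * (\<alpha>\<^sup>2 * (1 + \<bar>ln \<alpha>\<bar>))"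
      using d1(2) d2(2) le unfolding w_def[symmetric] by linarith+
    show "\<bar>(\<Sum>m. k \<alpha> (s1 \<alpha>) m * (g (- 1 * z \<alpha> (s1 \<alpha>) m) - g 0) - k \<alpha> (S \<alpha>) m * (g (1 * z \<alpha> (S \<alpha>) m) - g 0)) -
      ((\<Sum>m. ta m * (g (- 1 * ta m) - g 0)) - (\<Sum>m. tc m * (g (1 * tc m) - g 0)))\<bar> \<le> C * (\<alpha>\<^sup>2 * (1 + \<bar>ln \<alpha>\<bar>))"
      using d3(2) d5(2) le unfolding suminf_diff[OF d3(1) d5(1), symmetric] w_def[symmetric] by linarith
    show "\<bar>(\<Sum>m. k \<alpha> (s2 \<alpha>) m * (g (1 * z \<alpha> (s2 \<alpha>) m) - g 0) - k \<alpha> (S \<alpha>) m * (g (- 1 * z \<alpha> (S \<alpha>) m) - g 0)) -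
      ((\<Sum>m. tb m * (g (1 * tb m) - g 0)) - (\<Sum>m. tc m * (g (- 1 * tc m) - g 0)))\<bar> \<le> C * (\<alpha>\<^sup>2 * (1 + \<bar>ln \<alpha>\<bar>))"
      using d4(2) d6(2) le unfolding suminf_diff[OF d4(1) d6(1), symmetric] w_def[symmetric] by linarith
  qed
qed

section \<open>The limit of the concentration factor\<close>

text \<open>The indices cross: the charges that start at the centre of ball 1 have initial offset
  \<open>1 / r1\<close>, and \<open>(1 / r1) / q\<close> is \<open>rt2\<close>. Likewise ball 2 goes
  with \<open>rt1\<close>.\<close>

lemma offset_conv:
  assumes r: "r1 > 0" "r2 > 0"
  defines "q \<equiv> 1 / r1 + 1 / r2"
  shows "rt r1 r2 / (real m + 1) = offset q q m" "rt r1 r2 / (real m + rt2 r1 r2) = offset (1 / r1) q m"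
    "rt r1 r2 / (real m + rt1 r1 r2) = offset (1 / r2) q m"
proof -
  have q: "q > 0" "rt r1 r2 = 1 / q" "rt2 r1 r2 = (1 / r1) / q" "rt1 r1 r2 = (1 / r2) / q"
    using r by (auto simp: q_def rt_def rt1_def rt2_def field_simps add_pos_pos)
  have *: "1 / q / (real m + p / q) = offset p q m" for p
    using q(1) by (simp add: offset_def field_simps)
  show "rt r1 r2 / (real m + 1) = offset q q m" "rt r1 r2 / (real m + rt2 r1 r2) = offset (1 / r1) q m"
    "rt r1 r2 / (real m + rt1 r1 r2) = offset (1 / r2) q m"
    using *[of q] *[of "1 / r1"] *[of "1 / r2"] q by simp_all
qed

section \<open>The limit series as digamma and polygamma values\<close>

lemma offset_eq_inverse:
  assumes "p > 0" "q > 0"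
  shows "offset p q m = 1 / q * inverse (p / q + real m)"
  using assms by (simp add: offset_def field_simps)

lemma offset_diff_suminf:
  assumes "p > 0" "q > 0"
  shows "(\<Sum>m. offset p q m - offset q q m) = - (1 / q) * (Digamma (p / q) + euler_mascheroni)"
proof -
  have "p / q \<noteq> 0" using assms by simp
  note s = summable_Digamma[OF this]
  have "offset p q m - offset q q m = - (1 / q) * (inverse (of_nat (Suc m)) - inverse (p / q + of_nat m))" for m
    using assms unfolding offset_eq_inverse[OF assms] offset_eq_inverse[OF assms(2,2)] by (simp add: right_diff_distrib)
  then have "(\<Sum>m. offset p q m - offset q q m) =
      - (1 / q) * (\<Sum>m. inverse (of_nat (Suc m)) - inverse (p / q + of_nat m))"
    by (simp only: suminf_mult[OF s])
  then show ?thesis unfolding Digamma_def[of "p / q"] by simp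
qed

lemma offset_diff_suminf_pos:
  assumes "0 < p" "p < q"
  shows "(\<Sum>m. offset p q m - offset q q m) > 0"
proof (rule suminf_pos)
  show "summable (\<lambda>m. offset p q m - offset q q m)" using assms by (intro summable_offset_diff) auto
  show "0 < offset p q m - offset q q m" for m
    using assms by (auto simp: offset_def intro!: divide_strict_left_mono mult_pos_pos add_pos_nonneg)
qed

lemma offset_power_suminf:
  assumes "p > 0" "q > 0"
  shows "(\<Sum>m. offset p q m ^ (k + 2)) = (1 / q) ^ (k + 2) * ((- 1) ^ k * Polygamma (Suc k) (p / q) / fact (Suc k))"
proof -
  have "p / q \<noteq> 0" using assms by simp
  from sums_mult[OF Polygamma_LIMSEQ[OF this, of "Suc k"], of "(1 / q) ^ (k + 2)"]
  have "(\<lambda>m. (1 / q) ^ (k + 2) * inverse ((p / q + real m) ^ (k + 2))) sums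
      ((1 / q) ^ (k + 2) * ((- 1) ^ k * Polygamma (Suc k) (p / q) / fact (Suc k)))" by simp
  then show ?thesis
    unfolding offset_eq_inverse[OF assms] power_mult_distrib power_inverse by (rule sums_unique[symmetric])
qed

lemma offset_power_suminf_zeta:
  assumes "q > 0"
  shows "(\<Sum>m. offset q q m ^ (k + 2)) = (1 / q) ^ (k + 2) * zeta_nat (k + 2)"
proof -
  have "offset q q m ^ (k + 2) = (1 / q) ^ (k + 2) * (1 / real (Suc m) ^ (k + 2))" for m
    using assms unfolding offset_eq_inverse[OF assms assms] power_mult_distrib by (simp add: power_one_over inverse_eq_divide)
  moreover have "summable (\<lambda>m. 1 / real (Suc m) ^ (k + 2))"
    using Polygamma_LIMSEQ[of "1 :: real" "Suc k"] by (simp add: sums_iff inverse_eq_divide)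
  ultimately show ?thesis unfolding zeta_nat_def by (simp only: suminf_mult)
qed

text \<open>The crossing again: \<open>a\<close> belongs to \<open>rt2\<close> and \<open>b\<close>
  to \<open>rt1\<close>, so \<open>mu1\<close> is the share of \<open>b\<close>. Positivity of
  \<open>a\<close> and \<open>b\<close> makes the limiting denominator \<open>a + b\<close>
  nonzero.\<close>

lemma mu_eq:
  assumes r: "r1 > 0" "r2 > 0"
  defines "q \<equiv> 1 / r1 + 1 / r2"
  defines "a \<equiv> \<Sum>m. offset (1 / r1) q m - offset q q m" and "b \<equiv> \<Sum>m. offset (1 / r2) q m - offset q q m"
  shows "a > 0" "b > 0" "mu1 r1 r2 = b / (a + b)" "mu2 r1 r2 = a / (a + b)"
proof -
  have q: "q > 0" "rt2 r1 r2 = (1 / r1) / q" "rt1 r1 r2 = (1 / r2) / q"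
    using r by (auto simp: q_def rt1_def rt2_def field_simps add_pos_pos)
  have a: "a = - (1 / q) * (Digamma (rt2 r1 r2) + euler_mascheroni)"
    unfolding a_def q(2) using r q(1) by (intro offset_diff_suminf) auto
  have b: "b = - (1 / q) * (Digamma (rt1 r1 r2) + euler_mascheroni)"
    unfolding b_def q(3) using r q(1) by (intro offset_diff_suminf) auto
  have ab: "a + b = - (1 / q) * (Digamma (rt1 r1 r2) + Digamma (rt2 r1 r2) + 2 * euler_mascheroni)"
    unfolding a b by (simp only: distrib_left[symmetric]) simp
  show "a > 0" "b > 0" unfolding a_def b_def using r by (intro offset_diff_suminf_pos; simp add: q_def)+
  have "- (1 / q) \<noteq> 0" using q(1) by simp
  note c = mult_divide_mult_cancel_left[OF this]
  show "mu1 r1 r2 = b / (a + b)" "mu2 r1 r2 = a / (a + b)"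
    unfolding ab unfolding a b c mu1_def mu2_def by simp_all
qed

section \<open>The limit for a fixed entire harmonic function\<close>

context
  fixes r1 r2 :: real and H :: "real ^ 3 \<Rightarrow> real" and g :: "real \<Rightarrow> real"
    and q :: real and ta tb tc :: "nat \<Rightarrow> real" and a b Sa Sb :: real and Sc :: "real \<Rightarrow> real"
  assumes r: "r1 > 0" "r2 > 0" and H: "harmonic_on UNIV H"
  defines "g \<equiv> \<lambda>t. H (t *\<^sub>R vector [0, 0, 1])"
    and "q \<equiv> 1 / r1 + 1 / r2"
    and "ta \<equiv> offset (1 / r1) q" and "tb \<equiv> offset (1 / r2) q" and "tc \<equiv> offset q q"
    and "a \<equiv> \<Sum>m. ta m - tc m" and "b \<equiv> \<Sum>m. tb m - tc m"
    and "Sa \<equiv> \<Sum>m. ta m * (g (- 1 * ta m) - g 0)" and "Sb \<equiv> \<Sum>m. tb m * (g (1 * tb m) - g 0)"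
    and "Sc \<equiv> \<lambda>\<tau>. \<Sum>m. tc m * (g (\<tau> * tc m) - g 0)"
begin

lemma q_pos: "q > 0" "1 / r1 > 0" "1 / r2 > 0"
  using r by (auto simp: q_def add_pos_pos)

lemma axis_sums: "(\<lambda>k. taylor_coeff H k * t ^ k) sums g t"
  unfolding g_def by (rule taylor_coeff_sums[OF H])

lemmas sums_a = offset_series_sums[OF q_pos(2,1) _ axis_sums, of "- 1", folded ta_def, simplified]
  and sums_b = offset_series_sums[OF q_pos(3,1) _ axis_sums, of 1, folded tb_def, simplified]
  and sums_c = offset_series_sums[OF q_pos(1,1) _ axis_sums, folded tc_def]

text \<open>\<open>C_lim\<close> is written with \<open>H\<close> itself, the asymptotics with
  \<open>H - H 0\<close>. The constant contributes a multiple of \<open>mu2 * b - mu1 * a\<close>,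
  which is 0 by the formulas for the two weights.\<close>

lemma C_terms:
  "summable (C_term1 r1 r2 H)" "summable (C_term2 r1 r2 H)"
  "C_lim r1 r2 H = 4 * pi * (mu1 r1 r2 * (Sc 1 - Sa) + mu2 r1 r2 * (Sb - Sc (- 1)))"
proof -
  have v: "H (vector [0, 0, x]) = g x" for x
    unfolding g_def by (rule arg_cong[of _ _ H]) (simp add: vector_3_eq_iff)
  note o = offset_conv[OF r, folded q_def, folded ta_def tb_def tc_def]
  have n: "- rt r1 r2 / x = - (rt r1 r2 / x)" for x by simp
  have t1: "C_term1 r1 r2 H = (\<lambda>m. tc m * (g (tc m) - g 0) - ta m * (g (- ta m) - g 0) - g 0 * (ta m - tc m))"
    unfolding C_term1_def n o v by (simp add: fun_eq_iff right_diff_distrib left_diff_distrib mult_ac)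
  have t2: "C_term2 r1 r2 H = (\<lambda>m. tb m * (g (tb m) - g 0) - tc m * (g (- tc m) - g 0) + g 0 * (tb m - tc m))"
    unfolding C_term2_def n o v by (simp add: fun_eq_iff right_diff_distrib left_diff_distrib mult_ac)
  have sd: "(\<lambda>m. ta m - tc m) sums a" "(\<lambda>m. tb m - tc m) sums b"
    unfolding a_def b_def ta_def tb_def tc_def by (intro summable_sums summable_offset_diff q_pos)+
  have sA: "(\<lambda>m. ta m * (g (- ta m) - g 0)) sums Sa" "(\<lambda>m. tb m * (g (tb m) - g 0)) sums Sb"
    "(\<lambda>m. tc m * (g (tc m) - g 0)) sums Sc 1" "(\<lambda>m. tc m * (g (- tc m) - g 0)) sums Sc (- 1)"
    using sums_a(1) sums_b(1) sums_c(1)[of 1] sums_c(1)[of "- 1"] by (simp_all add: Sa_def Sb_def Sc_def summable_sums)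
  have s1: "C_term1 r1 r2 H sums (Sc 1 - Sa - g 0 * a)"
    unfolding t1 by (intro sums_diff sums_mult sA sd)
  have s2: "C_term2 r1 r2 H sums (Sb - Sc (- 1) + g 0 * b)"
    unfolding t2 by (intro sums_diff sums_add sums_mult sA sd)
  show "summable (C_term1 r1 r2 H)" "summable (C_term2 r1 r2 H)" using s1 s2 by (auto simp: sums_iff)
  note mu = mu_eq[OF r, folded q_def, folded ta_def tb_def tc_def, folded a_def b_def]
  have "mu1 r1 r2 * a = mu2 r1 r2 * b" unfolding mu(3,4) by simp
  moreover have "C_lim r1 r2 H = 4 * pi * (mu1 r1 r2 * (Sc 1 - Sa) + mu2 r1 r2 * (Sb - Sc (- 1))) +
      4 * pi * g 0 * (mu2 r1 r2 * b - mu1 r1 r2 * a)"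
    unfolding C_lim_def sums_unique[OF s1, symmetric] sums_unique[OF s2, symmetric] by (simp add: algebra_simps)
  ultimately show "C_lim r1 r2 H = 4 * pi * (mu1 r1 r2 * (Sc 1 - Sa) + mu2 r1 r2 * (Sb - Sc (- 1)))" by simp
qed

lemma C_lim_eq: "C_lim r1 r2 H = 4 * pi * ((a * (Sb - Sc (- 1)) - b * (Sa - Sc 1)) / (a + b))"
proof -
  note mu = mu_eq[OF r, folded q_def, folded ta_def tb_def tc_def, folded a_def b_def]
  have "b / (a + b) * (Sc 1 - Sa) + a / (a + b) * (Sb - Sc (- 1)) = (a * (Sb - Sc (- 1)) - b * (Sa - Sc 1)) / (a + b)"
    by (simp add: add_divide_distrib[symmetric] diff_divide_distrib[symmetric]) (simp add: algebra_simps)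
  then show ?thesis unfolding C_terms(3) mu(3,4) by simp
qed

lemma Q_eq:
  "Q (Suc k) r1 r2 = 4 * pi *
     (mu1 r1 r2 * ((\<Sum>m. tc m ^ (k + 2)) - (- 1) ^ Suc k * (\<Sum>m. ta m ^ (k + 2))) +
      mu2 r1 r2 * ((\<Sum>m. tb m ^ (k + 2)) - (- 1) ^ Suc k * (\<Sum>m. tc m ^ (k + 2))))"
proof -
  have e: "1 / q = rt r1 r2" "(1 / r1) / q = rt2 r1 r2" "(1 / r2) / q = rt1 r1 r2"
    using r by (auto simp: q_def rt_def rt1_def rt2_def field_simps add_pos_pos)
  have a: "(\<Sum>m. ta m ^ (k + 2)) = rt r1 r2 ^ (k + 2) * ((- 1) ^ k * Polygamma (Suc k) (rt2 r1 r2) / fact (Suc k))"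
    unfolding ta_def offset_power_suminf[OF q_pos(2,1)] e ..
  have b: "(\<Sum>m. tb m ^ (k + 2)) = rt r1 r2 ^ (k + 2) * ((- 1) ^ k * Polygamma (Suc k) (rt1 r1 r2) / fact (Suc k))"
    unfolding tb_def offset_power_suminf[OF q_pos(3,1)] e ..
  have c: "(\<Sum>m. tc m ^ (k + 2)) = rt r1 r2 ^ (k + 2) * zeta_nat (k + 2)"
    unfolding tc_def offset_power_suminf_zeta[OF q_pos(1)] e ..
  \<comment> \<open>\<open>s\<close> stands for \<open>(- 1) ^ k\<close>, the sign of the polygamma
    values; only \<open>s * s = 1\<close> matters.\<close>
  have alg: "4 * pi * R * ((m1 + s * m2) * Z + (m1 * P2 + s * m2 * P1) / F) =
      4 * pi * (m1 * (R * Z - - s * (R * (s * P2 / F))) + m2 * (R * (s * P1 / F) - - s * (R * Z)))"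
    if "s = 1 \<or> s = - 1" for R m1 m2 s Z P1 P2 F :: real
    using that by (elim disjE) (simp_all add: algebra_simps add_divide_distrib diff_divide_distrib)
  have s: "(- 1 :: real) ^ k = 1 \<or> (- 1 :: real) ^ k = - 1" by (cases "even k") simp_all
  have e2: "Suc k + 1 = k + 2" "(- 1 :: real) ^ (k + 2) = (- 1) ^ k" "(- 1 :: real) ^ Suc k = - ((- 1) ^ k)" by simp_all
  show ?thesis unfolding Q_def a b c e2 by (rule alg[OF s])
qed

lemma taylor_series_sums: "(\<lambda>k. taylor_coeff H (Suc k) * Q (Suc k) r1 r2) sums C_lim r1 r2 H"
proof -
  have sc: "(\<lambda>k. taylor_coeff H (Suc k) * 1 ^ Suc k * (\<Sum>m. tc m ^ (k + 2))) sums Sc 1"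
    "(\<lambda>k. taylor_coeff H (Suc k) * (- 1) ^ Suc k * (\<Sum>m. tc m ^ (k + 2))) sums Sc (- 1)"
    unfolding Sc_def by (intro sums_c(2); simp)+
  have sa: "(\<lambda>k. taylor_coeff H (Suc k) * (- 1) ^ Suc k * (\<Sum>m. ta m ^ (k + 2))) sums Sa"
    unfolding Sa_def ta_def by (intro offset_series_sums(2) q_pos axis_sums) simp
  have sb: "(\<lambda>k. taylor_coeff H (Suc k) * 1 ^ Suc k * (\<Sum>m. tb m ^ (k + 2))) sums Sb"
    unfolding Sb_def tb_def by (intro offset_series_sums(2) q_pos axis_sums) simp
  have "(\<lambda>k. 4 * pi * (
      mu1 r1 r2 * (taylor_coeff H (Suc k) * 1 ^ Suc k * (\<Sum>m. tc m ^ (k + 2)) -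
        taylor_coeff H (Suc k) * (- 1) ^ Suc k * (\<Sum>m. ta m ^ (k + 2))) +
      mu2 r1 r2 * (taylor_coeff H (Suc k) * 1 ^ Suc k * (\<Sum>m. tb m ^ (k + 2)) -
        taylor_coeff H (Suc k) * (- 1) ^ Suc k * (\<Sum>m. tc m ^ (k + 2))))) sums C_lim r1 r2 H"
    unfolding C_terms(3) by (intro sums_mult sums_add sums_diff sa sb sc)
  moreover have "4 * pi * (m1 * (t * 1 * Z - t * s * A) + m2 * (t * 1 * B - t * s * Z)) =
      t * (4 * pi * (m1 * (Z - s * A) + m2 * (B - s * Z)))" for m1 m2 t Z s A B :: real
    by (simp add: algebra_simps)
  ultimately show ?thesis unfolding Q_eq power_one by (simp only:)
qed

text \<open>\<open>concentration_factor_eq\<close> and \<open>C_lim_eq\<close> have the same shape,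
  with four series in the first replaced by their limits in the second. The error passes through
  products and the quotient because \<open>a + b\<close> is not 0.\<close>

lemma concentration_factor_bigo:
  fixes u h :: "real \<Rightarrow> real ^ 3 \<Rightarrow> real"
  assumes u: "\<And>\<epsilon>. \<epsilon> > 0 \<Longrightarrow> is_u r1 r2 H \<epsilon> (u \<epsilon>)" and h: "\<And>\<epsilon>. \<epsilon> > 0 \<Longrightarrow> is_h r1 r2 \<epsilon> (h \<epsilon>)"
  shows "(\<lambda>\<epsilon>. concentration_factor r1 r2 \<epsilon> (u \<epsilon>) (h \<epsilon>) - C_lim r1 r2 H) \<in> O[at_right 0](\<lambda>\<epsilon>. \<epsilon> * \<bar>ln \<epsilon>\<bar>)"
proof -
  define \<alpha> where "\<alpha> = pole_dist r1 r2"
  define s1 s2 where "s1 \<alpha> = arsinh (\<alpha> / r1)" and "s2 \<alpha> = arsinh (\<alpha> / r2)" for \<alpha>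
  define S where "S \<alpha> = s1 \<alpha> + s2 \<alpha>" for \<alpha>
  define k where "k \<alpha> \<sigma> m = \<alpha> / sinh (\<sigma> + real m * S \<alpha>)" for \<alpha> \<sigma> m
  define z where "z \<alpha> \<sigma> m = \<alpha> * cosh (\<sigma> + real m * S \<alpha>) / sinh (\<sigma> + real m * S \<alpha>)" for \<alpha> \<sigma> m
  define A B where "A \<alpha> = (\<Sum>m. k \<alpha> (s1 \<alpha>) m - k \<alpha> (S \<alpha>) m)" and "B \<alpha> = (\<Sum>m. k \<alpha> (s2 \<alpha>) m - k \<alpha> (S \<alpha>) m)" for \<alpha>
  define T1 where "T1 \<alpha> = (\<Sum>m. k \<alpha> (s1 \<alpha>) m * (g (- 1 * z \<alpha> (s1 \<alpha>) m) - g 0) -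
      k \<alpha> (S \<alpha>) m * (g (1 * z \<alpha> (S \<alpha>) m) - g 0))" for \<alpha>
  define T2 where "T2 \<alpha> = (\<Sum>m. k \<alpha> (s2 \<alpha>) m * (g (1 * z \<alpha> (s2 \<alpha>) m) - g 0) -
      k \<alpha> (S \<alpha>) m * (g (- 1 * z \<alpha> (S \<alpha>) m) - g 0))" for \<alpha>
  define \<eta> where "\<eta> = (\<lambda>\<epsilon>::real. \<epsilon> * \<bar>ln \<epsilon>\<bar>)"
  have \<eta>: "(\<eta> \<longlongrightarrow> 0) (at_right 0)" unfolding \<eta>_def by real_asymp
  have Sc: "(\<Sum>m. tc m * (g (\<tau> * tc m) - g 0)) = Sc \<tau>" for \<tau> by (simp only: Sc_def)
  obtain C \<alpha>0 where C: "C \<ge> 0" "\<alpha>0 > 0" and C': "\<forall>\<alpha>. 0 < \<alpha> \<longrightarrow> \<alpha> < \<alpha>0 \<longrightarrow>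
    \<bar>A \<alpha> - a\<bar> \<le> C * (\<alpha>\<^sup>2 * (1 + \<bar>ln \<alpha>\<bar>)) \<and> \<bar>B \<alpha> - b\<bar> \<le> C * (\<alpha>\<^sup>2 * (1 + \<bar>ln \<alpha>\<bar>)) \<and>
    \<bar>T1 \<alpha> - (Sa - Sc 1)\<bar> \<le> C * (\<alpha>\<^sup>2 * (1 + \<bar>ln \<alpha>\<bar>)) \<and> \<bar>T2 \<alpha> - (Sb - Sc (- 1))\<bar> \<le> C * (\<alpha>\<^sup>2 * (1 + \<bar>ln \<alpha>\<bar>))"
    using image_series_limits[OF r axis_sums]
    unfolding q_def[symmetric] ta_def[symmetric] tb_def[symmetric] tc_def[symmetric]
      s1_def[symmetric] s2_def[symmetric] S_def[symmetric] k_def[symmetric] z_def[symmetric]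
      A_def[symmetric] B_def[symmetric] T1_def[symmetric] T2_def[symmetric] a_def[symmetric] b_def[symmetric]
      Sa_def[symmetric] Sb_def[symmetric] Sc by (elim exE conjE)
  obtain K e0 where K: "K > 0" "e0 > 0" and K': "\<forall>\<epsilon>. 0 < \<epsilon> \<longrightarrow> \<epsilon> < e0 \<longrightarrow> (\<alpha> \<epsilon>)\<^sup>2 * (1 + \<bar>ln (\<alpha> \<epsilon>)\<bar>) \<le> K * (\<epsilon> * \<bar>ln \<epsilon>\<bar>)"
    using pole_dist_log_bound[OF r] unfolding \<alpha>_def by (elim exE conjE)
  obtain c' C2 where C2: "C2 > 0" and C2': "\<forall>\<epsilon>. 0 < \<epsilon> \<longrightarrow> \<epsilon> < 1 \<longrightarrow> c' * \<epsilon> \<le> (\<alpha> \<epsilon>)\<^sup>2 \<and> (\<alpha> \<epsilon>)\<^sup>2 \<le> C2 * \<epsilon>"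
    using pole_dist_bounds[OF r] unfolding \<alpha>_def by (elim exE conjE)
  have \<alpha>_pos: "\<alpha> \<epsilon> > 0" if "\<epsilon> > 0" for \<epsilon> unfolding \<alpha>_def by (rule two_sphere_geometry(1)[OF r that])
  \<comment> \<open>The last entry forces \<open>\<alpha> \<epsilon> < \<alpha>0\<close>, through
    \<open>(\<alpha> \<epsilon>)\<^sup>2 \<le> C2 * \<epsilon>\<close>.\<close>
  define e1 where "e1 = Min {e0, 1, \<alpha>0\<^sup>2 / C2}"
  have e1: "e1 > 0" using K C C2 by (simp add: e1_def)
  have bound: "C * ((\<alpha> \<epsilon>)\<^sup>2 * (1 + \<bar>ln (\<alpha> \<epsilon>)\<bar>)) \<le> C * K * norm (\<eta> \<epsilon>)" "\<alpha> \<epsilon> < \<alpha>0" if "0 < \<epsilon>" "\<epsilon> < e1" for \<epsilon>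
  proof -
    have e: "\<epsilon> < e0" "\<epsilon> < 1" "\<epsilon> < \<alpha>0\<^sup>2 / C2" using that by (simp_all add: e1_def)
    have "C * ((\<alpha> \<epsilon>)\<^sup>2 * (1 + \<bar>ln (\<alpha> \<epsilon>)\<bar>)) \<le> C * (K * (\<epsilon> * \<bar>ln \<epsilon>\<bar>))"
      using K' that(1) e(1) C by (intro mult_left_mono) auto
    also have "\<dots> = C * K * norm (\<eta> \<epsilon>)" using that by (simp add: \<eta>_def abs_mult)
    finally show "C * ((\<alpha> \<epsilon>)\<^sup>2 * (1 + \<bar>ln (\<alpha> \<epsilon>)\<bar>)) \<le> C * K * norm (\<eta> \<epsilon>)" .
    have "(\<alpha> \<epsilon>)\<^sup>2 \<le> C2 * \<epsilon>" using C2' that(1) e(2) by simp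
    also have "\<dots> < \<alpha>0\<^sup>2" using e(3) C2 by (simp add: field_simps)
    finally show "\<alpha> \<epsilon> < \<alpha>0" using C(2) by (simp add: power_less_imp_less_base)
  qed
  have O: "(\<lambda>\<epsilon>. f (\<alpha> \<epsilon>) - L) \<in> O[at_right 0](\<eta>)"
    if "\<And>\<alpha>. 0 < \<alpha> \<Longrightarrow> \<alpha> < \<alpha>0 \<Longrightarrow> \<bar>f \<alpha> - L\<bar> \<le> C * (\<alpha>\<^sup>2 * (1 + \<bar>ln \<alpha>\<bar>))" for f L
  proof (rule bigoI)
    have "\<forall>\<^sub>F \<epsilon> in at_right 0. 0 < \<epsilon> \<and> \<epsilon> < e1"
      using e1 by (auto simp: eventually_at_right_field)
    then show "\<forall>\<^sub>F \<epsilon> in at_right 0. norm (f (\<alpha> \<epsilon>) - L) \<le> C * K * norm (\<eta> \<epsilon>)"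
    proof eventually_elim
      case (elim \<epsilon>)
      then show ?case using that[OF \<alpha>_pos bound(2), of \<epsilon>] bound(1)[of \<epsilon>] by simp
    qed
  qed
  have OA: "(\<lambda>\<epsilon>. A (\<alpha> \<epsilon>) - a) \<in> O[at_right 0](\<eta>)" and OB: "(\<lambda>\<epsilon>. B (\<alpha> \<epsilon>) - b) \<in> O[at_right 0](\<eta>)"
    and O1: "(\<lambda>\<epsilon>. T1 (\<alpha> \<epsilon>) - (Sa - Sc 1)) \<in> O[at_right 0](\<eta>)"
    and O2: "(\<lambda>\<epsilon>. T2 (\<alpha> \<epsilon>) - (Sb - Sc (- 1))) \<in> O[at_right 0](\<eta>)"
    by (rule O; use C' in simp)+
  note PA = product_bigo[OF OA O2 \<eta>] and PB = product_bigo[OF OB O1 \<eta>]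
  have N: "(\<lambda>\<epsilon>. (A (\<alpha> \<epsilon>) * T2 (\<alpha> \<epsilon>) - B (\<alpha> \<epsilon>) * T1 (\<alpha> \<epsilon>)) - (a * (Sb - Sc (- 1)) - b * (Sa - Sc 1))) \<in> O[at_right 0](\<eta>)"
    using sum_in_bigo(2)[OF PA PB] by (simp add: algebra_simps)
  have D: "(\<lambda>\<epsilon>. (A (\<alpha> \<epsilon>) + B (\<alpha> \<epsilon>)) - (a + b)) \<in> O[at_right 0](\<eta>)"
    using sum_in_bigo(1)[OF OA OB] by (simp add: algebra_simps)
  note mu = mu_eq[OF r, folded q_def, folded ta_def tb_def tc_def, folded a_def b_def]
  have "a + b \<noteq> 0" using mu(1,2) by simp
  note Qt = quotient_bigo[OF N D \<eta> this]
  have "(\<lambda>\<epsilon>. 4 * pi * ((A (\<alpha> \<epsilon>) * T2 (\<alpha> \<epsilon>) - B (\<alpha> \<epsilon>) * T1 (\<alpha> \<epsilon>)) / (A (\<alpha> \<epsilon>) + B (\<alpha> \<epsilon>)) -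
      (a * (Sb - Sc (- 1)) - b * (Sa - Sc 1)) / (a + b))) \<in> O[at_right 0](\<eta>)"
    using Qt(1) by simp
  \<comment> \<open>The denominator is known to be nonzero only for small \<epsilon>, which is
    enough for a Landau symbol at 0.\<close>
  moreover have "\<forall>\<^sub>F \<epsilon> in at_right 0. 4 * pi * ((A (\<alpha> \<epsilon>) * T2 (\<alpha> \<epsilon>) - B (\<alpha> \<epsilon>) * T1 (\<alpha> \<epsilon>)) / (A (\<alpha> \<epsilon>) + B (\<alpha> \<epsilon>)) -
      (a * (Sb - Sc (- 1)) - b * (Sa - Sc 1)) / (a + b)) =
      concentration_factor r1 r2 \<epsilon> (u \<epsilon>) (h \<epsilon>) - C_lim r1 r2 H"
    using Qt(2) eventually_at_right_less[of 0]
  proof eventually_elim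
    case (elim \<epsilon>)
    have S_Suc: "(real m + 1) * S \<alpha> = S \<alpha> + real m * S \<alpha>" for m \<alpha> by (simp add: distrib_right)
    have g0: "H 0 = g 0" and gD: "\<And>t. H (t *\<^sub>R vector [0, 0, 1]) = g t" by (simp_all add: g_def)
    note cf = concentration_factor_eq[OF r elim(2) H u[OF elim(2)] h[OF elim(2)],
      folded \<alpha>_def, folded s1_def s2_def, folded S_def, unfolded S_Suc, unfolded coth_point_eq(2), unfolded coth_point_eq(1),
      folded k_def z_def, unfolded g0 gD]
    have "concentration_factor r1 r2 \<epsilon> (u \<epsilon>) (h \<epsilon>) =
        4 * pi * (A (\<alpha> \<epsilon>) * T2 (\<alpha> \<epsilon>) - B (\<alpha> \<epsilon>) * T1 (\<alpha> \<epsilon>)) / (A (\<alpha> \<epsilon>) + B (\<alpha> \<epsilon>))"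
      using cf elim(1) unfolding A_def B_def T1_def T2_def by simp
    then show ?case unfolding C_lim_eq by (simp only: right_diff_distrib times_divide_eq_right)
  qed
  note landau_o.big.in_cong[OF this]
  ultimately show ?thesis unfolding \<eta>_def by simp
qed

end

lemma axis_taylor_sums:
  assumes "harmonic_on UNIV H"
  shows "(\<lambda>k. taylor_coeff H (Suc k) * t ^ Suc k) sums (H (t *\<^sub>R vector [0, 0, 1]) - H 0)"
proof -
  note s = taylor_coeff_sums[OF assms]
  have "H 0 = taylor_coeff H 0" using sums_unique2[OF s[of 0] powser_sums_zero] by simp
  then show ?thesis
    using sums_Suc_iff[of "\<lambda>k. taylor_coeff H k * t ^ k" "H (t *\<^sub>R vector [0, 0, 1]) - H 0"] s[of t] by simp
qed

theorem theorem2p1: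
  fixes r1 r2 :: real and H :: "real ^ 3 \<Rightarrow> real" and u h :: "real \<Rightarrow> real ^ 3 \<Rightarrow> real"
  assumes "r1 > 0" and "r2 > 0"
    and "harmonic_on UNIV H"
    and "\<And>\<epsilon>. \<epsilon> > 0 \<Longrightarrow> is_u r1 r2 H \<epsilon> (u \<epsilon>)"
    and "\<And>\<epsilon>. \<epsilon> > 0 \<Longrightarrow> is_h r1 r2 \<epsilon> (h \<epsilon>)"
  shows "(summable (C_term1 r1 r2 H) \<and> summable (C_term2 r1 r2 H) \<and>
          (\<lambda>\<epsilon>. concentration_factor r1 r2 \<epsilon> (u \<epsilon>) (h \<epsilon>) - C_lim r1 r2 H)
            \<in> O[at_right 0](\<lambda>\<epsilon>. \<epsilon> * \<bar>ln \<epsilon>\<bar>)) \<and>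
         ((\<forall>t. (\<lambda>k. taylor_coeff H (Suc k) * t ^ Suc k) sums (H (t *\<^sub>R vector [0, 0, 1]) - H 0)) \<and>
          (\<lambda>k. taylor_coeff H (Suc k) * Q (Suc k) r1 r2) sums C_lim r1 r2 H)"
  using C_terms(1,2)[OF assms(1-3)] concentration_factor_bigo[OF assms] axis_taylor_sums[OF assms(3)]
    taylor_series_sums[OF assms(1-3)] by (intro conjI allI)

end
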